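(* Let $d, k \in \mathbb{N}$ with $1<k<d$. Let $\Omega$ be a bounded Lipschitz domain in $\mathbb{R}^{d}$, and let $K \subset \Omega$ be a smooth compact set of class $C^{0,1}$ of codimension $k$ (in the sense defined in the context). Let $p>1$ and $s \in (0,1)$ be such that $sp=d$. Then for any $u \in W^{s,p}_{0}(\Omega \setminus K)$ and any $\alpha>0$, $$\int_{\Omega} \Phi_{d,s}\left(\alpha |u(x)|^{\frac{d}{d-s}}\right) \frac{1}{\delta^{d}_{K}(x)}\,dx < \infty.$$
   Context: Distance: for $K \subset \Omega$ compact and $x \in \Omega$, $\delta_{K}(x) := \inf_{y \in K}|x-y|$. Smooth compact set of class $C^{0,1}$ of codimension $k$: let $k \in \mathbb{N}$, $1<k<d$, and let $Q = B^{k}_{1}(0) \times (0,1)^{d-k}$, where $B^{k}_{1}(0) \subset \mathbb{R}^{k}$ is the unit ball centred at $0$; write $\xi = (\xi_{k},\xi_{d-k}) \in Q$ with $\xi_{k} \in B^{k}_{1}(0)$, $\xi_{d-k} \in (0,1)^{d-k}$. A compact surface $K \subset \Omega$ of codimension $k$ in $\mathbb{R}^{d}$ is of class $C^{0,1}$ if there exists $C>0$ such that for every $x \in K$ there exist a ball $B = B_{r}(x) \subset \mathbb{R}^{d}$, $r>0$, and an isomorphism (bijection) $T: Q \to B$ such that $T \in C^{0,1}(\overline{Q})$, $T^{-1} \in C^{0,1}(\overline{B})$, $\|T\|_{C^{0,1}(\overline{Q})} + \|T^{-1}\|_{C^{0,1}(\overline{B})} \leq C$, and $T^{-1}(B \cap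 K) = \{(\xi_{k},\xi_{d-k}) \in Q : \xi_{k}=0\}$; moreover, for any $y \in (\Omega \setminus K) \cap B$ with $y = T((\xi_{k},\xi_{d-k}))$ one has $\delta_{K}(y) \sim |\xi_{k}|$, i.e. $C_{1}|\xi_{k}| \leq \delta_{K}(y) \leq C_{2}|\xi_{k}|$ for some $C_{1},C_{2}>0$ very close to $1$. Function spaces: $[u]_{W^{s,p}(\Omega)} = \left( \int_{\Omega}\int_{\Omega} \frac{|u(x)-u(y)|^{p}}{|x-y|^{d+sp}}\,dx\,dy \right)^{1/p}$ and $\|u\|_{W^{s,p}(\Omega)} = \left([u]^{p}_{W^{s,p}(\Omega)} + \|u\|^{p}_{L^{p}(\Omega)}\right)^{1/p}$. $W^{s,p}_{0}(\Omega \setminus K)$ is the closure of $C^{\infty}_{c}(\Omega \setminus K)$ with respect to $\|\cdot\|_{W^{s,p}(\Omega)}$. The function $\Phi_{d,s}$: $\Phi_{d,s}(t) := \exp(t) - \sum_{i=0}^{j_{p}-2} \frac{t^{i}}{i!}$, where $j_{p} = \min\{j \in \mathbb{N} : j \geq p\}$ (and $p = d/s$). *)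

theory Defs
  imports "HOL-Analysis.Analysis"
begin

subsection \<open>Bounded Lipschitz domains\<close>

text \<open>
  Locally, after a rigid motion, the domain is the set strictly above the graph of a Lipschitz
  function.  The unit vector \<open>e\<close> is the vertical axis of the rotated coordinates centred at the
  boundary point \<open>z\<close>; the hyperplane orthogonal to \<open>e\<close> plays the role of the space of the first
  \<open>d - 1\<close> coordinates.
\<close>

definition bounded_Lipschitz_domain :: "(real ^ 'd) set \<Rightarrow> bool" where
  "bounded_Lipschitz_domain \<Omega> \<longleftrightarrow>
     open \<Omega> \<and> connected \<Omega> \<and> \<Omega> \<noteq> {} \<and> bounded \<Omega> \<and>
     (\<forall>z\<in>frontier \<Omega>. \<exists>r>0. \<exists>e. \<exists>\<gamma> :: real ^ 'd \<Rightarrow> real. \<exists>L.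
        norm e = 1 \<and> L-lipschitz_on {v. v \<bullet> e = 0} \<gamma> \<and>
        \<Omega> \<inter> ball z r =
          {x \<in> ball z r. \<gamma> ((x - z) - ((x - z) \<bullet> e) *\<^sub>R e) < (x - z) \<bullet> e})"


subsection \<open>Compact surfaces of class \<open>C\<^sup>0\<^sup>,\<^sup>1\<close> of a given codimension\<close>

definition C01 :: "'a::real_normed_vector set \<Rightarrow> ('a \<Rightarrow> 'b::real_normed_vector) \<Rightarrow> bool" where
  "C01 X f \<longleftrightarrow> bounded (f ` X) \<and> (\<exists>L. L-lipschitz_on X f)"

definition C01_norm :: "'a::real_normed_vector set \<Rightarrow> ('a \<Rightarrow> 'b::real_normed_vector) \<Rightarrow> real" where
  "C01_norm X f =
     (SUP x\<in>X. norm (f x)) +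
     (SUP (x, y)\<in>{(x, y). x \<in> X \<and> y \<in> X \<and> x \<noteq> y}. norm (f x - f y) / norm (x - y))"

text \<open>
  A point of the reference cylinder is a pair \<open>(\<xi>\<^sub>k, \<xi>\<^sub>d\<^sub>-\<^sub>k)\<close>; the library norm on the product type is
  the Euclidean norm.
\<close>

definition reference_cylinder :: "((real ^ 'k) \<times> (real ^ 'm)) set" where
  "reference_cylinder = ball 0 1 \<times> {\<eta>. \<forall>i. 0 < \<eta> $ i \<and> \<eta> $ i < 1}"

text \<open>
  The two type arguments supply the codimension \<open>k = CARD('k)\<close> and the dimension
  \<open>d - k = CARD('m)\<close> of the surface.  The function \<open>S\<close> is the inverse chart, taken on the closed
  ball together with its Lipschitz extension to the boundary.
\<close>

definition C01_compact_surface ::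
    "'k::finite itself \<Rightarrow> 'm::finite itself \<Rightarrow> (real ^ 'd) set \<Rightarrow> (real ^ 'd) set \<Rightarrow> bool" where
  "C01_compact_surface _ _ \<Omega> K \<longleftrightarrow>
     compact K \<and> K \<subseteq> \<Omega> \<and>
     (\<exists>C>0. \<forall>x\<in>K. \<exists>r>0.
        \<exists>(T :: (real ^ 'k) \<times> (real ^ 'm) \<Rightarrow> real ^ 'd) S.
          bij_betw T reference_cylinder (ball x r) \<and>
          (\<forall>\<xi>\<in>reference_cylinder. S (T \<xi>) = \<xi>) \<and>
          C01 (closure reference_cylinder) T \<and> C01 (closure (ball x r)) S \<and>
          C01_norm (closure reference_cylinder) T + C01_norm (closure (ball x r)) S \<le> C \<and>
          S ` (ball x r \<inter> K) = {\<xi> \<in> reference_cylinder. fst \<xi> = 0} \<and>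
          (\<exists>C1>0. \<exists>C2>0. \<forall>\<xi>\<in>reference_cylinder. T \<xi> \<in> \<Omega> - K \<longrightarrow>
             C1 * norm (fst \<xi>) \<le> infdist (T \<xi>) K \<and> infdist (T \<xi>) K \<le> C2 * norm (fst \<xi>)))"


subsection \<open>Fractional Sobolev spaces\<close>

definition Gagliardo_integral ::
    "real \<Rightarrow> real \<Rightarrow> (real ^ 'd) set \<Rightarrow> (real ^ 'd \<Rightarrow> real) \<Rightarrow> ennreal" where
  "Gagliardo_integral s p \<Omega> u =
     (\<integral>\<^sup>+x\<in>\<Omega>. (\<integral>\<^sup>+y\<in>\<Omega>.
        ennreal (\<bar>u x - u y\<bar> powr p / norm (x - y) powr (real CARD('d) + s * p))
        \<partial>lebesgue) \<partial>lebesgue)"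

definition Lp_integral :: "real \<Rightarrow> (real ^ 'd) set \<Rightarrow> (real ^ 'd \<Rightarrow> real) \<Rightarrow> ennreal" where
  "Lp_integral p \<Omega> u = (\<integral>\<^sup>+x\<in>\<Omega>. ennreal (\<bar>u x\<bar> powr p) \<partial>lebesgue)"

text \<open>
  Functions on \<open>\<Omega>\<close> are represented by total functions whose values outside \<open>\<Omega>\<close> are irrelevant.
  The real-valued (semi)norms below are meaningful only on \<open>Wsp s p \<Omega>\<close>, where both integrals
  are finite.
\<close>

definition Wsp :: "real \<Rightarrow> real \<Rightarrow> (real ^ 'd) set \<Rightarrow> (real ^ 'd \<Rightarrow> real) set" where
  "Wsp s p \<Omega> =
     {u. u \<in> borel_measurable (lebesgue_on \<Omega>) \<and>
         Gagliardo_integral s p \<Omega> u < \<infinity> \<and> Lp_integral p \<Omega> u < \<infinity>}"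

definition Wsp_seminorm :: "real \<Rightarrow> real \<Rightarrow> (real ^ 'd) set \<Rightarrow> (real ^ 'd \<Rightarrow> real) \<Rightarrow> real" where
  "Wsp_seminorm s p \<Omega> u = enn2real (Gagliardo_integral s p \<Omega> u) powr (1 / p)"

definition Lp_norm :: "real \<Rightarrow> (real ^ 'd) set \<Rightarrow> (real ^ 'd \<Rightarrow> real) \<Rightarrow> real" where
  "Lp_norm p \<Omega> u = enn2real (Lp_integral p \<Omega> u) powr (1 / p)"

definition Wsp_norm :: "real \<Rightarrow> real \<Rightarrow> (real ^ 'd) set \<Rightarrow> (real ^ 'd \<Rightarrow> real) \<Rightarrow> real" where
  "Wsp_norm s p \<Omega> u = (Wsp_seminorm s p \<Omega> u powr p + Lp_norm p \<Omega> u powr p) powr (1 / p)"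

primrec C_times :: "nat \<Rightarrow> (real ^ 'd \<Rightarrow> real) \<Rightarrow> bool" where
  "C_times 0 f \<longleftrightarrow> continuous_on UNIV f"
| "C_times (Suc n) f \<longleftrightarrow>
     (\<forall>x. f differentiable (at x)) \<and>
     (\<forall>i. C_times n (\<lambda>x. frechet_derivative f (at x) (axis i 1)))"

text \<open>Test functions on \<open>U\<close> are extended by zero to the whole space.\<close>

definition test_functions :: "(real ^ 'd) set \<Rightarrow> (real ^ 'd \<Rightarrow> real) set" where
  "test_functions U =
     {\<phi>. (\<forall>n. C_times n \<phi>) \<and> compact (closure {x. \<phi> x \<noteq> 0}) \<and> closure {x. \<phi> x \<noteq> 0} \<subseteq> U}"

text \<open>\<open>Wsp0 s p \<Omega> K\<close> is the closure of the test functions on \<open>\<Omega> - K\<close> in the norm over all of \<open>\<Omega>\<close>.\<close>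

definition Wsp0 ::
    "real \<Rightarrow> real \<Rightarrow> (real ^ 'd) set \<Rightarrow> (real ^ 'd) set \<Rightarrow> (real ^ 'd \<Rightarrow> real) set" where
  "Wsp0 s p \<Omega> K =
     {u \<in> Wsp s p \<Omega>. \<forall>\<epsilon>>0. \<exists>\<phi>\<in>test_functions (\<Omega> - K). Wsp_norm s p \<Omega> (\<lambda>x. u x - \<phi> x) < \<epsilon>}"


subsection \<open>The truncated exponential\<close>

text \<open>
  The exponent is \<open>p = d / s\<close>.  For \<open>p > 1\<close> the least natural number \<open>j \<ge> p\<close> is at least \<open>2\<close>,
  so that the subtraction is not truncated.
\<close>

definition Phi :: "nat \<Rightarrow> real \<Rightarrow> real \<Rightarrow> real" where
  "Phi d s t = exp t - (\<Sum>i = 0..(LEAST j::nat. real j \<ge> real d / s) - 2. t ^ i / fact i)"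

end

theory Submission
  imports Defs
begin

text \<open>
  Write \<open>q = p / (p - 1) = d / (d - s)\<close>. Because \<open>s * p = d\<close>, the
  Gagliardo energy is invariant under scaling: the averages of a function over two neighbouring
  balls of comparable size differ by at most a constant times the \<open>1 / p\<close>-th power
  of the energy of these balls (\<open>average_step\<close>). Connect a point \<open>x\<close>
  near \<open>K\<close> to \<open>K\<close> by two chains of disjoint balls that start at a
  common ball, of size comparable to the distance \<open>\<delta> x\<close> from
  \<open>K\<close>: one shrinks to \<open>x\<close>, the other to a point of \<open>K\<close>. A
  test function vanishes at the end on \<open>K\<close>, so its value at \<open>x\<close> is
  bounded by a sum of steps.

  The \<open>p\<close>-th powers of the steps sum up to at most a constant times the total
  energy \<open>\<epsilon>\<close>, since the balls of a chain are disjoint. Moreover, in the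
  measure \<open>dx / \<delta> x ^ d\<close> the \<open>n\<close>-th step is exponentially small
  in \<open>n\<close> in the mean: towards \<open>x\<close> since the balls shrink, and towards
  \<open>K\<close> since the surface has positive dimension \<open>d - k\<close>, so that few
  points use a given ball (\<open>chains_near_surface\<close>). The first fact bounds the sum of
  \<open>N\<close> steps by a multiple of \<open>N powr (1 / q) * \<epsilon> powr (1 /
  p)\<close>, the second handles the remaining steps, and balancing the two at \<open>N\<close>
  of logarithmic size produces an integrable pointwise majorant of the truncated exponential
  (\<open>telescoping_exp_tail_bound\<close>, \<open>exp_tail_ball_chain\<close>). The
  truncation is what makes the majorant integrable where the function is small: near
  \<open>0\<close> the truncated exponential of \<open>t powr q\<close> is at most of order
  \<open>t powr p\<close>.

  Away from \<open>K\<close> the weight is bounded, and chains inside the interior cones of the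
  Lipschitz domain end at balls of fixed size, on which the average is controlled by the
  \<open>L\<^sup>p\<close> norm (\<open>uniformly_exp_bounded_away\<close>). Both regions
  together give a bound for all test functions of sufficiently small norm, where the smallness
  depends on the exponent (\<open>uniformly_exp_bounded_domain\<close>). Density of the test
  functions and Fatou's lemma extend this to every exponent and every \<open>u\<close>:
  \<open>u\<close> is a test function up to an error of small norm.
\<close>

section \<open>Tails of the exponential series\<close>

definition exp_tail :: "nat \<Rightarrow> real \<Rightarrow> real" where
  "exp_tail n t = exp t - (\<Sum>i<n. t ^ i / fact i)"

lemma exp_tail_sums:
  "(\<lambda>i. t ^ (i + n) / fact (i + n)) sums exp_tail n t"
proof -
  have "(\<lambda>i. t ^ i / fact i) sums exp t"
    using exp_converges[of t] by (simp add: divide_inverse mult.commute)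
  from sums_split_initial_segment[OF this, of n] show ?thesis
    by (simp add: exp_tail_def)
qed

lemma exp_tail_nonneg: "0 \<le> t \<Longrightarrow> 0 \<le> exp_tail n t"
  by (rule sums_le[OF _ sums_zero exp_tail_sums]) simp

lemma exp_tail_mono: "0 \<le> t \<Longrightarrow> t \<le> t' \<Longrightarrow> exp_tail n t \<le> exp_tail n t'"
  by (rule sums_le[OF _ exp_tail_sums exp_tail_sums]) (simp add: divide_right_mono power_mono)

lemma exp_tail_le_exp: "0 \<le> t \<Longrightarrow> exp_tail n t \<le> exp t"
  unfolding exp_tail_def by (simp add: sum_nonneg)

lemma exp_tail_le_power:
  assumes "0 \<le> t"
  shows "exp_tail n t \<le> t ^ n * exp t"
proof (rule sums_le[OF _ exp_tail_sums])
  show "(\<lambda>i. t ^ n * (t ^ i / fact i)) sums (t ^ n * exp t)"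
    using exp_converges[of t] by (intro sums_mult) (simp add: divide_inverse mult.commute)
  show "t ^ (i + n) / fact (i + n) \<le> t ^ n * (t ^ i / fact i)" for i
    using assms by (auto simp: power_add mult.commute intro!: divide_left_mono fact_mono)
qed

lemma exp_tail_0: "0 < n \<Longrightarrow> exp_tail n 0 = 0"
  using exp_tail_le_power[of 0 n] exp_tail_nonneg[of 0 n] by (simp add: power_0_left)

lemma continuous_on_exp_tail: "continuous_on A (exp_tail n)"
  unfolding exp_tail_def[abs_def] by (intro continuous_intros) auto

lemma Phi_eq_exp_tail:
  assumes "1 < real d / s"
  shows "\<exists>n\<ge>1. real d / s - 1 \<le> real n \<and> Phi d s = exp_tail n"
proof -
  define j where "j = (LEAST j::nat. real j \<ge> real d / s)"
  have j: "real j \<ge> real d / s"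
    unfolding j_def by (rule LeastI_ex) (rule real_arch_simple)
  with assms have "2 \<le> j" by linarith
  then have "{0..j - 2} = {..<j - 1}" by auto
  then have "Phi d s = exp_tail (j - 1)"
    by (simp add: fun_eq_iff Phi_def exp_tail_def j_def)
  then show ?thesis using j \<open>2 \<le> j\<close>
    by (intro exI[of _ "j - 1"]) auto
qed

text \<open>
  The tail is monotone, so \<open>exp_tail\<close> at a sum is controlled by its value at twice
  the larger summand. The price for splitting a function into two pieces is therefore only the
  factor \<open>2 powr r\<close> in the exponent, which is harmless because every exponent is
  admissible in the end.
\<close>

lemma exp_tail_max:
  assumes "0 \<le> a" "0 \<le> b" "0 \<le> r" "0 \<le> \<alpha>"  "\<bar>c\<bar> \<le> a + b"
  shows "exp_tail n (\<alpha> * \<bar>c\<bar> powr r) \<le>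
    exp_tail n (\<alpha> * 2 powr r * a powr r) + exp_tail n (\<alpha> * 2 powr r * b powr r)"
proof -
  have *: "exp_tail n (\<alpha> * \<bar>c\<bar> powr r) \<le> exp_tail n (\<alpha> * 2 powr r * x powr r)"
    if "\<bar>c\<bar> \<le> 2 * x" "0 \<le> x" for x
  proof (rule exp_tail_mono)
    have "\<bar>c\<bar> powr r \<le> (2 * x) powr r" using that assms by (intro powr_mono2) auto
    also have "\<dots> = 2 powr r * x powr r" using that by (simp add: powr_mult)
    finally show "\<alpha> * \<bar>c\<bar> powr r \<le> \<alpha> * 2 powr r * x powr r"
      using assms by (simp add: mult.assoc mult_left_mono)
  qed (use assms in auto)
  have "0 \<le> exp_tail n (\<alpha> * 2 powr r * a powr r)" "0 \<le> exp_tail n (\<alpha> * 2 powr r * b powr r)"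
    using assms by (auto intro!: exp_tail_nonneg)
  then show ?thesis
    using *[of a] *[of b] assms by (cases "a \<le> b") force+
qed

section \<open>From dyadic oscillations to an exponential bound\<close>

text \<open>
  This replaces Hoelder's and Jensen's inequalities throughout: a first power is split at the
  height \<open>l\<close>, and the free scale \<open>l\<close> is optimised only after
  integration or summation.
\<close>

lemma le_scale_plus_powr:
  fixes l p y :: real
  assumes "1 < p" "0 < l" "0 \<le> y"
  shows "y \<le> l + l powr (1 - p) * y powr p"
proof (cases "y \<le> l")
  case False
  then have "y = y powr p * y powr (1 - p)" using assms by (simp add: powr_add[symmetric])
  also have "\<dots> \<le> y powr p * l powr (1 - p)"
    using assms False by (intro mult_left_mono powr_mono2') auto
  finally show ?thesis using assms by (simp add: mult.commute)
qed (use assms in \<open>auto intro: add_increasing2\<close>)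

lemma le_root_if_le_scales:
  fixes x J p :: real
  assumes "1 < p" "0 \<le> J" "\<And>l. 0 < l \<Longrightarrow> x \<le> l + l powr (1 - p) * J"
  shows "x \<le> 2 * J powr (1 / p)"
proof (cases "J = 0")
  case True
  then have "x \<le> l" if "0 < l" for l using assms(3)[OF that] by simp
  then show ?thesis using True field_le_epsilon[of x 0] by simp
next
  case False
  then have "x \<le> J powr (1 / p) + (J powr (1 / p)) powr (1 - p) * J"
    using assms by (intro assms(3)) auto
  also have "(J powr (1 / p)) powr (1 - p) * J = J powr (1 / p)"
    using False assms by (simp add: powr_powr powr_mult_base mult.commute field_simps)
  finally show ?thesis by simp
qed

lemma sum_powr_Holder:
  fixes x :: "nat \<Rightarrow> real"
  assumes "1 < p" "\<And>n. 0 \<le> x n" "(\<Sum>n<N. x n) \<le> \<epsilon>" "0 < \<epsilon>"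
  shows "(\<Sum>n<N. x n powr (1 / p)) \<le> 2 * real N powr (1 - 1 / p) * \<epsilon> powr (1 / p)"
proof (cases "N = 0")
  case False
  define l where "l = (\<epsilon> / N) powr (1 / p)"
  have l: "0 < l" using False assms by (simp add: l_def)
  have t: "y powr (1 / p) \<le> l + y * l powr (1 - p)" if "0 \<le> y" for y
    using le_scale_plus_powr[OF assms(1) l, of "y powr (1 / p)"] assms that
    by (simp add: powr_powr mult.commute)
  have "(\<Sum>n<N. x n powr (1 / p)) \<le> (\<Sum>n<N. l + x n * l powr (1 - p))"
    by (intro sum_mono t assms)
  also have "\<dots> = N * l + (\<Sum>n<N. x n) * l powr (1 - p)"
    by (simp add: sum.distrib sum_distrib_right)
  also have "\<dots> \<le> N * l + \<epsilon> * l powr (1 - p)"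
    using assms by (simp add: mult_right_mono)
  also have "\<epsilon> * l powr (1 - p) = N * l"
  proof -
    have "l powr p = \<epsilon> / N" using assms False by (simp add: l_def powr_powr)
    then have "l powr (1 - p) = l / (\<epsilon> / N)" using l by (simp add: powr_diff)
    then show ?thesis using assms False by (simp add: field_simps)
  qed
  also have "N * l + N * l = 2 * real N powr (1 - 1 / p) * \<epsilon> powr (1 / p)"
    using False assms by (simp add: l_def powr_divide powr_diff)
  finally show ?thesis .
qed auto


lemma geometric_steps_limit:
  fixes A :: "nat \<Rightarrow> real"
  assumes "A \<longlonglongrightarrow> a" "\<And>n. \<bar>A n - A (Suc n)\<bar> \<le> D * \<kappa> ^ n" "0 \<le> D" "0 \<le> \<kappa>" "\<kappa> < 1"
  shows "\<bar>a - A N\<bar> \<le> D * \<kappa> ^ N / (1 - \<kappa>)"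
proof -
  have step: "\<bar>A (N + k) - A N\<bar> \<le> D * \<kappa> ^ N * (\<Sum>i<k. \<kappa> ^ i)" for k
  proof (induction k)
    case (Suc k)
    have "\<bar>A (N + Suc k) - A N\<bar> \<le> \<bar>A (N + k) - A N\<bar> + D * \<kappa> ^ (N + k)"
      using assms(2)[of "N + k"] by simp
    with Suc show ?case by (simp add: algebra_simps power_add)
  qed simp
  have "\<bar>A (N + k) - A N\<bar> \<le> D * \<kappa> ^ N / (1 - \<kappa>)" for k
  proof -
    have "(\<Sum>i<k. \<kappa> ^ i) \<le> 1 / (1 - \<kappa>)"
      using assms by (simp add: sum_gp_strict divide_right_mono)
    then have "D * \<kappa> ^ N * (\<Sum>i<k. \<kappa> ^ i) \<le> D * \<kappa> ^ N * (1 / (1 - \<kappa>))"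
      using assms by (intro mult_left_mono) auto
    with step[of k] show ?thesis by simp
  qed
  moreover have "(\<lambda>k. \<bar>A (N + k) - A N\<bar>) \<longlonglongrightarrow> \<bar>a - A N\<bar>"
    by (intro tendsto_intros) (use LIMSEQ_ignore_initial_segment[OF assms(1), of N] in \<open>simp add: add.commute\<close>)
  ultimately show ?thesis
    by (intro LIMSEQ_le_const2) auto
qed

text \<open>
  The sequence \<open>A\<close> stands for averages of a function over balls that shrink to a
  point, and \<open>\<mu> n\<close> for the share of the Gagliardo energy charged to the
  \<open>n\<close>-th step. There are two competing estimates for the steps. The shares sum up
  to at most \<open>\<epsilon>\<close>, so by Hoelder the first \<open>N\<close> steps
  contribute at most a multiple of \<open>N powr (1 / q) * \<epsilon> powr (1 / p)\<close>; and
  the shares decay relative to \<open>H\<close>, so the steps after \<open>N\<close> contribute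
  at most a multiple of \<open>((2 / 3) ^ N * H) powr (1 / p)\<close>. If \<open>\<bar>a - A
  0\<bar>\<close> exceeds \<open>1\<close>, choose \<open>N\<close> of the order of \<open>ln
  H\<close>, so that the second contribution is at most \<open>1 / 2\<close>. Then
  \<open>\<bar>a - A 0\<bar> powr q\<close> is at most of order \<open>\<epsilon> powr (q / p) *
  ln H\<close>, and its exponential is at most of order \<open>H\<close> once
  \<open>\<epsilon>\<close> is small. If \<open>\<bar>a - A 0\<bar>\<close> is at most
  \<open>1\<close>, the choice \<open>N = 0\<close> gives \<open>\<bar>a - A 0\<bar> powr p
  \<le> const * H\<close>, and the first \<open>m\<close> terms missing from the exponential
  series make the left-hand side that small.
\<close>

lemma telescoping_exp_tail_bound:
  fixes p q C \<alpha> :: real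
  assumes p: "1 < p" and q: "q = p / (p - 1)" and "0 < C" "0 < \<alpha>" and m: "p - 1 \<le> real m"
  shows "\<exists>\<epsilon>>0. \<exists>M>0. \<forall>A a \<mu> H.
    A \<longlonglongrightarrow> a \<longrightarrow> 0 \<le> H \<longrightarrow> (\<forall>n. 0 \<le> \<mu> n) \<longrightarrow> (\<forall>N. (\<Sum>n<N. \<mu> n) \<le> \<epsilon>) \<longrightarrow>
    (\<forall>n. \<mu> n \<le> (2 / 3) ^ n * H) \<longrightarrow> (\<forall>n. \<bar>A n - A (Suc n)\<bar> \<le> C * \<mu> n powr (1 / p)) \<longrightarrow>
    exp_tail m (\<alpha> * \<bar>a - A 0\<bar> powr q) \<le> M * H"
proof -
  define \<kappa> where "\<kappa> = (2 / 3 :: real) powr (1 / p)"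
  have \<kappa>: "0 < \<kappa>" "\<kappa> < 1"
    using p powr_less_mono2[of "1/p" "2/3" 1] by (auto simp: \<kappa>_def)
  have \<kappa>_pow: "\<kappa> ^ n = ((2 / 3) ^ n) powr (1 / p)" for n
    unfolding \<kappa>_def by (simp add: powr_powr powr_realpow[symmetric] mult.commute)
  define C2 where "C2 = C / (1 - \<kappa>)"
  have C2: "0 < C2" using \<kappa> \<open>0 < C\<close> by (simp add: C2_def)
  \<comment> \<open>chosen so that the first \<open>N\<close> steps contribute at most the factor \<open>exp (N * ln (3 / 2)) = (3 / 2) ^ N\<close>\<close>
  define \<epsilon> where "\<epsilon> = (ln (3/2) / (\<alpha> * (4 * C) powr q)) powr (p / q)"
  have q0: "1 < q" "(1 - 1 / p) * q = 1" "q * (p - 1) = p"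
    using p by (auto simp: q field_simps)
  have \<epsilon>: "0 < \<epsilon>" using \<open>0 < C\<close> \<open>0 < \<alpha>\<close> by (simp add: \<epsilon>_def)
  have \<epsilon>q: "\<alpha> * ((4 * C) powr q * \<epsilon> powr (q / p)) = ln (3/2)"
    using p q0 \<open>0 < C\<close> \<open>0 < \<alpha>\<close> by (simp add: \<epsilon>_def powr_powr)
  define M where "M = \<alpha> ^ m * exp \<alpha> * C2 powr p + 3 / 2 * (2 * C2) powr p"
  have M: "0 < M" using C2 \<open>0 < \<alpha>\<close> by (simp add: M_def add_pos_pos)
  show ?thesis
  proof (rule exI[of _ \<epsilon>], rule conjI[OF \<epsilon>], rule exI[of _ M], rule conjI[OF M], intro allI impI)
    fix A :: "nat \<Rightarrow> real" and a \<mu> H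
    assume lim: "A \<longlonglongrightarrow> a" and H: "0 \<le> H" and \<mu>: "\<forall>n. 0 \<le> \<mu> n" "\<forall>N. (\<Sum>n<N. \<mu> n) \<le> \<epsilon>"
      "\<forall>n. \<mu> n \<le> (2 / 3) ^ n * H" and step: "\<forall>n. \<bar>A n - A (Suc n)\<bar> \<le> C * \<mu> n powr (1 / p)"
    define F where "F = \<bar>a - A 0\<bar>"
    have F0: "0 \<le> F" by (simp add: F_def)
    have "\<mu> n powr (1 / p) \<le> \<kappa> ^ n * H powr (1 / p)" for n
    proof -
      have "\<mu> n powr (1 / p) \<le> ((2 / 3) ^ n * H) powr (1 / p)"
        using \<mu> p by (intro powr_mono2) auto
      then show ?thesis using H by (simp add: powr_mult \<kappa>_pow)
    qed
    then have "\<bar>A n - A (Suc n)\<bar> \<le> C * H powr (1 / p) * \<kappa> ^ n" for n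
      using order_trans[OF step[rule_format, of n] mult_left_mono[of _ "\<kappa> ^ n * H powr (1 / p)" C]]
        \<open>0 < C\<close> by (simp add: mult_ac)
    then have tail: "\<bar>a - A N\<bar> \<le> C2 * H powr (1 / p) * \<kappa> ^ N" for N
      using geometric_steps_limit[OF lim, of "C * H powr (1 / p)" \<kappa> N] \<kappa> \<open>0 < C\<close>
      by (simp add: C2_def)
    have head: "\<bar>A 0 - A N\<bar> \<le> C * (\<Sum>n<N. \<mu> n powr (1 / p))" for N
    proof (induction N)
      case (Suc N)
      show ?case using Suc step[rule_format, of N] by (simp add: algebra_simps)
    qed simp
    have F_le: "F \<le> C2 * H powr (1 / p)" using tail[of 0] by (simp add: F_def)
    have "exp_tail m (\<alpha> * F powr q) \<le> M * H"
    proof (cases "F \<le> 1")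
      case True
      have F1: "F powr q \<le> 1" using True F0 q0 by (simp add: powr_le1)
      have Fm: "(F powr q) ^ m \<le> F powr p"
      proof (cases "F = 0")
        case False
        then have "(F powr q) ^ m = F powr (q * m)"
          using F0 by (simp add: powr_powr powr_realpow[symmetric])
        also have "\<dots> \<le> F powr p"
        proof (intro powr_mono')
          show "p \<le> q * real m" using mult_left_mono[OF m, of q] q0 by simp
        qed (use False F0 True in auto)
        finally show ?thesis .
      next
        case True
        have "0 < m" using m p by (cases m) auto
        with True show ?thesis by (simp add: power_0_left)
      qed
      have "exp_tail m (\<alpha> * F powr q) \<le> (\<alpha> * F powr q) ^ m * exp (\<alpha> * F powr q)"
        using \<open>0 < \<alpha>\<close> by (intro exp_tail_le_power) auto
      also have "\<dots> \<le> \<alpha> ^ m * F powr p * exp \<alpha>"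
        using \<open>0 < \<alpha>\<close> Fm F1 by (auto simp: power_mult_distrib intro!: mult_mono)
      also have "F powr p \<le> (C2 * H powr (1 / p)) powr p"
        using F_le F0 p by (intro powr_mono2) auto
      also have "\<dots> = C2 powr p * H" using C2 H p by (simp add: powr_mult powr_powr)
      finally have "exp_tail m (\<alpha> * F powr q) \<le> \<alpha> ^ m * exp \<alpha> * C2 powr p * H"
        using \<open>0 < \<alpha>\<close> by (simp add: algebra_simps)
      also have "\<dots> \<le> M * H"
        unfolding M_def using H C2 by (intro mult_right_mono) auto
      finally show ?thesis .
    next
      case False
      \<comment> \<open>normalised so that \<open>(2 / 3) ^ N * Y \<le> 1\<close> bounds the steps after \<open>N\<close> by \<open>1 / 2\<close>\<close>
      define Y where "Y = (2 * C2) powr p * H"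
      have Y_root: "Y powr (1 / p) = 2 * (C2 * H powr (1 / p))"
        using C2 H p by (simp add: Y_def powr_mult powr_powr)
      have "1 < Y powr (1 / p)" using F_le False unfolding Y_root by linarith
      then have Y: "1 < Y"
        using p H powr_le1[of "1 / p" Y] by (force simp: Y_def)
      define N where "N = (LEAST N. (2/3) ^ N * Y \<le> 1)"
      have "\<exists>N. (2/3::real) ^ N < 1 / Y" using Y by (intro real_arch_pow_inv) auto
      then have "\<exists>N. (2/3) ^ N * Y \<le> 1"
        using Y by (metis less_divide_eq less_imp_le less_trans zero_less_one)
      then have N: "(2/3) ^ N * Y \<le> 1" unfolding N_def by (rule LeastI_ex)
      then have "0 < N" using Y by (cases N) auto
      then have "\<not> (2/3) ^ (N - 1) * Y \<le> 1" unfolding N_def by (intro not_less_Least) auto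
      then have N': "(3/2) ^ N \<le> 3 / 2 * Y"
        using \<open>0 < N\<close> by (cases N) (auto simp: field_simps power_divide)
      have "C2 * H powr (1 / p) * \<kappa> ^ N = ((2/3) ^ N * Y) powr (1 / p) / 2"
        using Y by (simp add: powr_mult Y_root \<kappa>_pow)
      also have "\<dots> \<le> 1 / 2" using N Y p by (simp add: powr_le1)
      finally have "\<bar>a - A N\<bar> \<le> 1 / 2" using tail[of N] by linarith
      moreover have "F \<le> \<bar>a - A N\<bar> + \<bar>A 0 - A N\<bar>" unfolding F_def by linarith
      ultimately have "F / 2 \<le> \<bar>A 0 - A N\<bar>" using False by linarith
      also have "\<dots> \<le> C * (2 * real N powr (1 - 1 / p) * \<epsilon> powr (1 / p))"
        by (rule order_trans[OF head[of N]], rule mult_left_mono[OF sum_powr_Holder[OF p]])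
          (use \<mu> \<epsilon> \<open>0 < C\<close> in auto)
      finally have "F \<le> 4 * C * real N powr (1 - 1 / p) * \<epsilon> powr (1 / p)" by simp
      then have "F powr q \<le> (4 * C * real N powr (1 - 1 / p) * \<epsilon> powr (1 / p)) powr q"
        using q0 F0 by (intro powr_mono2) auto
      also have "\<dots> = (4 * C) powr q * real N * \<epsilon> powr (q / p)"
        using q0 \<open>0 < C\<close> by (simp add: powr_mult powr_powr)
      finally have "\<alpha> * F powr q \<le> \<alpha> * ((4 * C) powr q * real N * \<epsilon> powr (q / p))"
        using \<open>0 < \<alpha>\<close> by (intro mult_left_mono) auto
      also have "\<dots> = N * ln (3/2)" unfolding \<epsilon>q[symmetric] by simp
      finally have "exp (\<alpha> * F powr q) \<le> exp (N * ln (3/2))" by simp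
      also have "\<dots> = (3/2) ^ N" by (simp add: exp_of_nat_mult)
      also note N'
      also have "3 / 2 * Y \<le> M * H"
        unfolding Y_def M_def using H \<open>0 < \<alpha>\<close> by (simp add: algebra_simps)
      finally show ?thesis
        using exp_tail_le_exp[of "\<alpha> * F powr q" m] \<open>0 < \<alpha>\<close> by simp
    qed
    then show "exp_tail m (\<alpha> * \<bar>a - A 0\<bar> powr q) \<le> M * H" by (simp add: F_def)
  qed
qed

section \<open>Averages over balls and the Gagliardo energy\<close>

definition ball_average :: "('a::euclidean_space \<Rightarrow> real) \<Rightarrow> 'a \<Rightarrow> real \<Rightarrow> real" where
  "ball_average \<phi> a r = (LINT y:ball a r|lborel. \<phi> y) / measure lborel (ball a r)"

lemma measurable_ball [measurable]: "ball (a::'a::euclidean_space) r \<in> sets borel"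
  by simp

lemma measure_ball_pos: "0 < r \<Longrightarrow> 0 < measure lborel (ball (a::'a::euclidean_space) r)"
  using content_ball_pos[of r a] by (simp add: measure_def)

lemma emeasure_ball_measure:
  "emeasure lborel (ball (a::'a::euclidean_space) r) = ennreal (measure lborel (ball a r))"
  by (rule emeasure_eq_ennreal_measure) (use emeasure_lborel_ball_finite[of a r] in auto)

lemma set_integrable_ball:
  fixes \<phi> :: "'a::euclidean_space \<Rightarrow> real"
  assumes "continuous_on UNIV \<phi>"
  shows "set_integrable lborel (ball a r) \<phi>"
proof -
  have "set_integrable lborel (cball a r) \<phi>"
    unfolding set_integrable_def
    by (intro borel_integrable_compact continuous_on_subset[OF assms]) auto
  then show ?thesis by (rule set_integrable_subset) auto
qed

lemma ball_average_deviation: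
  fixes \<phi> :: "'a::euclidean_space \<Rightarrow> real"
  assumes \<phi>: "continuous_on UNIV \<phi>" and r: "0 < r"
  shows "ennreal (\<bar>ball_average \<phi> a r - b\<bar> * measure lborel (ball a r))
    \<le> (\<integral>\<^sup>+y\<in>ball a r. ennreal \<bar>\<phi> y - b\<bar> \<partial>lborel)"
proof -
  let ?B = "ball a r"
  have V: "0 < measure lborel ?B" using r by (rule measure_ball_pos)
  have int: "set_integrable lborel ?B \<phi>" "set_integrable lborel ?B (\<lambda>y. b)"
    using \<phi> by (auto intro!: set_integrable_ball)
  have "(LINT y:?B|lborel. \<phi> y - b) = (LINT y:?B|lborel. \<phi> y) - measure lborel ?B * b"
    using int by (subst set_integral_diff) (auto simp: set_lebesgue_integral_def)
  then have "\<bar>ball_average \<phi> a r - b\<bar> * measure lborel ?B = \<bar>LINT y:?B|lborel. \<phi> y - b\<bar>"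
    using V by (simp add: ball_average_def field_simps abs_mult_pos)
  moreover have "ennreal \<bar>LINT y:?B|lborel. \<phi> y - b\<bar> \<le> (\<integral>\<^sup>+y. ennreal (norm (indicator ?B y *\<^sub>R (\<phi> y - b))) \<partial>lborel)"
    unfolding set_lebesgue_integral_def real_norm_def[symmetric]
    using set_integral_diff(1)[OF int] by (intro integral_norm_bound_ennreal) (simp add: set_integrable_def)
  moreover have "\<dots> = (\<integral>\<^sup>+y\<in>?B. ennreal \<bar>\<phi> y - b\<bar> \<partial>lborel)"
    by (intro nn_integral_cong) (auto split: split_indicator)
  ultimately show ?thesis by simp
qed

lemma ball_average_tendsto:
  fixes \<phi> :: "'a::euclidean_space \<Rightarrow> real"
  assumes \<phi>: "continuous_on UNIV \<phi>" and "c \<longlonglongrightarrow> a" "r \<longlonglongrightarrow> 0" and r: "\<And>n. 0 < r n"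
  shows "(\<lambda>n. ball_average \<phi> (c n) (r n)) \<longlonglongrightarrow> \<phi> a"
proof (rule LIMSEQ_I)
  fix e :: real assume e: "0 < e"
  obtain d where d: "0 < d" "\<And>y. dist y a < d \<Longrightarrow> \<bar>\<phi> y - \<phi> a\<bar> < e / 2"
    using \<phi> e unfolding continuous_on_iff dist_real_def by (metis UNIV_I half_gt_zero)
  have "\<forall>\<^sub>F n in sequentially. dist (c n) a < d / 2 \<and> r n < d / 2"
    using tendstoD[OF assms(2), of "d/2"] tendstoD[OF assms(3), of "d/2"] d
    by (auto elim: eventually_elim2)
  then obtain N where N: "\<And>n. N \<le> n \<Longrightarrow> dist (c n) a < d / 2 \<and> r n < d / 2"
    by (auto simp: eventually_sequentially)
  have "\<bar>ball_average \<phi> (c n) (r n) - \<phi> a\<bar> < e" if "N \<le> n" for n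
  proof -
    let ?V = "measure lborel (ball (c n) (r n))"
    have near: "ennreal \<bar>\<phi> y - \<phi> a\<bar> \<le> ennreal (e / 2)" if "y \<in> ball (c n) (r n)" for y
    proof -
      have "dist y a < d" using N[OF \<open>N \<le> n\<close>] that dist_triangle[of y a "c n"] by (simp add: dist_commute)
      then show ?thesis using d(2)[of y] by (intro ennreal_leI) simp
    qed
    have "ennreal (\<bar>ball_average \<phi> (c n) (r n) - \<phi> a\<bar> * ?V)
      \<le> (\<integral>\<^sup>+y\<in>ball (c n) (r n). ennreal \<bar>\<phi> y - \<phi> a\<bar> \<partial>lborel)"
      by (rule ball_average_deviation[OF \<phi> r])
    also have "\<dots> \<le> (\<integral>\<^sup>+y\<in>ball (c n) (r n). ennreal (e / 2) \<partial>lborel)"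
      using near by (intro nn_integral_mono) (auto split: split_indicator)
    also have "\<dots> = ennreal (e / 2 * ?V)"
      using e by (simp add: nn_integral_cmult_indicator emeasure_ball_measure flip: ennreal_mult)
    finally have "\<bar>ball_average \<phi> (c n) (r n) - \<phi> a\<bar> * ?V \<le> e / 2 * ?V"
      using e by simp
    then show ?thesis using measure_ball_pos[OF r[of n], of "c n"] e by simp
  qed
  then show "\<exists>N. \<forall>n\<ge>N. norm (ball_average \<phi> (c n) (r n) - \<phi> a) < e" by auto
qed

lemma ball_average_le_Lp:
  fixes \<phi> :: "'a::euclidean_space \<Rightarrow> real"
  assumes \<phi>: "continuous_on UNIV \<phi>" and r: "0 < r" and p: "1 < p"
    and L: "(\<integral>\<^sup>+y\<in>ball a r. ennreal (\<bar>\<phi> y\<bar> powr p) \<partial>lborel) \<le> 1"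
  shows "\<bar>ball_average \<phi> a r\<bar> \<le> 1 + 1 / measure lborel (ball a r)"
proof -
  let ?V = "measure lborel (ball a r)"
  have [measurable]: "\<phi> \<in> borel_measurable borel" using \<phi> by (rule borel_measurable_continuous_onI)
  have pt: "ennreal \<bar>\<phi> y\<bar> \<le> 1 + ennreal (\<bar>\<phi> y\<bar> powr p)" for y
    using ennreal_leI[OF le_scale_plus_powr[OF p, of 1 "\<bar>\<phi> y\<bar>"]] by simp
  have "ennreal (\<bar>ball_average \<phi> a r - 0\<bar> * ?V) \<le> (\<integral>\<^sup>+y\<in>ball a r. ennreal \<bar>\<phi> y - 0\<bar> \<partial>lborel)"
    by (rule ball_average_deviation[OF \<phi> r])
  also have "\<dots> \<le> (\<integral>\<^sup>+y. indicator (ball a r) y + ennreal (\<bar>\<phi> y\<bar> powr p) * indicator (ball a r) y \<partial>lborel)"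
    using pt by (intro nn_integral_mono) (auto split: split_indicator)
  also have "\<dots> = ennreal ?V + (\<integral>\<^sup>+y\<in>ball a r. ennreal (\<bar>\<phi> y\<bar> powr p) \<partial>lborel)"
    by (subst nn_integral_add) (simp_all add: emeasure_ball_measure)
  also have "\<dots> \<le> ennreal ?V + ennreal 1" using L by (intro add_mono) auto
  also have "\<dots> = ennreal (?V + 1)" by (subst ennreal_plus) auto
  finally have "\<bar>ball_average \<phi> a r\<bar> * ?V \<le> ?V + 1"
    by (subst (asm) ennreal_le_iff) auto
  then show ?thesis using measure_ball_pos[OF r, of a] by (simp add: field_simps)
qed

text \<open>
  The exponent \<open>2 * DIM('a)\<close> is the exponent \<open>d + s * p\<close> of the
  Gagliardo seminorm in the borderline case \<open>s * p = d\<close>. It makes the energy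
  invariant under scaling, which is why all scales contribute alike.
\<close>

definition gagliardo_kernel :: "real \<Rightarrow> ('a::euclidean_space \<Rightarrow> real) \<Rightarrow> 'a \<Rightarrow> 'a \<Rightarrow> ennreal" where
  "gagliardo_kernel p \<phi> y z = ennreal (\<bar>\<phi> y - \<phi> z\<bar> powr p / norm (y - z) powr (2 * real DIM('a)))"

definition gagliardo_density :: "real \<Rightarrow> 'a::euclidean_space set \<Rightarrow> ('a \<Rightarrow> real) \<Rightarrow> 'a \<Rightarrow> ennreal" where
  "gagliardo_density p \<Omega> \<phi> y = (\<integral>\<^sup>+z\<in>\<Omega>. gagliardo_kernel p \<phi> y z \<partial>lborel)"

lemma measurable_gagliardo_kernel [measurable]:
  assumes [measurable]: "\<phi> \<in> borel_measurable borel" "f \<in> M \<rightarrow>\<^sub>M borel" "g \<in> M \<rightarrow>\<^sub>M borel"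
  shows "(\<lambda>x. gagliardo_kernel p \<phi> (f x) (g x)) \<in> borel_measurable M"
  unfolding gagliardo_kernel_def by measurable

lemma measurable_gagliardo_density [measurable]:
  assumes [measurable]: "\<phi> \<in> borel_measurable borel" "\<Omega> \<in> sets borel"
  shows "gagliardo_density p \<Omega> \<phi> \<in> borel_measurable borel"
  unfolding gagliardo_density_def[abs_def] by measurable

text \<open>
  The points of the two balls have distance at most a multiple of \<open>r\<close>, and the
  product of the volumes of the balls is comparable to \<open>r ^ (2 * DIM('a))\<close>. These
  two powers of \<open>r\<close> cancel, so the constant depends neither on the scale nor on the
  position. Only the first ball is charged with the energy; the second variable may range over
  all of \<open>\<Omega>\<close>.
\<close>

lemma average_step:
  fixes p M :: real
  assumes p: "1 < p" and M: "0 \<le> M"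
  shows "\<exists>C>0. \<forall>(\<phi>::'a::euclidean_space \<Rightarrow> real) \<Omega> a b r I.
    continuous_on UNIV \<phi> \<longrightarrow> open \<Omega> \<longrightarrow> 0 < r \<longrightarrow> dist a b \<le> M * r \<longrightarrow> ball b (r / 2) \<subseteq> \<Omega> \<longrightarrow> 0 \<le> I \<longrightarrow>
    (\<integral>\<^sup>+y\<in>ball a r. gagliardo_density p \<Omega> \<phi> y \<partial>lborel) \<le> ennreal I \<longrightarrow>
    \<bar>ball_average \<phi> a r - ball_average \<phi> b (r / 2)\<bar> \<le> C * I powr (1 / p)"
proof -
  define \<omega> where "\<omega> = unit_ball_vol (real DIM('a))"
  have \<omega>: "0 < \<omega>" by (simp add: \<omega>_def)
  define c where "c = (M + 2) ^ (2 * DIM('a)) * 2 ^ DIM('a) / \<omega> ^ 2"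
  have c: "0 < c" using \<omega> M by (simp add: c_def)
  show ?thesis
  proof (rule exI[of _ "2 * c powr (1 / p)"], intro conjI allI impI)
    show "0 < 2 * c powr (1 / p)" using c by simp
    fix \<phi> :: "'a \<Rightarrow> real" and \<Omega> a b r I
    assume \<phi>: "continuous_on UNIV \<phi>" and "open \<Omega>" and r: "0 < r" and ab: "dist a b \<le> M * r"
      and sub: "ball b (r / 2) \<subseteq> \<Omega>" and I: "0 \<le> I"
      and le_I: "(\<integral>\<^sup>+y\<in>ball a r. gagliardo_density p \<Omega> \<phi> y \<partial>lborel) \<le> ennreal I"
    have [measurable]: "\<phi> \<in> borel_measurable borel" "\<Omega> \<in> sets borel"
      using \<phi> \<open>open \<Omega>\<close> by (auto intro: borel_measurable_continuous_onI)
    let ?B = "ball a r" and ?B' = "ball b (r / 2)"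
    let ?V = "measure lborel ?B" and ?V' = "measure lborel ?B'"
    let ?k = "gagliardo_kernel p \<phi>"
    define R where "R = (M + 2) * r"
    have R: "0 < R" using M r by (simp add: R_def)
    define \<Delta> where "\<Delta> = \<bar>ball_average \<phi> a r - ball_average \<phi> b (r / 2)\<bar>"
    have VV': "?V * ?V' = R ^ (2 * DIM('a)) / c"
    proof -
      have "?V = \<omega> * r ^ DIM('a)" "?V' = \<omega> * r ^ DIM('a) / 2 ^ DIM('a)"
        using r by (auto simp: measure_def emeasure_ball \<omega>_def power_divide)
      moreover have "R ^ (2 * DIM('a)) = (M + 2) ^ (2 * DIM('a)) * (r ^ DIM('a)) ^ 2"
        by (simp add: R_def power_mult_distrib power_mult[symmetric] mult.commute)
      ultimately show ?thesis
        using \<omega> M by (simp add: c_def power2_eq_square field_simps)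
    qed
    have "\<Delta> \<le> l + l powr (1 - p) * (c * I)" if l: "0 < l" for l
    proof -
      define K where "K = l powr (1 - p) * R ^ (2 * DIM('a))"
      have K: "0 < K" using l R by (simp add: K_def)
      have pt: "ennreal \<bar>\<phi> y - \<phi> z\<bar> \<le> ennreal l + ennreal K * ?k y z" if "y \<in> ?B" "z \<in> ?B'" for y z
      proof -
        have "dist y z \<le> dist y a + dist a b + dist b z"
          by (meson add_right_mono dist_triangle order_trans)
        then have "norm (y - z) \<le> R"
          using ab that r M by (simp add: dist_norm[symmetric] R_def dist_commute algebra_simps)
        then have n: "norm (y - z) powr (2 * real DIM('a)) \<le> R ^ (2 * DIM('a))"
          using R by (subst powr_realpow[OF R, symmetric]) (auto intro!: powr_mono2)
        have "\<bar>\<phi> y - \<phi> z\<bar> powr p \<le> R ^ (2 * DIM('a)) * (\<bar>\<phi> y - \<phi> z\<bar> powr p / norm (y - z) powr (2 * real DIM('a)))"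
        proof (cases "y = z")
          case False
          then have "0 < norm (y - z) powr (2 * real DIM('a))" by simp
          with mult_left_mono[OF n, of "\<bar>\<phi> y - \<phi> z\<bar> powr p"] show ?thesis
            by (simp add: field_simps)
        qed (use R in simp)
        then have "\<bar>\<phi> y - \<phi> z\<bar> \<le> l + K * (\<bar>\<phi> y - \<phi> z\<bar> powr p / norm (y - z) powr (2 * real DIM('a)))"
          using le_scale_plus_powr[OF p l, of "\<bar>\<phi> y - \<phi> z\<bar>"]
          unfolding K_def mult.assoc by (smt (verit) mult_left_mono powr_ge_zero)
        then show ?thesis
          unfolding gagliardo_kernel_def using K l
          by (subst ennreal_mult[symmetric], simp, simp, subst ennreal_plus[symmetric])
            (auto intro: ennreal_leI simp del: ennreal_plus)
      qed
      have inner: "ennreal (\<bar>\<phi> y - ball_average \<phi> b (r / 2)\<bar>) * ennreal ?V'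
          \<le> ennreal (l * ?V') + ennreal K * gagliardo_density p \<Omega> \<phi> y" if "y \<in> ?B" for y
      proof -
        have "ennreal (\<bar>ball_average \<phi> b (r / 2) - \<phi> y\<bar> * ?V') \<le> (\<integral>\<^sup>+z\<in>?B'. ennreal \<bar>\<phi> z - \<phi> y\<bar> \<partial>lborel)"
          using r by (intro ball_average_deviation[OF \<phi>]) simp
        also have "\<dots> \<le> (\<integral>\<^sup>+z. ennreal l * indicator ?B' z + ennreal K * (?k y z * indicator \<Omega> z) \<partial>lborel)"
          using pt[OF that] sub
          by (intro nn_integral_mono) (auto split: split_indicator simp: abs_minus_commute)
        also have "\<dots> = ennreal (l * ?V') + ennreal K * gagliardo_density p \<Omega> \<phi> y"
          unfolding gagliardo_density_def using l
          by (subst nn_integral_add) (auto simp: nn_integral_cmult nn_integral_cmult_indicator emeasure_ball_measure ennreal_mult)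
        finally show ?thesis by (simp add: ennreal_mult abs_minus_commute)
      qed
      have "ennreal (\<Delta> * ?V) * ennreal ?V'
          \<le> (\<integral>\<^sup>+y\<in>?B. ennreal \<bar>\<phi> y - ball_average \<phi> b (r / 2)\<bar> \<partial>lborel) * ennreal ?V'"
        unfolding \<Delta>_def by (intro mult_right_mono ball_average_deviation[OF \<phi> r]) simp
      also have "\<dots> = (\<integral>\<^sup>+y\<in>?B. ennreal \<bar>\<phi> y - ball_average \<phi> b (r / 2)\<bar> * ennreal ?V' \<partial>lborel)"
        by (subst nn_integral_multc[symmetric]) (auto intro!: nn_integral_cong simp: mult_ac)
      also have "\<dots> \<le> (\<integral>\<^sup>+y. ennreal (l * ?V') * indicator ?B y
          + ennreal K * (gagliardo_density p \<Omega> \<phi> y * indicator ?B y) \<partial>lborel)"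
        using inner by (intro nn_integral_mono) (auto split: split_indicator)
      also have "\<dots> = ennreal (l * ?V' * ?V) + ennreal K * (\<integral>\<^sup>+y\<in>?B. gagliardo_density p \<Omega> \<phi> y \<partial>lborel)"
        using l by (subst nn_integral_add)
          (auto simp: nn_integral_cmult nn_integral_cmult_indicator emeasure_ball_measure ennreal_mult)
      also have "\<dots> \<le> ennreal (l * ?V' * ?V) + ennreal K * ennreal I"
        using le_I by (intro add_left_mono mult_left_mono) auto
      also have "\<dots> = ennreal (l * ?V' * ?V + K * I)"
        using K I l by (subst ennreal_plus) (auto simp: ennreal_mult)
      finally have "\<Delta> * (?V * ?V') \<le> l * (?V * ?V') + K * I"
        using K I l by (simp add: ennreal_mult[symmetric] \<Delta>_def mult_ac del: ennreal_plus)
      then have "\<Delta> * R ^ (2 * DIM('a)) \<le> (l + l powr (1 - p) * (c * I)) * R ^ (2 * DIM('a))"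
        using c unfolding VV' K_def by (simp add: field_simps)
      then show ?thesis using R by simp
    qed
    from le_root_if_le_scales[OF p _ this] have "\<Delta> \<le> 2 * (c * I) powr (1 / p)" using c I by simp
    then show "\<bar>ball_average \<phi> a r - ball_average \<phi> b (r / 2)\<bar> \<le> 2 * c powr (1 / p) * I powr (1 / p)"
      using c I by (simp add: \<Delta>_def powr_mult)
  qed
qed

section \<open>Chains of balls\<close>

text \<open>
  A chain attaches to each point \<open>x \<in> X\<close> balls in \<open>\<Omega>\<close> of
  radius \<open>\<rho> x / 2 ^ n\<close> that shrink to a point \<open>a x\<close>. For fixed
  \<open>x\<close> the balls are disjoint, so that the energies of the balls sum up to at most
  the energy on \<open>\<Omega>\<close>. The last condition is the dual one: for fixed
  \<open>n\<close>, the weighted measure of the points whose \<open>n\<close>-th ball contains a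
  given \<open>y\<close> decays geometrically. The two endpoints of interest are \<open>a x =
  x\<close>, and \<open>a x\<close> on the singular set, where the functions vanish.
\<close>

definition ball_chain :: "'a::euclidean_space set \<Rightarrow> 'a set \<Rightarrow> ('a \<Rightarrow> ennreal) \<Rightarrow>
    (nat \<Rightarrow> 'a \<Rightarrow> 'a) \<Rightarrow> ('a \<Rightarrow> real) \<Rightarrow> ('a \<Rightarrow> 'a) \<Rightarrow> bool" where
  "ball_chain \<Omega> X w c \<rho> a \<longleftrightarrow>
     X \<in> sets borel \<and> w \<in> borel_measurable borel \<and>
     (\<forall>n. continuous_on X (c n)) \<and> continuous_on X \<rho> \<and>
     (\<forall>x\<in>X. 0 < \<rho> x \<and> (\<lambda>n. c n x) \<longlonglongrightarrow> a x \<and>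
        disjoint_family (\<lambda>n. ball (c n x) (\<rho> x / 2 ^ n)) \<and> (\<forall>n. ball (c n x) (\<rho> x / 2 ^ n) \<subseteq> \<Omega>)) \<and>
     (\<exists>M\<ge>0. \<forall>x\<in>X. \<forall>n. dist (c n x) (c (Suc n) x) \<le> M * (\<rho> x / 2 ^ n)) \<and>
     (\<exists>D\<ge>0. \<forall>n y. (\<integral>\<^sup>+x\<in>{x\<in>X. y \<in> ball (c n x) (\<rho> x / 2 ^ n)}. w x \<partial>lborel) \<le> ennreal (D / 2 ^ n))"

text \<open>
  Apply the bound for telescoping sums pointwise with \<open>H x = (\<Sum>n. (3 / 2) ^ n * \<nu>
  n x)\<close>, where \<open>\<nu> n x\<close> is the energy of the \<open>n\<close>-th ball.
  Exchanging the integrals in \<open>x\<close> and in the energy variable \<open>y\<close>, the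
  overlap condition gives the \<open>n\<close>-th term at most a multiple of \<open>(3 / 2) ^ n
  / 2 ^ n\<close> times the energy, which is summable. The conclusion provides a measurable
  majorant, so that several chains can be added without discussing the measurability of averages
  over balls that move with \<open>x\<close>.
\<close>

lemma exp_tail_ball_chain:
  fixes \<Omega> :: "'a::euclidean_space set"
  assumes p: "1 < p" and q: "q = p / (p - 1)" and \<alpha>: "0 < \<alpha>" and m: "p - 1 \<le> real m"
    and "open \<Omega>" and chain: "ball_chain \<Omega> X w c \<rho> a"
  shows "\<exists>\<epsilon>>0. \<exists>M. \<forall>\<phi>. continuous_on UNIV \<phi> \<longrightarrow>
    (\<integral>\<^sup>+y\<in>\<Omega>. gagliardo_density p \<Omega> \<phi> y \<partial>lborel) \<le> ennreal \<epsilon> \<longrightarrow>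
    (\<exists>H\<in>borel_measurable borel.
      (\<forall>x\<in>X. ennreal (exp_tail m (\<alpha> * \<bar>\<phi> (a x) - ball_average \<phi> (c 0 x) (\<rho> x)\<bar> powr q)) \<le> H x) \<and>
      (\<integral>\<^sup>+x\<in>X. w x * H x \<partial>lborel) \<le> ennreal M)"
proof -
  have [measurable]: "X \<in> sets borel" "w \<in> borel_measurable borel" "\<Omega> \<in> sets borel"
    using chain \<open>open \<Omega>\<close> by (auto simp: ball_chain_def)
  have cont: "continuous_on X (c n)" "continuous_on X \<rho>" for n
    using chain by (auto simp: ball_chain_def)
  define B where "B n x = ball (c n x) (\<rho> x / 2 ^ n)" for n x
  have X: "0 < \<rho> x" "(\<lambda>n. c n x) \<longlonglongrightarrow> a x" "disjoint_family (\<lambda>n. B n x)" "B n x \<subseteq> \<Omega>" if "x \<in> X" for x n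
    using chain that by (auto simp: ball_chain_def B_def)
  obtain M where M: "0 \<le> M" "\<And>x n. x \<in> X \<Longrightarrow> dist (c n x) (c (Suc n) x) \<le> M * (\<rho> x / 2 ^ n)"
    using chain by (auto simp: ball_chain_def)
  obtain D where D: "0 \<le> D"
    "\<And>n y. (\<integral>\<^sup>+x\<in>{x\<in>X. y \<in> B n x}. w x \<partial>lborel) \<le> ennreal (D / 2 ^ n)"
    using chain by (auto simp: ball_chain_def B_def)
  obtain C where C: "0 < C" and step: "\<forall>(\<phi>::'a \<Rightarrow> real) \<Omega> a b r I.
      continuous_on UNIV \<phi> \<longrightarrow> open \<Omega> \<longrightarrow> 0 < r \<longrightarrow> dist a b \<le> M * r \<longrightarrow> ball b (r / 2) \<subseteq> \<Omega> \<longrightarrow> 0 \<le> I \<longrightarrow>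
      (\<integral>\<^sup>+y\<in>ball a r. gagliardo_density p \<Omega> \<phi> y \<partial>lborel) \<le> ennreal I \<longrightarrow>
      \<bar>ball_average \<phi> a r - ball_average \<phi> b (r / 2)\<bar> \<le> C * I powr (1 / p)"
    using average_step[OF p M(1), where 'a = 'a] by (elim exE conjE)
  obtain \<epsilon> L where \<epsilon>: "0 < \<epsilon>" and L: "0 < L" and bound: "\<forall>A a \<mu> H.
      A \<longlonglongrightarrow> a \<longrightarrow> 0 \<le> H \<longrightarrow> (\<forall>n. 0 \<le> \<mu> n) \<longrightarrow> (\<forall>N. (\<Sum>n<N. \<mu> n) \<le> \<epsilon>) \<longrightarrow>
      (\<forall>n. \<mu> n \<le> (2 / 3) ^ n * H) \<longrightarrow> (\<forall>n. \<bar>A n - A (Suc n)\<bar> \<le> C * \<mu> n powr (1 / p)) \<longrightarrow>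
      exp_tail m (\<alpha> * \<bar>a - A 0\<bar> powr q) \<le> L * H"
    using telescoping_exp_tail_bound[OF p q C \<alpha> m] by (elim exE conjE)
  \<comment> \<open>the balls depend measurably on \<open>x\<close> because the centres and radii, cut off outside \<open>X\<close>, are Borel functions\<close>
  define c' where "c' n x = indicator X x *\<^sub>R c n x" for n x
  define \<rho>' where "\<rho>' x = indicator X x *\<^sub>R \<rho> x" for x
  have [measurable]: "c' n \<in> borel_measurable borel" "\<rho>' \<in> borel_measurable borel" for n
    unfolding c'_def[abs_def] \<rho>'_def[abs_def]
    by (intro borel_measurable_continuous_on_indicator cont; simp)+
  have B_iff: "x \<in> X \<and> y \<in> B n x \<longleftrightarrow> x \<in> X \<and> dist (c' n x) y < \<rho>' x / 2 ^ n" for x y n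
    by (auto simp: B_def c'_def \<rho>'_def)
  show ?thesis
  proof (rule exI[of _ \<epsilon>], rule conjI[OF \<epsilon>], rule exI[of _ "L * (4 * (D * \<epsilon>))"], intro allI impI)
    fix \<phi> :: "'a \<Rightarrow> real"
    assume \<phi>: "continuous_on UNIV \<phi>"
      and G: "(\<integral>\<^sup>+y\<in>\<Omega>. gagliardo_density p \<Omega> \<phi> y \<partial>lborel) \<le> ennreal \<epsilon>"
    have [measurable]: "\<phi> \<in> borel_measurable borel" using \<phi> by (rule borel_measurable_continuous_onI)
    define \<gamma> where "\<gamma> = gagliardo_density p \<Omega> \<phi>"
    have [measurable]: "\<gamma> \<in> borel_measurable borel" by (simp add: \<gamma>_def)
    define \<nu> where "\<nu> n x = (\<integral>\<^sup>+y. indicator X x * indicator (B n x) y * \<gamma> y \<partial>lborel)" for n x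
    have ind: "indicator X x * indicator (B n x) y =
        (indicator {x \<in> space (borel \<Otimes>\<^sub>M borel). fst x \<in> X \<and> dist (c' n (fst x)) (snd x) < \<rho>' (fst x) / 2 ^ n} (x, y) :: ennreal)" for x y n
      using B_iff[of x y n] by (auto simp: space_pair_measure split: split_indicator)
    have [measurable]: "(\<lambda>(x, y). indicator X x * indicator (B n x) y :: ennreal) \<in> borel_measurable (borel \<Otimes>\<^sub>M borel)" for n
      unfolding ind by measurable
    have [measurable]: "\<nu> n \<in> borel_measurable borel" for n
      unfolding \<nu>_def[abs_def] by measurable
    define H where "H x = (\<Sum>n. ennreal ((3/2) ^ n) * \<nu> n x)" for x
    have [measurable]: "H \<in> borel_measurable borel" unfolding H_def[abs_def] by measurable
    have \<nu>_sum: "(\<Sum>n<N. \<nu> n x) \<le> ennreal \<epsilon>" if "x \<in> X" for x N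
    proof -
      have "(\<Sum>n<N. indicator (B n x) y :: ennreal) \<le> indicator \<Omega> y" for y
      proof -
        have "(\<Sum>n<N. indicator (B n x) y :: ennreal) = indicator (\<Union>n<N. B n x) y"
          using X(3)[OF that] by (subst indicator_UN_disjoint) (auto simp: disjoint_family_on_def)
        also have "\<dots> \<le> indicator \<Omega> y" using X(4)[OF that] by (auto split: split_indicator)
        finally show ?thesis .
      qed
      have "(\<Sum>n<N. \<nu> n x) = (\<integral>\<^sup>+y. (\<Sum>n<N. indicator (B n x) y) * \<gamma> y \<partial>lborel)"
        unfolding \<nu>_def using that
        by (subst nn_integral_sum[symmetric]) (auto simp: sum_distrib_right B_def)
      also have "\<dots> \<le> (\<integral>\<^sup>+y\<in>\<Omega>. \<gamma> y \<partial>lborel)"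
        by (intro nn_integral_mono) (simp add: mult.commute mult_left_mono \<open>\<And>y. _ \<le> indicator \<Omega> y\<close>)
      finally show ?thesis using G by (simp add: \<gamma>_def)
    qed
    have pointwise: "ennreal (exp_tail m (\<alpha> * \<bar>\<phi> (a x) - ball_average \<phi> (c 0 x) (\<rho> x)\<bar> powr q)) \<le> ennreal L * H x"
      if x: "x \<in> X" for x
    proof (cases "H x = \<infinity>")
      case True
      then show ?thesis using L by (simp add: ennreal_mult_top)
    next
      case False
      define h where "h = enn2real (H x)"
      have h: "H x = ennreal h" "0 \<le> h" using False by (auto simp: h_def less_top)
      define \<mu> where "\<mu> n = enn2real (\<nu> n x)" for n
      have \<nu>_fin: "\<nu> n x \<le> ennreal \<epsilon>" for n
      proof -
        have "\<nu> n x \<le> (\<Sum>i<Suc n. \<nu> i x)" by (intro member_le_sum) auto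
        then show ?thesis using \<nu>_sum[OF x, of "Suc n"] by (rule order_trans)
      qed
      then have \<mu>: "\<nu> n x = ennreal (\<mu> n)" "0 \<le> \<mu> n" for n
        unfolding \<mu>_def by (auto intro!: ennreal_enn2real[symmetric] le_less_trans[OF \<nu>_fin])
      have "exp_tail m (\<alpha> * \<bar>\<phi> (a x) - ball_average \<phi> (c 0 x) (\<rho> x / 2 ^ 0)\<bar> powr q) \<le> L * h"
      proof (rule bound[rule_format, where \<mu> = \<mu>])
        show "(\<lambda>n. ball_average \<phi> (c n x) (\<rho> x / 2 ^ n)) \<longlonglongrightarrow> \<phi> (a x)"
        proof (rule ball_average_tendsto[OF \<phi> X(2)[OF x]])
          show "(\<lambda>n. \<rho> x / 2 ^ n) \<longlonglongrightarrow> 0"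
            using tendsto_mult_right_zero[OF LIMSEQ_power_zero[of "1/2::real"], of "\<rho> x"]
            by (simp add: power_divide)
        qed (use X(1)[OF x] in simp)
        show "(\<Sum>n<N. \<mu> n) \<le> \<epsilon>" for N
          using \<nu>_sum[OF x, of N] \<epsilon> \<mu> by simp
        show "\<mu> n \<le> (2 / 3) ^ n * h" for n
        proof -
          have "ennreal ((3/2) ^ n) * \<nu> n x \<le> H x"
            unfolding H_def using sum_le_suminf[of "\<lambda>n. ennreal ((3/2) ^ n) * \<nu> n x" "{n}"] by auto
          then have "(3/2) ^ n * \<mu> n \<le> h"
            using h \<mu> by (simp flip: ennreal_mult)
          then show ?thesis by (simp add: power_divide field_simps)
        qed
        show "\<bar>ball_average \<phi> (c n x) (\<rho> x / 2 ^ n) - ball_average \<phi> (c (Suc n) x) (\<rho> x / 2 ^ Suc n)\<bar>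
            \<le> C * \<mu> n powr (1 / p)" for n
        proof -
          have "(\<integral>\<^sup>+y\<in>ball (c n x) (\<rho> x / 2 ^ n). gagliardo_density p \<Omega> \<phi> y \<partial>lborel) = \<nu> n x"
            unfolding \<nu>_def using x by (intro nn_integral_cong) (simp add: B_def \<gamma>_def mult.commute)
          then show ?thesis
            using step[rule_format, OF \<phi> \<open>open \<Omega>\<close> _ M(2)[OF x, of n] _ \<mu>(2)[of n]] X(1)[OF x] X(4)[OF x, of "Suc n"] \<mu>(1)[of n]
            by (simp add: B_def mult.commute)
        qed
      qed (use h \<mu> in auto)
      then show ?thesis
        unfolding h using L h by (simp add: ennreal_leI flip: ennreal_mult)
    qed
    \<comment> \<open>the exchange of integrals that turns the overlap condition into decay of the energies\<close>
    have layer: "(\<integral>\<^sup>+x. w x * \<nu> n x \<partial>lborel) \<le> ennreal (D * \<epsilon> / 2 ^ n)" for n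
    proof -
      have "(\<integral>\<^sup>+x. w x * \<nu> n x \<partial>lborel)
        = (\<integral>\<^sup>+x. \<integral>\<^sup>+y. w x * (indicator X x * indicator (B n x) y * \<gamma> y) \<partial>lborel \<partial>lborel)"
        unfolding \<nu>_def by (subst nn_integral_cmult) (measurable; simp add: B_def)+
      also have "\<dots> = (\<integral>\<^sup>+y. \<integral>\<^sup>+x. w x * (indicator X x * indicator (B n x) y * \<gamma> y) \<partial>lborel \<partial>lborel)"
        by (rule lborel_pair.Fubini'[symmetric]) measurable
      also have "\<dots> \<le> (\<integral>\<^sup>+y. ennreal (D / 2 ^ n) * (\<gamma> y * indicator \<Omega> y) \<partial>lborel)"
      proof (rule nn_integral_mono)
        fix y
        have "(\<integral>\<^sup>+x. w x * (indicator X x * indicator (B n x) y * \<gamma> y) \<partial>lborel)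
           = (\<integral>\<^sup>+x. (w x * indicator {x\<in>X. y \<in> B n x} x) * (\<gamma> y * indicator \<Omega> y) \<partial>lborel)"
          using X(4) by (intro nn_integral_cong) (auto split: split_indicator)
        also have "\<dots> = (\<integral>\<^sup>+x\<in>{x\<in>X. y \<in> B n x}. w x \<partial>lborel) * (\<gamma> y * indicator \<Omega> y)"
          unfolding B_iff by (rule nn_integral_multc) measurable
        also have "\<dots> \<le> ennreal (D / 2 ^ n) * (\<gamma> y * indicator \<Omega> y)"
          by (intro mult_right_mono D) simp
        finally show "(\<integral>\<^sup>+x. w x * (indicator X x * indicator (B n x) y * \<gamma> y) \<partial>lborel)
          \<le> ennreal (D / 2 ^ n) * (\<gamma> y * indicator \<Omega> y)" .
      qed
      also have "\<dots> = ennreal (D / 2 ^ n) * (\<integral>\<^sup>+y\<in>\<Omega>. \<gamma> y \<partial>lborel)"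
        by (rule nn_integral_cmult) measurable
      also have "\<dots> \<le> ennreal (D / 2 ^ n) * ennreal \<epsilon>"
        using G by (intro mult_left_mono) (auto simp: \<gamma>_def)
      finally show ?thesis using D \<epsilon> by (simp flip: ennreal_mult)
    qed
    have "(\<integral>\<^sup>+x\<in>X. w x * (ennreal L * H x) \<partial>lborel) \<le> (\<integral>\<^sup>+x. ennreal L * (w x * H x) \<partial>lborel)"
      by (intro nn_integral_mono) (auto split: split_indicator simp: mult.left_commute[of "ennreal L"])
    also have "\<dots> = ennreal L * (\<integral>\<^sup>+x. (\<Sum>n. ennreal ((3/2) ^ n) * (w x * \<nu> n x)) \<partial>lborel)"
    proof -
      have "w x * H x = (\<Sum>n. ennreal ((3/2) ^ n) * (w x * \<nu> n x))" for x
        unfolding H_def by (subst ennreal_suminf_cmult[symmetric]) (simp add: mult_ac)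
      then show ?thesis by (simp add: nn_integral_cmult)
    qed
    also have "(\<integral>\<^sup>+x. (\<Sum>n. ennreal ((3/2) ^ n) * (w x * \<nu> n x)) \<partial>lborel)
      = (\<Sum>n. ennreal ((3/2) ^ n) * (\<integral>\<^sup>+x. w x * \<nu> n x \<partial>lborel))"
      by (subst nn_integral_suminf) (auto simp: nn_integral_cmult)
    also have "\<dots> \<le> (\<Sum>n. ennreal (D * \<epsilon> * (3/4) ^ n))"
    proof (rule suminf_le)
      fix n
      have "ennreal ((3/2) ^ n) * (\<integral>\<^sup>+x. w x * \<nu> n x \<partial>lborel) \<le> ennreal ((3/2) ^ n) * ennreal (D * \<epsilon> / 2 ^ n)"
        by (intro mult_left_mono layer) simp
      also have "\<dots> = ennreal (D * \<epsilon> * (3/4) ^ n)"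
        using D \<epsilon> by (simp add: power_divide power_mult_distrib[symmetric] flip: ennreal_mult)
      finally show "ennreal ((3/2) ^ n) * (\<integral>\<^sup>+x. w x * \<nu> n x \<partial>lborel) \<le> ennreal (D * \<epsilon> * (3/4) ^ n)" .
    qed auto
    also have "\<dots> = ennreal (4 * (D * \<epsilon>))"
      using D \<epsilon> sums_mult[OF geometric_sums[of "3/4::real"], of "D * \<epsilon>"]
      by (intro suminf_ennreal_eq) (auto simp: mult_ac)
    finally have "(\<integral>\<^sup>+x\<in>X. w x * (ennreal L * H x) \<partial>lborel) \<le> ennreal (L * (4 * (D * \<epsilon>)))"
      using L D \<epsilon> by (simp add: ennreal_mult mult_left_mono)
    then show "\<exists>H\<in>borel_measurable borel.
      (\<forall>x\<in>X. ennreal (exp_tail m (\<alpha> * \<bar>\<phi> (a x) - ball_average \<phi> (c 0 x) (\<rho> x)\<bar> powr q)) \<le> H x) \<and>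
      (\<integral>\<^sup>+x\<in>X. w x * H x \<partial>lborel) \<le> ennreal (L * (4 * (D * \<epsilon>)))"
      using pointwise by (intro bexI[of _ "\<lambda>x. ennreal L * H x"]) auto
  qed
qed

section \<open>Chains in a fixed direction\<close>

lemma dyadic_shells_disjoint:
  fixes a t :: real
  assumes "3 / 4 * (a / 2 ^ n) < t" "t < 5 / 4 * (a / 2 ^ n)"
    "3 / 4 * (a / 2 ^ m) < t" "t < 5 / 4 * (a / 2 ^ m)"
  shows "n = m"
proof -
  have *: False if "n < m" "3 / 4 * (a / 2 ^ n) < t" "t < 5 / 4 * (a / 2 ^ m)" "t < 5 / 4 * (a / 2 ^ n)" for n m
  proof -
    define u v where "u = a / 2 ^ n" and "v = a / 2 ^ m"
    note uv = that(2-4)[folded u_def v_def]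
    have "0 < u" using uv by linarith
    then have a: "0 < a" by (simp add: u_def zero_less_divide_iff)
    have "2 ^ Suc n \<le> (2::real) ^ m" using that by (intro power_increasing) auto
    then have "v \<le> u / 2" using a by (simp add: u_def v_def field_simps)
    with uv \<open>0 < u\<close> show False by linarith
  qed
  show ?thesis using *[of n m] *[of m n] assms by (cases n m rule: linorder_cases) auto
qed

lemma weighted_measure_le:
  fixes E :: "'a::euclidean_space set"
  assumes "\<And>x. x \<in> A \<Longrightarrow> x \<in> E \<and> w x \<le> ennreal W" "E \<in> sets borel"
    "emeasure lborel E \<le> ennreal V" "0 \<le> W" "W * V \<le> U"
  shows "(\<integral>\<^sup>+x\<in>A. w x \<partial>lborel) \<le> ennreal U"
proof -
  have "(\<integral>\<^sup>+x\<in>A. w x \<partial>lborel) \<le> (\<integral>\<^sup>+x. ennreal W * indicator E x \<partial>lborel)"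
    using assms(1) by (intro nn_integral_mono) (auto split: split_indicator)
  also have "\<dots> \<le> ennreal W * ennreal V"
    using assms by (simp add: nn_integral_cmult_indicator mult_left_mono)
  also have "\<dots> \<le> ennreal U"
    using assms by (metis ennreal_leI ennreal_mult')
  finally show ?thesis .
qed

text \<open>
  The \<open>n\<close>-th ball lies in the shell of radii between \<open>3 / 4\<close> and
  \<open>5 / 4\<close> times \<open>\<rho> x / 2 ^ n\<close> around \<open>x\<close>. Displacing
  the centres from \<open>x\<close> is what makes the balls disjoint.
\<close>

lemma ball_chain_direction:
  fixes \<Omega> :: "'a::euclidean_space set"
  assumes X: "X \<in> sets borel" and w: "w \<in> borel_measurable borel" and \<rho>: "continuous_on X \<rho>"
    and pos: "\<And>x. x \<in> X \<Longrightarrow> 0 < \<rho> x" and e: "norm e = 1" and \<kappa>: "0 < \<kappa>" "\<kappa> \<le> 1 / 4"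
    and sub: "\<And>x n. x \<in> X \<Longrightarrow> ball (x + (\<rho> x / 2 ^ n) *\<^sub>R e) (\<kappa> * \<rho> x / 2 ^ n) \<subseteq> \<Omega>"
    and D: "0 \<le> D" "\<And>n y. (\<integral>\<^sup>+x\<in>{x\<in>X. y \<in> ball (x + (\<rho> x / 2 ^ n) *\<^sub>R e) (\<kappa> * \<rho> x / 2 ^ n)}. w x \<partial>lborel)
      \<le> ennreal (D / 2 ^ n)"
  shows "ball_chain \<Omega> X w (\<lambda>n x. x + (\<rho> x / 2 ^ n) *\<^sub>R e) (\<lambda>x. \<kappa> * \<rho> x) (\<lambda>x. x)"
proof -
  have lim: "(\<lambda>n. x + (\<rho> x / 2 ^ n) *\<^sub>R e) \<longlonglongrightarrow> x" for x
  proof -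
    have "(\<lambda>n. \<rho> x * (1 / 2) ^ n) \<longlonglongrightarrow> \<rho> x * 0"
      by (intro tendsto_mult tendsto_const LIMSEQ_power_zero) simp
    then have "(\<lambda>n. x + (\<rho> x / 2 ^ n) *\<^sub>R e) \<longlonglongrightarrow> x + 0 *\<^sub>R e"
      by (intro tendsto_intros) (simp add: power_divide)
    then show ?thesis by simp
  qed
  have shell: "3 / 4 * (\<rho> x / 2 ^ n) < dist x y \<and> dist x y < 5 / 4 * (\<rho> x / 2 ^ n)"
    if x: "x \<in> X" and y: "y \<in> ball (x + (\<rho> x / 2 ^ n) *\<^sub>R e) (\<kappa> * \<rho> x / 2 ^ n)" for x y n
  proof -
    have c: "dist x (x + (\<rho> x / 2 ^ n) *\<^sub>R e) = \<rho> x / 2 ^ n"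
      using e pos[OF x] by (simp add: dist_norm)
    have "\<kappa> * (\<rho> x / 2 ^ n) \<le> 1 / 4 * (\<rho> x / 2 ^ n)"
      using \<kappa> pos[OF x] by (intro mult_right_mono) auto
    then have "dist (x + (\<rho> x / 2 ^ n) *\<^sub>R e) y < 1 / 4 * (\<rho> x / 2 ^ n)" using y by simp
    with c show ?thesis
      using dist_triangle[of x y "x + (\<rho> x / 2 ^ n) *\<^sub>R e"]
        dist_triangle[of x "x + (\<rho> x / 2 ^ n) *\<^sub>R e" y] by (simp add: dist_commute)
  qed
  have step: "dist (x + (\<rho> x / 2 ^ n) *\<^sub>R e) (x + (\<rho> x / 2 ^ Suc n) *\<^sub>R e) \<le> 1 / \<kappa> * (\<kappa> * \<rho> x / 2 ^ n)"
    if "x \<in> X" for x n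
  proof -
    have "dist (x + (\<rho> x / 2 ^ n) *\<^sub>R e) (x + (\<rho> x / 2 ^ Suc n) *\<^sub>R e)
      = norm ((\<rho> x / 2 ^ n - \<rho> x / 2 ^ Suc n) *\<^sub>R e)"
      by (simp only: dist_norm add_diff_cancel_left scaleR_left_diff_distrib)
    also have "\<dots> = \<rho> x / 2 ^ n / 2" using pos[OF that] e unfolding norm_scaleR by simp
    also have "\<dots> \<le> \<rho> x / 2 ^ n"
    proof -
      have "v / 2 \<le> v" if "0 \<le> v" for v :: real using that by simp
      from this[of "\<rho> x / 2 ^ n"] show ?thesis using pos[OF that] by (simp only: zero_le_divide_iff) simp
    qed
    finally show ?thesis using \<kappa> by simp
  qed
  show ?thesis
    unfolding ball_chain_def
  proof (intro conjI ballI allI)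
    show "disjoint_family (\<lambda>n. ball (x + (\<rho> x / 2 ^ n) *\<^sub>R e) (\<kappa> * \<rho> x / 2 ^ n))" if "x \<in> X" for x
      unfolding disjoint_family_on_def using shell[OF that] dyadic_shells_disjoint by blast
    show "\<exists>M\<ge>0. \<forall>x\<in>X. \<forall>n. dist (x + (\<rho> x / 2 ^ n) *\<^sub>R e) (x + (\<rho> x / 2 ^ Suc n) *\<^sub>R e)
        \<le> M * (\<kappa> * \<rho> x / 2 ^ n)"
      using step \<kappa> by (intro exI[of _ "1 / \<kappa>"]) auto
    show "\<exists>D\<ge>0. \<forall>n y. (\<integral>\<^sup>+x\<in>{x\<in>X. y \<in> ball (x + (\<rho> x / 2 ^ n) *\<^sub>R e) (\<kappa> * \<rho> x / 2 ^ n)}. w x \<partial>lborel)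
        \<le> ennreal (D / 2 ^ n)"
      using D by blast
    show "continuous_on X (\<lambda>x. x + (\<rho> x / 2 ^ n) *\<^sub>R e)" for n
      using \<rho> by (auto intro!: continuous_intros)
    show "continuous_on X (\<lambda>x. \<kappa> * \<rho> x)"
      using \<rho> by (auto intro!: continuous_intros)
  qed (use X w pos \<kappa> sub lim in auto)
qed

lemma emeasure_ball_dyadic:
  assumes "0 \<le> r"
  shows "emeasure lborel (ball (y::'a::euclidean_space) (r / 2 ^ n)) \<le> ennreal (unit_ball_vol (real DIM('a)) * r ^ DIM('a) / 2 ^ n)"
proof -
  have "(2::real) ^ n \<le> (2 ^ n) ^ DIM('a)" by (simp add: self_le_power)
  then show ?thesis
    using assms by (auto simp: emeasure_ball power_divide intro!: ennreal_leI divide_left_mono)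
qed

lemma ball_chain_cone:
  fixes \<Omega> :: "'a::euclidean_space set"
  assumes X: "X \<in> sets borel" and e: "norm e = 1" and \<kappa>: "0 < \<kappa>" "\<kappa> \<le> 1 / 4" and h: "0 < h"
    and cone: "\<And>x t. x \<in> X \<Longrightarrow> 0 < t \<Longrightarrow> t \<le> h \<Longrightarrow> ball (x + t *\<^sub>R e) (\<kappa> * t) \<subseteq> \<Omega>"
  shows "ball_chain \<Omega> X (\<lambda>_. 1) (\<lambda>n x. x + (h / 2 ^ n) *\<^sub>R e) (\<lambda>_. \<kappa> * h) (\<lambda>x. x)"
proof (rule ball_chain_direction[where D = "unit_ball_vol (real DIM('a)) * (2 * h) ^ DIM('a)"])
  show "ball (x + (h / 2 ^ n) *\<^sub>R e) (\<kappa> * h / 2 ^ n) \<subseteq> \<Omega>" if "x \<in> X" for x n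
  proof -
    have "h / 2 ^ n \<le> h / 1" using h by (intro divide_left_mono) auto
    then have "h / 2 ^ n \<le> h" by (simp only: div_by_1)
    moreover have "0 < h / 2 ^ n" using h by simp
    ultimately have "ball (x + (h / 2 ^ n) *\<^sub>R e) (\<kappa> * (h / 2 ^ n)) \<subseteq> \<Omega>"
      using cone[OF that] by blast
    then show ?thesis by (simp only: times_divide_eq_right)
  qed
  show "(\<integral>\<^sup>+x\<in>{x\<in>X. y \<in> ball (x + (h / 2 ^ n) *\<^sub>R e) (\<kappa> * h / 2 ^ n)}. 1 \<partial>lborel)
      \<le> ennreal (unit_ball_vol (real DIM('a)) * (2 * h) ^ DIM('a) / 2 ^ n)" for n y
  proof (rule weighted_measure_le[where W = 1 and E = "ball y (2 * h / 2 ^ n)"])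
    show "emeasure lborel (ball y (2 * h / 2 ^ n)) \<le> ennreal (unit_ball_vol (real DIM('a)) * (2 * h) ^ DIM('a) / 2 ^ n)"
      using h by (intro emeasure_ball_dyadic) simp
    fix x assume "x \<in> {x\<in>X. y \<in> ball (x + (h / 2 ^ n) *\<^sub>R e) (\<kappa> * h / 2 ^ n)}"
    then have "dist (x + (h / 2 ^ n) *\<^sub>R e) y < \<kappa> * (h / 2 ^ n)" by simp
    also have "\<dots> \<le> 1 / 4 * (h / 2 ^ n)" using \<kappa> h by (intro mult_right_mono) auto
    finally have "dist (x + (h / 2 ^ n) *\<^sub>R e) y < h / 2 ^ n / 4" by simp
    moreover have "dist x (x + (h / 2 ^ n) *\<^sub>R e) = h / 2 ^ n"
      using e h by (simp add: dist_norm)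
    moreover have "0 < h / 2 ^ n" using h by simp
    moreover define u where "u = h / 2 ^ n"
    ultimately have "dist x y < 2 * u"
      using dist_triangle[of x y "x + (h / 2 ^ n) *\<^sub>R e"] by (fold u_def) linarith
    then show "x \<in> ball y (2 * h / 2 ^ n) \<and> 1 \<le> ennreal 1" by (simp add: dist_commute u_def)
  qed auto
qed (use assms in auto)

section \<open>Volumes under expanding maps\<close>

text \<open>
  A substitute for the change of variables formula, which rests on almost everywhere
  differentiability of Lipschitz maps. Integrate the indicator of \<open>dist (S x) \<zeta> <
  h\<close> over \<open>x \<in> A\<close> and all \<open>\<zeta>\<close>. For fixed
  \<open>x\<close> the section is a ball of radius \<open>h\<close>; for fixed
  \<open>\<zeta>\<close> the section has diameter at most \<open>2 * L * h\<close> and is empty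
  unless \<open>\<zeta> \<in> F\<close>.
\<close>

lemma expanding_preimage_volume:
  fixes S :: "'a::euclidean_space \<Rightarrow> 'b::euclidean_space"
  assumes A: "A \<in> sets borel" and S: "continuous_on A S" and L: "0 < L"
    and expand: "\<And>x x'. x \<in> A \<Longrightarrow> x' \<in> A \<Longrightarrow> dist x x' \<le> L * dist (S x) (S x')"
    and F: "F \<in> sets borel" "\<And>x. x \<in> A \<Longrightarrow> ball (S x) h \<subseteq> F" and h: "0 < h"
  shows "emeasure lborel A * ennreal (unit_ball_vol (real DIM('b)) * h ^ DIM('b))
    \<le> emeasure lborel F * ennreal (unit_ball_vol (real DIM('a)) * (2 * L * h) ^ DIM('a))"
proof -
  note [measurable] = A F(1)
  define S' where "S' x = indicator A x *\<^sub>R S x" for x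
  have [measurable]: "S' \<in> borel_measurable borel"
    unfolding S'_def[abs_def] by (intro borel_measurable_continuous_on_indicator S) simp
  have "emeasure lborel A * ennreal (unit_ball_vol (real DIM('b)) * h ^ DIM('b))
      = (\<integral>\<^sup>+x. indicator A x * emeasure lborel (ball (S' x) h) \<partial>lborel)"
    using h by (simp add: emeasure_ball nn_integral_multc)
  also have "\<dots> = (\<integral>\<^sup>+x. \<integral>\<^sup>+\<zeta>. indicator {z. fst z \<in> A \<and> dist (S' (fst z)) (snd z) < h} (x, \<zeta>) \<partial>lborel \<partial>lborel)"
    by (intro nn_integral_cong) (auto simp: nn_integral_indicator[symmetric] simp del: nn_integral_indicator
        intro!: nn_integral_cong split: split_indicator)
  also have "\<dots> = (\<integral>\<^sup>+\<zeta>. \<integral>\<^sup>+x. indicator {z. fst z \<in> A \<and> dist (S' (fst z)) (snd z) < h} (x, \<zeta>) \<partial>lborel \<partial>lborel)"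
  proof (rule lborel_pair.Fubini'[symmetric])
    have "{z \<in> space (borel \<Otimes>\<^sub>M borel). fst z \<in> A \<and> dist (S' (fst z)) (snd z :: 'b) < h} \<in> sets (borel \<Otimes>\<^sub>M borel)"
      by measurable
    then show "(\<lambda>(x, \<zeta>). indicator {z. fst z \<in> A \<and> dist (S' (fst z)) (snd z) < h} (x, \<zeta>) :: ennreal)
        \<in> borel_measurable (lborel \<Otimes>\<^sub>M lborel)"
      by (simp add: space_pair_measure split_beta' cong: measurable_cong_sets sets_pair_measure_cong)
  qed
  also have "\<dots> \<le> (\<integral>\<^sup>+\<zeta>. ennreal (unit_ball_vol (real DIM('a)) * (2 * L * h) ^ DIM('a)) * indicator F \<zeta> \<partial>lborel)"
  proof (rule nn_integral_mono)
    fix \<zeta> :: 'b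
    let ?E = "{x \<in> A. dist (S x) \<zeta> < h}"
    have eq: "(\<integral>\<^sup>+x. indicator {z. fst z \<in> A \<and> dist (S' (fst z)) (snd z) < h} (x, \<zeta>) \<partial>lborel)
        = (\<integral>\<^sup>+x. indicator ?E x \<partial>lborel)"
      by (intro nn_integral_cong) (auto simp: S'_def split: split_indicator)
    show "(\<integral>\<^sup>+x. indicator {z. fst z \<in> A \<and> dist (S' (fst z)) (snd z) < h} (x, \<zeta>) \<partial>lborel)
        \<le> ennreal (unit_ball_vol (real DIM('a)) * (2 * L * h) ^ DIM('a)) * indicator F \<zeta>"
    proof (cases "?E = {}")
      case True
      show ?thesis unfolding eq True by simp
    next
      case False
      then obtain x1 where x1: "x1 \<in> A" "dist (S x1) \<zeta> < h" by auto
      then have "\<zeta> \<in> F" using F(2)[OF x1(1)] by (auto simp: subset_eq)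
      have "?E \<subseteq> ball x1 (2 * L * h)"
      proof
        fix x assume "x \<in> ?E"
        then have "dist (S x1) (S x) < 2 * h" "x \<in> A"
          using x1 dist_triangle2[of "S x1" "S x" \<zeta>] by auto
        then have "L * dist (S x1) (S x) < L * (2 * h)" using L by simp
        then show "x \<in> ball x1 (2 * L * h)" using expand[OF x1(1) \<open>x \<in> A\<close>] by simp
      qed
      then have "(\<integral>\<^sup>+x. indicator ?E x \<partial>lborel) \<le> (\<integral>\<^sup>+x. indicator (ball x1 (2 * L * h)) x \<partial>lborel)"
        by (intro nn_integral_mono) (auto split: split_indicator)
      also have "\<dots> = ennreal (unit_ball_vol (real DIM('a)) * (2 * L * h) ^ DIM('a))"
        using L h by (simp add: emeasure_ball)
      finally show ?thesis unfolding eq using \<open>\<zeta> \<in> F\<close> by simp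
    qed
  qed
  also have "\<dots> = emeasure lborel F * ennreal (unit_ball_vol (real DIM('a)) * (2 * L * h) ^ DIM('a))"
    using F by (subst nn_integral_cmult_indicator) (simp_all add: mult.commute)
  finally show ?thesis .
qed

section \<open>Chains near the surface\<close>

definition distance_weight :: "'a::euclidean_space set \<Rightarrow> 'a \<Rightarrow> ennreal" where
  "distance_weight K x = ennreal (1 / infdist x K ^ DIM('a))"

lemma measurable_distance_weight [measurable]: "distance_weight K \<in> borel_measurable borel"
proof -
  have [measurable]: "(\<lambda>x. infdist x K) \<in> borel_measurable borel"
    by (intro borel_measurable_continuous_onI continuous_intros)
  show ?thesis unfolding distance_weight_def[abs_def] by measurable
qed

lemma le_divide_ennreal:
  assumes "a * ennreal c \<le> ennreal v" "0 < c" "0 \<le> v"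
  shows "a \<le> ennreal (v / c)"
proof (cases a)
  case (real b)
  then have "b * c \<le> v" using assms by (simp flip: ennreal_mult)
  then show ?thesis using real assms by (auto simp: field_simps intro!: ennreal_leI)
qed (use assms in \<open>auto simp: ennreal_top_mult top_unique split: if_splits\<close>)

locale surface_chart =
  fixes \<Omega> K :: "'a::euclidean_space set" and x0 :: 'a and r :: real
    and T :: "(real ^ 'k) \<times> (real ^ 'm) \<Rightarrow> 'a" and S L C1
  assumes dim: "DIM('a) = CARD('k) + CARD('m)"
    and open_domain: "open \<Omega>" "x0 \<in> \<Omega>" and K: "closed K" "x0 \<in> K"
    and r: "0 < r" and T_bij: "bij_betw T reference_cylinder (ball x0 r)"
    and S_T: "\<And>\<xi>. \<xi> \<in> reference_cylinder \<Longrightarrow> S (T \<xi>) = \<xi>"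
    and L: "1 \<le> L" and T_lip: "L-lipschitz_on reference_cylinder T"
    and S_lip: "L-lipschitz_on (ball x0 r) S"
    and S_K: "S ` (ball x0 r \<inter> K) = {\<xi> \<in> reference_cylinder. fst \<xi> = 0}"
    and C1: "0 < C1"
    and infdist_ge: "\<And>\<xi>. \<xi> \<in> reference_cylinder \<Longrightarrow> T \<xi> \<in> \<Omega> - K \<Longrightarrow> C1 * norm (fst \<xi>) \<le> infdist (T \<xi>) K"
begin

lemma S_in: "x \<in> ball x0 r \<Longrightarrow> S x \<in> reference_cylinder"
  and T_S: "x \<in> ball x0 r \<Longrightarrow> T (S x) = x"
proof -
  assume "x \<in> ball x0 r"
  then obtain \<xi> where "\<xi> \<in> reference_cylinder" "x = T \<xi>" using T_bij unfolding bij_betw_def by blast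
  then show "S x \<in> reference_cylinder" "T (S x) = x" using S_T by simp_all
qed

lemma T_zero_in_K:
  fixes \<eta> :: "real ^ 'm"
  assumes "(0 :: real ^ 'k, \<eta>) \<in> reference_cylinder"
  shows "T (0, \<eta>) \<in> K"
proof -
  have "(0, \<eta>) \<in> S ` (ball x0 r \<inter> K)" unfolding S_K using assms by simp
  then obtain y where "y \<in> ball x0 r" "y \<in> K" "S y = (0, \<eta>)" by (auto simp del: mem_ball)
  with T_S[of y] show ?thesis by simp
qed

lemma S_centre: "fst (S x0) = 0"
  using S_K K r by (metis (mono_tags, lifting) IntI centre_in_ball imageI mem_Collect_eq)

lemma S_dist: "x \<in> ball x0 r \<Longrightarrow> y \<in> ball x0 r \<Longrightarrow> dist (S x) (S y) \<le> L * dist x y"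
  using S_lip by (auto dest: lipschitz_onD)

lemma T_dist: "\<xi> \<in> reference_cylinder \<Longrightarrow> \<zeta> \<in> reference_cylinder \<Longrightarrow> dist (T \<xi>) (T \<zeta>) \<le> L * dist \<xi> \<zeta>"
  using T_lip by (auto dest: lipschitz_onD)

text \<open>
  A stand-in for the distance from the surface, expressed in the chart.
\<close>

definition offset :: "'a \<Rightarrow> real" where "offset x = norm (fst (S x))"

text \<open>
  The path, from \<open>t = 1\<close> to \<open>t = 0\<close>, along which a chain runs from
  \<open>x\<close> down to a point of the surface.
\<close>

definition pull :: "real \<Rightarrow> 'a \<Rightarrow> 'a" where "pull t x = T (t *\<^sub>R fst (S x), snd (S x))"

lemma offset_nonneg: "0 \<le> offset x" by (simp add: offset_def)

lemma offset_pos: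
  assumes "x \<in> ball x0 r" "x \<notin> K"
  shows "0 < offset x"
proof (rule ccontr)
  assume "\<not> 0 < offset x"
  then have "S x = (0, snd (S x))" by (simp add: offset_def prod_eq_iff)
  with T_zero_in_K[of "snd (S x)"] S_in[OF assms(1)] T_S[OF assms(1)] assms(2) show False by metis
qed

lemma distance_weight_le:
  assumes "x \<in> ball x0 r" "x \<in> \<Omega>" "x \<notin> K" "b \<le> offset x" "0 < b"
  shows "distance_weight K x \<le> ennreal (1 / (C1 * b) ^ DIM('a))"
proof -
  have "C1 * b \<le> C1 * offset x" using C1 assms by simp
  also have "\<dots> \<le> infdist x K"
    using infdist_ge[OF S_in[OF assms(1)]] T_S[OF assms(1)] assms by (simp add: offset_def)
  finally have "(C1 * b) ^ DIM('a) \<le> infdist x K ^ DIM('a)"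
    using C1 assms by (intro power_mono) auto
  then show ?thesis
    unfolding distance_weight_def using C1 assms by (intro ennreal_leI frac_le) auto
qed

lemma dist_pull_point: "dist (t *\<^sub>R fst (S x), snd (S x)) (S x0) \<le> dist (S x) (S x0)" if "0 \<le> t" "t \<le> 1"
proof -
  have "(t * offset x)\<^sup>2 \<le> (offset x)\<^sup>2"
    using that offset_nonneg[of x] by (intro power_mono) (auto intro: mult_left_le_one_le)
  then show ?thesis
    using that S_centre unfolding dist_prod_def
    by (intro real_sqrt_le_mono add_mono) (auto simp: offset_def)
qed

text \<open>
  A neighbourhood of \<open>x0\<close> in which the contraction towards the surface, together
  with balls of radius comparable to the offset, stays inside the chart and inside the domain.
\<close>

lemma small_radius:
  obtains s where "0 < s" "s \<le> r"
    "\<And>x t. x \<in> ball x0 s \<Longrightarrow> 0 \<le> t \<Longrightarrow> t \<le> 1 \<Longrightarrow> (t *\<^sub>R fst (S x), snd (S x)) \<in> reference_cylinder"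
    "\<And>x t. x \<in> ball x0 s \<Longrightarrow> 0 \<le> t \<Longrightarrow> t \<le> 1 \<Longrightarrow> ball (pull t x) (offset x / (4 * L)) \<subseteq> \<Omega> \<inter> ball x0 r"
proof -
  have "open (reference_cylinder :: ((real ^ 'k) \<times> (real ^ 'm)) set)"
  proof -
    have "open {\<eta> :: real ^ 'm. \<forall>i. 0 < \<eta> $ i \<and> \<eta> $ i < 1}"
    proof -
      have "{\<eta> :: real ^ 'm. \<forall>i. 0 < \<eta> $ i \<and> \<eta> $ i < 1} = box 0 1" by (auto simp: mem_box_cart)
      then show ?thesis by (simp only: open_box)
    qed
    then show ?thesis unfolding reference_cylinder_def by (intro open_Times) auto
  qed
  moreover have "S x0 \<in> reference_cylinder" using S_in r by simp
  ultimately obtain \<kappa> where \<kappa>: "0 < \<kappa>" "ball (S x0) \<kappa> \<subseteq> reference_cylinder"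
    by (auto simp: open_contains_ball)
  have "open (\<Omega> \<inter> ball x0 r)" "x0 \<in> \<Omega> \<inter> ball x0 r" using open_domain r by auto
  then obtain r0 where r0: "0 < r0" "ball x0 r0 \<subseteq> \<Omega> \<inter> ball x0 r"
    by (meson open_contains_ball)
  define s where "s = Min {r, \<kappa> / L, r0 / (2 * L\<^sup>2)}"
  have s: "0 < s" "s \<le> r" "s \<le> \<kappa> / L" "s \<le> r0 / (2 * L\<^sup>2)"
    using r \<kappa> r0 L by (auto simp: s_def)
  have near: "dist (S x) (S x0) < \<kappa> \<and> dist (S x) (S x0) \<le> L * s" if "x \<in> ball x0 s" for x
  proof -
    have "dist (S x) (S x0) \<le> L * dist x x0" using S_dist[of x x0] that s r by auto
    also have "\<dots> < L * s" using that L by (simp add: dist_commute)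
    finally show ?thesis using s(3) L by (auto simp: field_simps)
  qed
  have cyl: "(t *\<^sub>R fst (S x), snd (S x)) \<in> reference_cylinder" if "x \<in> ball x0 s" "0 \<le> t" "t \<le> 1" for x t
    using dist_pull_point[OF that(2,3), of x] near[OF that(1)] \<kappa>(2) by (force simp: dist_commute)
  have "ball (pull t x) (offset x / (4 * L)) \<subseteq> \<Omega> \<inter> ball x0 r" if x: "x \<in> ball x0 s" and t: "0 \<le> t" "t \<le> 1" for x t
  proof -
    have "dist (pull t x) x0 = dist (pull t x) (T (S x0))" using T_S r by simp
    also have "\<dots> \<le> L * dist (t *\<^sub>R fst (S x), snd (S x)) (S x0)"
      unfolding pull_def using S_in r by (intro T_dist cyl x t) auto
    also have "\<dots> \<le> L * (L * s)"
      using dist_pull_point[OF t, of x] near[OF x] L by (intro mult_left_mono) auto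
    also have "\<dots> \<le> r0 / 2" using s(4) L by (simp add: field_simps power2_eq_square)
    finally have 1: "dist (pull t x) x0 \<le> r0 / 2" .
    have "offset x \<le> dist (S x) (S x0)"
      using dist_fst_le[of "S x" "S x0"] S_centre by (simp add: offset_def)
    also have "\<dots> \<le> L * s" using near[OF x] by simp
    finally have "offset x / (4 * L) \<le> s / 4" using L by (simp add: field_simps)
    also have "s \<le> r0 / 2"
    proof -
      have "r0 / (2 * L\<^sup>2) \<le> r0 / 2" using r0 L by (intro divide_left_mono) auto
      with s(4) show ?thesis by simp
    qed
    finally have 2: "offset x / (4 * L) \<le> r0 / 8" by simp
    have "ball (pull t x) (offset x / (4 * L)) \<subseteq> ball x0 r0"
    proof
      fix y assume "y \<in> ball (pull t x) (offset x / (4 * L))"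
      then have "dist x0 y < r0 / 2 + r0 / 8"
        using 1 2 dist_triangle[of x0 y "pull t x"] by (simp add: dist_commute)
      then show "y \<in> ball x0 r0" using r0 by simp
    qed
    with r0(2) show ?thesis by blast
  qed
  with s cyl show thesis by (intro that[of s]) auto
qed


text \<open>
  Two chains that start from the same ball, of size comparable to the distance from the surface.
  The first shrinks to \<open>x\<close>, the second to a point of the surface along \<open>pull
  (1 / 2 ^ n) x\<close>.

  The overlap condition for the second chain is where the dimension of the surface enters. If
  \<open>y\<close> lies in the \<open>n\<close>-th ball of \<open>x\<close>, then the offset of
  \<open>x\<close> is comparable to \<open>\<sigma> = 2 ^ n * offset y\<close>, while the
  tangential components of \<open>x\<close> and \<open>y\<close> differ by at most \<open>h =
  \<sigma> / 2 ^ n\<close>. In the chart, these \<open>x\<close> fill a set of volume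
  \<open>\<sigma> ^ CARD('k) * h ^ CARD('m)\<close> up to a constant, and their weight is of
  order \<open>1 / \<sigma> ^ DIM('a)\<close>. The product is \<open>1 / (2 ^ n) ^
  CARD('m)\<close>, which decays because the surface has positive dimension.
\<close>

lemma chains_near_surface:
  obtains s c c' \<rho> a where "0 < s"
    "ball_chain \<Omega> (ball x0 s \<inter> (\<Omega> - K)) (distance_weight K) c \<rho> (\<lambda>x. x)"
    "ball_chain \<Omega> (ball x0 s \<inter> (\<Omega> - K)) (distance_weight K) c' \<rho> a"
    "\<And>x. x \<in> ball x0 s \<inter> (\<Omega> - K) \<Longrightarrow> c' 0 x = c 0 x"
    "\<And>x. x \<in> ball x0 s \<inter> (\<Omega> - K) \<Longrightarrow> a x \<in> K"
proof -
  obtain s where s: "0 < s" "s \<le> r"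
    and cyl: "\<And>x t. x \<in> ball x0 s \<Longrightarrow> 0 \<le> t \<Longrightarrow> t \<le> 1 \<Longrightarrow> (t *\<^sub>R fst (S x), snd (S x)) \<in> reference_cylinder"
    and inside: "\<And>x t. x \<in> ball x0 s \<Longrightarrow> 0 \<le> t \<Longrightarrow> t \<le> 1 \<Longrightarrow> ball (pull t x) (offset x / (4 * L)) \<subseteq> \<Omega> \<inter> ball x0 r"
    using small_radius by metis
  define X where "X = ball x0 s \<inter> (\<Omega> - K)"
  have "open X" unfolding X_def using open_domain K by (intro open_Int open_Diff) auto
  then have [measurable]: "X \<in> sets borel" by simp
  have Xr: "x \<in> ball x0 r" "x \<in> ball x0 s" "x \<in> \<Omega>" "x \<notin> K" if "x \<in> X" for x
    using that s by (auto simp: X_def)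
  obtain e :: 'a where e: "norm e = 1" using vector_choose_size[of 1] by auto
  define R where "R x = offset x / (8 * L)" for x
  have R: "0 < R x" if "x \<in> X" for x
    using offset_pos[of x] Xr[OF that] L by (simp add: R_def)
  have cont_S: "continuous_on X S"
    using lipschitz_on_continuous_on[OF S_lip] by (rule continuous_on_subset) (use Xr in blast)
  have cont_T: "continuous_on reference_cylinder T"
    by (rule lipschitz_on_continuous_on[OF T_lip])
  have cont_R: "continuous_on X R"
    unfolding R_def[abs_def] offset_def[abs_def] using L by (intro continuous_intros cont_S) auto
  have cont_pull: "continuous_on X (pull t)" if "0 \<le> t" "t \<le> 1" for t
    unfolding pull_def[abs_def]
    by (rule continuous_on_compose2[OF cont_T]) (use cyl that Xr in \<open>auto intro!: continuous_intros cont_S\<close>)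
  have shift: "ball (pull t x + (R x / 2 ^ n) *\<^sub>R e) (1 / 4 * R x / 2 ^ n) \<subseteq> ball (pull t x) (offset x / (4 * L) / 2 ^ n)"
    if "x \<in> X" for x t n
  proof
    fix y assume y: "y \<in> ball (pull t x + (R x / 2 ^ n) *\<^sub>R e) (1 / 4 * R x / 2 ^ n)"
    define v where "v = R x / 2 ^ n"
    have "0 < v" using R[OF that] by (simp add: v_def)
    have "dist (pull t x) y \<le> dist (pull t x) (pull t x + v *\<^sub>R e) + dist (pull t x + v *\<^sub>R e) y"
      by (rule dist_triangle)
    also have "dist (pull t x) (pull t x + v *\<^sub>R e) = v" using e \<open>0 < v\<close> by (simp add: dist_norm)
    also have "v + dist (pull t x + v *\<^sub>R e) y < 2 * v"
      using y \<open>0 < v\<close> by (simp add: v_def)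
    also have "2 * v = offset x / (4 * L) / 2 ^ n" by (simp add: v_def R_def)
    finally show "y \<in> ball (pull t x) (offset x / (4 * L) / 2 ^ n)" by simp
  qed
  have shrink: "offset x / (4 * L) / 2 ^ n \<le> offset x / (4 * L)" for x n
  proof -
    have "0 \<le> offset x / (4 * L)" using offset_nonneg L by simp
    then have "offset x / (4 * L) / 2 ^ n \<le> offset x / (4 * L) / 1"
      by (intro divide_left_mono) auto
    then show ?thesis by (simp only: div_by_1)
  qed
  have sub: "ball (pull t x + (R x / 2 ^ n) *\<^sub>R e) (1 / 4 * R x / 2 ^ n) \<subseteq> \<Omega> \<inter> ball x0 r"
    if "x \<in> X" "0 \<le> t" "t \<le> 1" for x t n
    using shift[OF that(1), of t n] inside[OF Xr(2)[OF that(1)] that(2,3)] shrink[of x n]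
      subset_ball[OF shrink[of x n], of "pull t x"] by blast
  \<comment> \<open>in chart coordinates the balls are small compared with the offset, so they determine \<open>n\<close>\<close>
  have coords: "dist (S y) (t *\<^sub>R fst (S x), snd (S x)) < offset x / 4 / 2 ^ n"
    if "x \<in> X" "0 \<le> t" "t \<le> 1" "y \<in> ball (pull t x + (R x / 2 ^ n) *\<^sub>R e) (1 / 4 * R x / 2 ^ n)" for x y t n
  proof -
    have y: "y \<in> ball x0 r" "dist (pull t x) y < offset x / (4 * L) / 2 ^ n"
    proof -
      show "y \<in> ball x0 r" using sub[OF that(1-3)] that(4) by blast
      show "dist (pull t x) y < offset x / (4 * L) / 2 ^ n"
        using subsetD[OF shift[OF that(1)] that(4)] by (simp only: mem_ball)
    qed
    have "0 < offset x / (4 * L)" using R[OF that(1)] L by (simp add: R_def)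
    then have "pull t x \<in> ball x0 r"
      using inside[OF Xr(2)[OF that(1)] that(2,3)] centre_in_ball by blast
    moreover have "S (pull t x) = (t *\<^sub>R fst (S x), snd (S x))"
      unfolding pull_def by (intro S_T cyl Xr that)
    ultimately have "dist (S y) (t *\<^sub>R fst (S x), snd (S x)) \<le> L * dist (pull t x) y"
      using S_dist[OF y(1), of "pull t x"] by (simp add: dist_commute)
    also have "\<dots> < L * (offset x / (4 * L) / 2 ^ n)" using y(2) L by (intro mult_strict_left_mono) auto
    finally show ?thesis using L by simp
  qed
  have pull1: "pull 1 x = x" if "x \<in> X" for x
    using T_S[OF Xr(1)[OF that]] by (simp add: pull_def)
  have inner: "ball_chain \<Omega> X (distance_weight K) (\<lambda>n x. x + (R x / 2 ^ n) *\<^sub>R e) (\<lambda>x. 1 / 4 * R x) (\<lambda>x. x)"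
  proof (rule ball_chain_direction[where D = "(2 / C1) ^ DIM('a) * unit_ball_vol (real DIM('a))"])
    show "ball (x + (R x / 2 ^ n) *\<^sub>R e) (1 / 4 * R x / 2 ^ n) \<subseteq> \<Omega>" if "x \<in> X" for x n
      using sub[OF that, of 1 n] pull1[OF that] by auto
    show "(\<integral>\<^sup>+x\<in>{x\<in>X. y \<in> ball (x + (R x / 2 ^ n) *\<^sub>R e) (1 / 4 * R x / 2 ^ n)}. distance_weight K x \<partial>lborel)
      \<le> ennreal ((2 / C1) ^ DIM('a) * unit_ball_vol (real DIM('a)) / 2 ^ n)" for n y
    proof (rule weighted_measure_le[where W = "1 / (C1 * (offset y / 2)) ^ DIM('a)" and E = "ball y (offset y / 2 ^ n)"])
      show "emeasure lborel (ball y (offset y / 2 ^ n)) \<le> ennreal (unit_ball_vol (real DIM('a)) * offset y ^ DIM('a) / 2 ^ n)"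
        by (rule emeasure_ball_dyadic[OF offset_nonneg])
      show "1 / (C1 * (offset y / 2)) ^ DIM('a) * (unit_ball_vol (real DIM('a)) * offset y ^ DIM('a) / 2 ^ n)
          \<le> (2 / C1) ^ DIM('a) * unit_ball_vol (real DIM('a)) / 2 ^ n"
        using C1 by (cases "offset y = 0") (auto simp: power_mult_distrib power_divide)
      fix x assume "x \<in> {x\<in>X. y \<in> ball (x + (R x / 2 ^ n) *\<^sub>R e) (1 / 4 * R x / 2 ^ n)}"
      then have x: "x \<in> X" and y: "y \<in> ball (pull 1 x + (R x / 2 ^ n) *\<^sub>R e) (1 / 4 * R x / 2 ^ n)"
        using pull1 by auto
      have o: "0 < offset x" using offset_pos Xr[OF x] by blast
      have "dist (S y) (S x) < offset x / 4 / 2 ^ n" using coords[OF x _ _ y] by simp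
      also have "\<dots> \<le> offset x / 4 / 1" using o by (intro divide_left_mono) auto
      finally have "dist (fst (S y)) (fst (S x)) < offset x / 4"
        using dist_fst_le[of "S y" "S x"] by simp
      then have cmp: "3 / 4 * offset x < offset y" "offset y < 5 / 4 * offset x"
        unfolding offset_def dist_norm by norm+
      have "dist x y < offset x / (4 * L) / 2 ^ n"
        using shift[OF x, of 1 n] y pull1[OF x] by auto
      also have "\<dots> \<le> offset y / 2 ^ n"
      proof (rule divide_right_mono)
        have "offset x / (4 * L) \<le> offset x / 4" using L o by (intro divide_left_mono) auto
        with cmp o show "offset x / (4 * L) \<le> offset y" by linarith
      qed simp
      finally show "x \<in> ball y (offset y / 2 ^ n) \<and> distance_weight K x \<le> ennreal (1 / (C1 * (offset y / 2)) ^ DIM('a))"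
        using distance_weight_le[OF Xr(1,3,4)[OF x], of "offset y / 2"] cmp o by (auto simp: dist_commute)
    qed (use C1 offset_nonneg in auto)
  qed (use cont_R R e C1 in auto)

  have t01: "0 \<le> 1 / (2::real) ^ n" "1 / (2::real) ^ n \<le> 1" for n by auto
  define B where "B n x = ball (pull (1 / 2 ^ n) x + (R x / 2 ^ n) *\<^sub>R e) (1 / 4 * R x / 2 ^ n)" for n x
  have shell: "3 / 4 * (offset x / 2 ^ n) < offset y \<and> offset y < 5 / 4 * (offset x / 2 ^ n)
      \<and> dist (snd (S y)) (snd (S x)) < offset x / 2 ^ n / 4"
    if "x \<in> X" "y \<in> B n x" for x y n
  proof -
    let ?\<zeta> = "((1 / 2 ^ n) *\<^sub>R fst (S x), snd (S x))"
    have d: "dist (S y) ?\<zeta> < offset x / 4 / 2 ^ n"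
      using coords[OF that(1) t01] that(2) by (simp add: B_def)
    have "dist (fst (S y)) (fst ?\<zeta>) < offset x / 4 / 2 ^ n"
      using dist_fst_le[of "S y" ?\<zeta>] d by linarith
    moreover define v where "v = offset x / 2 ^ n"
    moreover have "norm (fst ?\<zeta>) = v" by (simp add: offset_def v_def)
    moreover have "\<bar>norm (fst (S y)) - norm (fst ?\<zeta>)\<bar> \<le> dist (fst (S y)) (fst ?\<zeta>)"
      unfolding dist_norm by (rule norm_triangle_ineq3)
    ultimately have "\<bar>offset y - v\<bar> < v / 4" by (simp add: offset_def)
    then have "3 / 4 * v < offset y \<and> offset y < 5 / 4 * v" by linarith
    then show ?thesis
      using dist_snd_le[of "S y" ?\<zeta>] d by (simp add: v_def)
  qed
  define U where "U = (2 / C1) ^ DIM('a) * (unit_ball_vol (real CARD('k)) * 3 ^ CARD('k) * (unit_ball_vol (real CARD('m)) * 2 ^ CARD('m))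
    * (unit_ball_vol (real DIM('a)) * (2 * L) ^ DIM('a)) / unit_ball_vol (real DIM('a)))"
  have U: "0 \<le> U" using C1 L by (simp add: U_def)
  have overlap: "(\<integral>\<^sup>+x\<in>{x\<in>X. y \<in> B n x}. distance_weight K x \<partial>lborel) \<le> ennreal (U / 2 ^ n)" for n y
  proof (cases "{x\<in>X. y \<in> B n x} = {}")
    case False
    define \<sigma> where "\<sigma> = 2 ^ n * offset y"
    define h where "h = \<sigma> / 2 ^ n"
    have bounds: "\<sigma> / 2 < offset x \<and> offset x < 2 * \<sigma> \<and> dist (snd (S y)) (snd (S x)) < h"
      if "x \<in> X" "y \<in> B n x" for x
    proof -
      define v where "v = offset x / 2 ^ n"
      have "offset x = 2 ^ n * v" "\<sigma> = 2 ^ n * h" "h = offset y" by (auto simp: v_def h_def \<sigma>_def)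
      moreover have "h / 2 < v" "v < 2 * h" "dist (snd (S y)) (snd (S x)) < h"
        using shell[OF that, folded v_def] \<open>h = offset y\<close> by linarith+
      ultimately show ?thesis by auto
    qed
    have \<sigma>: "0 < \<sigma>" using False bounds by fastforce
    then have h: "0 < h" "h \<le> \<sigma>" by (auto simp: h_def field_simps)
    define A where "A = {x\<in>X. y \<in> B n x}"
    have A: "A \<in> sets borel"
    proof -
      have "continuous_on X (\<lambda>x. 1 / 4 * R x / 2 ^ n - dist (pull (1 / 2 ^ n) x + (R x / 2 ^ n) *\<^sub>R e) y)"
        by (intro continuous_intros cont_R cont_pull t01) auto
      from continuous_open_preimage[OF this \<open>open X\<close> open_greaterThan[of 0]]
      have "open {x\<in>X. y \<in> B n x}" by (simp add: B_def Int_def vimage_def)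
      then show ?thesis by (simp add: A_def)
    qed
    \<comment> \<open>thickening by \<open>h\<close>, the smaller of the two side lengths, enlarges the volume by a bounded factor only\<close>
    define F :: "((real ^ 'k) \<times> (real ^ 'm)) set" where "F = ball 0 (3 * \<sigma>) \<times> ball (snd (S y)) (2 * h)"
    have F_vol: "emeasure lborel F = ennreal (unit_ball_vol (real CARD('k)) * (3 * \<sigma>) ^ CARD('k)
        * (unit_ball_vol (real CARD('m)) * (2 * h) ^ CARD('m)))"
    proof -
      have "emeasure lborel F = emeasure (lborel \<Otimes>\<^sub>M lborel) F" by (subst lborel_prod) (rule refl)
      also have "\<dots> = emeasure lborel (ball (0 :: real ^ 'k) (3 * \<sigma>)) * emeasure lborel (ball (snd (S y)) (2 * h))"
        unfolding F_def by (rule lborel.emeasure_pair_measure_Times) auto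
      finally show ?thesis using \<sigma> h by (simp add: emeasure_ball ennreal_mult)
    qed
    have "emeasure lborel A * ennreal (unit_ball_vol (real DIM((real ^ 'k) \<times> (real ^ 'm))) * h ^ DIM((real ^ 'k) \<times> (real ^ 'm)))
        \<le> emeasure lborel F * ennreal (unit_ball_vol (real DIM('a)) * (2 * L * h) ^ DIM('a))"
    proof (rule expanding_preimage_volume[OF A])
      show "continuous_on A S" using cont_S by (rule continuous_on_subset) (auto simp: A_def)
      show "F \<in> sets borel" unfolding F_def by (intro borel_open open_Times) auto
      show "dist x x' \<le> L * dist (S x) (S x')" if "x \<in> A" "x' \<in> A" for x x'
        using T_dist[OF S_in S_in, of x x'] T_S Xr(1) that by (simp add: A_def)
      show "ball (S x) h \<subseteq> F" if "x \<in> A" for x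
      proof
        fix \<zeta> assume \<zeta>: "\<zeta> \<in> ball (S x) h"
        have b: "offset x < 2 * \<sigma>" "dist (snd (S y)) (snd (S x)) < h"
          using bounds that by (auto simp: A_def)
        have "dist (fst (S x)) (fst \<zeta>) < h" "dist (snd (S x)) (snd \<zeta>) < h"
          using \<zeta> dist_fst_le[of "S x" \<zeta>] dist_snd_le[of "S x" \<zeta>] by auto
        moreover from this have "norm (fst \<zeta>) < offset x + h"
          unfolding offset_def dist_norm by norm
        ultimately have "norm (fst \<zeta>) < 3 * \<sigma>" "dist (snd (S y)) (snd \<zeta>) < 2 * h"
          using b h dist_triangle[of "snd (S y)" "snd \<zeta>" "snd (S x)"] by linarith+
        then show "\<zeta> \<in> F" by (simp add: F_def mem_Times_iff)
      qed
    qed (use L h in auto)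
    also have "\<dots> = ennreal (unit_ball_vol (real CARD('k)) * (3 * \<sigma>) ^ CARD('k)
        * (unit_ball_vol (real CARD('m)) * (2 * h) ^ CARD('m)) * (unit_ball_vol (real DIM('a)) * (2 * L * h) ^ DIM('a)))"
      unfolding F_vol using L h \<sigma> by (simp flip: ennreal_mult)
    finally have "emeasure lborel A \<le> ennreal (unit_ball_vol (real CARD('k)) * (3 * \<sigma>) ^ CARD('k)
        * (unit_ball_vol (real CARD('m)) * (2 * h) ^ CARD('m)) * (unit_ball_vol (real DIM('a)) * (2 * L * h) ^ DIM('a))
        / (unit_ball_vol (real DIM((real ^ 'k) \<times> (real ^ 'm))) * h ^ DIM((real ^ 'k) \<times> (real ^ 'm))))"
      by (rule le_divide_ennreal) (use L h \<sigma> in auto)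
    also have "\<dots> = ennreal (U * (C1 / 2) ^ DIM('a) * (\<sigma> ^ CARD('k) * h ^ CARD('m)))"
      using h C1 by (simp add: U_def dim power_mult_distrib power_divide field_simps)
    finally have vol: "emeasure lborel A \<le> ennreal (U * (C1 / 2) ^ DIM('a) * (\<sigma> ^ CARD('k) * h ^ CARD('m)))" .
    show ?thesis
    proof (rule weighted_measure_le[where W = "1 / (C1 * (\<sigma> / 2)) ^ DIM('a)" and E = A])
      show "x \<in> A \<and> distance_weight K x \<le> ennreal (1 / (C1 * (\<sigma> / 2)) ^ DIM('a))" if "x \<in> {x\<in>X. y \<in> B n x}" for x
        using that bounds[of x] distance_weight_le[of x "\<sigma> / 2"] Xr[of x] \<sigma> by (auto simp: A_def)
      have "h ^ CARD('m) \<le> \<sigma> ^ CARD('m) / 2 ^ n"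
      proof -
        have "(2::real) ^ n \<le> (2 ^ n) ^ CARD('m)" by (simp add: self_le_power)
        then show ?thesis using \<sigma> by (auto simp: h_def power_divide intro!: divide_left_mono)
      qed
      then have "\<sigma> ^ CARD('k) * h ^ CARD('m) \<le> \<sigma> ^ CARD('k) * (\<sigma> ^ CARD('m) / 2 ^ n)"
        using \<sigma> by (intro mult_left_mono) auto
      also have "\<dots> = \<sigma> ^ DIM('a) / 2 ^ n" by (simp add: dim power_add)
      finally have "U * (\<sigma> ^ CARD('k) * h ^ CARD('m)) / \<sigma> ^ DIM('a) \<le> U * (\<sigma> ^ DIM('a) / 2 ^ n) / \<sigma> ^ DIM('a)"
        using U \<sigma> by (intro divide_right_mono mult_left_mono) auto
      then show "1 / (C1 * (\<sigma> / 2)) ^ DIM('a) * (U * (C1 / 2) ^ DIM('a) * (\<sigma> ^ CARD('k) * h ^ CARD('m))) \<le> U / 2 ^ n"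
        using \<sigma> C1 by (simp add: power_mult_distrib power_divide)
    qed (use A vol C1 \<sigma> in auto)
  qed simp
  have limit: "(\<lambda>n. pull (1 / 2 ^ n) x + (R x / 2 ^ n) *\<^sub>R e) \<longlonglongrightarrow> pull 0 x" if x: "x \<in> X" for x
  proof -
    have z: "(\<lambda>n. 1 / (2::real) ^ n) \<longlonglongrightarrow> 0"
      using LIMSEQ_power_zero[of "1/2::real"] by (simp add: power_divide)
    have "(\<lambda>n. ((1 / 2 ^ n) *\<^sub>R fst (S x), snd (S x))) \<longlonglongrightarrow> (0 *\<^sub>R fst (S x), snd (S x))"
      by (intro tendsto_intros z)
    from continuous_on_tendsto_compose[OF cont_T this]
    have "(\<lambda>n. pull (1 / 2 ^ n) x) \<longlonglongrightarrow> pull 0 x"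
      unfolding pull_def using cyl[OF Xr(2)[OF x]] cyl[OF Xr(2)[OF x], of 0] by auto
    moreover have "(\<lambda>n. (R x * (1 / 2 ^ n)) *\<^sub>R e) \<longlonglongrightarrow> (R x * 0) *\<^sub>R e"
      by (intro tendsto_intros z)
    ultimately show ?thesis using tendsto_add by fastforce
  qed
  have step: "dist (pull (1 / 2 ^ n) x + (R x / 2 ^ n) *\<^sub>R e) (pull (1 / 2 ^ Suc n) x + (R x / 2 ^ Suc n) *\<^sub>R e)
      \<le> (32 * L\<^sup>2 + 4) * (1 / 4 * R x / 2 ^ n)" if x: "x \<in> X" for x n
  proof -
    define v where "v = R x / 2 ^ n"
    have v: "0 < v" "R x / 2 ^ Suc n = v / 2" using R[OF x] by (auto simp: v_def)
    have off: "offset x / 2 ^ n = 8 * L * v" using L by (simp add: v_def R_def)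
    let ?P = "(1 / 2 ^ n) *\<^sub>R fst (S x)" and ?P' = "(1 / 2 ^ Suc n) *\<^sub>R fst (S x)"
    have "dist (pull (1 / 2 ^ n) x) (pull (1 / 2 ^ Suc n) x) \<le> L * dist (?P, snd (S x)) (?P', snd (S x))"
      unfolding pull_def by (intro T_dist cyl Xr(2) x t01)
    also have "dist (?P, snd (S x)) (?P', snd (S x)) = norm ((1 / 2 ^ n - 1 / 2 ^ Suc n) *\<^sub>R fst (S x))"
      by (simp only: dist_Pair_Pair dist_self dist_norm scaleR_left_diff_distrib) simp
    also have "\<dots> = offset x / 2 ^ n / 2" unfolding norm_scaleR by (simp add: offset_def)
    finally have 1: "dist (pull (1 / 2 ^ n) x) (pull (1 / 2 ^ Suc n) x) \<le> 4 * L\<^sup>2 * v"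
      unfolding off by (simp add: power2_eq_square)
    have "dist (v *\<^sub>R e) ((v / 2) *\<^sub>R e) = norm ((v - v / 2) *\<^sub>R e)"
      by (simp only: dist_norm scaleR_left_diff_distrib)
    also have "\<dots> = v / 2" using e v unfolding norm_scaleR by simp
    finally have 2: "dist (v *\<^sub>R e) ((v / 2) *\<^sub>R e) = v / 2" .
    have "dist (pull (1 / 2 ^ n) x + v *\<^sub>R e) (pull (1 / 2 ^ Suc n) x + (v / 2) *\<^sub>R e) \<le> 4 * L\<^sup>2 * v + v / 2"
      using dist_triangle_add[of "pull (1 / 2 ^ n) x" "v *\<^sub>R e" "pull (1 / 2 ^ Suc n) x" "(v / 2) *\<^sub>R e"] 1 2 by linarith
    also have "\<dots> \<le> (32 * L\<^sup>2 + 4) * (1 / 4 * v)" using v by (simp add: algebra_simps)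
    finally show ?thesis unfolding v(2) by (simp add: v_def)
  qed
  have outer: "ball_chain \<Omega> X (distance_weight K) (\<lambda>n x. pull (1 / 2 ^ n) x + (R x / 2 ^ n) *\<^sub>R e)
      (\<lambda>x. 1 / 4 * R x) (pull 0)"
    unfolding ball_chain_def
  proof (intro conjI ballI allI)
    show "disjoint_family (\<lambda>n. ball (pull (1 / 2 ^ n) x + (R x / 2 ^ n) *\<^sub>R e) (1 / 4 * R x / 2 ^ n))" if "x \<in> X" for x
      unfolding disjoint_family_on_def B_def[symmetric] using shell[OF that] dyadic_shells_disjoint by blast
    show "\<exists>M\<ge>0. \<forall>x\<in>X. \<forall>n. dist (pull (1 / 2 ^ n) x + (R x / 2 ^ n) *\<^sub>R e) (pull (1 / 2 ^ Suc n) x + (R x / 2 ^ Suc n) *\<^sub>R e)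
        \<le> M * (1 / 4 * R x / 2 ^ n)"
      using step by (intro exI[of _ "32 * L\<^sup>2 + 4"]) auto
    show "\<exists>D\<ge>0. \<forall>n y. (\<integral>\<^sup>+x\<in>{x\<in>X. y \<in> ball (pull (1 / 2 ^ n) x + (R x / 2 ^ n) *\<^sub>R e) (1 / 4 * R x / 2 ^ n)}. distance_weight K x \<partial>lborel)
        \<le> ennreal (D / 2 ^ n)"
      using overlap U unfolding B_def by blast
    show "continuous_on X (\<lambda>x. pull (1 / 2 ^ n) x + (R x / 2 ^ n) *\<^sub>R e)" for n
      by (intro continuous_intros cont_R cont_pull t01) auto
    show "continuous_on X (\<lambda>x. 1 / 4 * R x)" by (intro continuous_intros cont_R)
    show "ball (pull (1 / 2 ^ n) x + (R x / 2 ^ n) *\<^sub>R e) (1 / 4 * R x / 2 ^ n) \<subseteq> \<Omega>" if "x \<in> X" for x n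
      using sub[OF that t01] by blast
  qed (use R limit in auto)
  show thesis
  proof (rule that[OF s(1), folded X_def, OF inner outer])
    show "pull (1 / 2 ^ 0) x + (R x / 2 ^ 0) *\<^sub>R e = x + (R x / 2 ^ 0) *\<^sub>R e" if "x \<in> X" for x
      using pull1[OF that] by simp
    show "pull 0 x \<in> K" if "x \<in> X" for x
      using T_zero_in_K[of "snd (S x)"] cyl[OF Xr(2)[OF that], of 0] by (simp add: pull_def)
  qed
qed

end

section \<open>Energies of differences and of Lipschitz functions\<close>

abbreviation gagliardo_energy :: "real \<Rightarrow> 'a::euclidean_space set \<Rightarrow> ('a \<Rightarrow> real) \<Rightarrow> ennreal" where
  "gagliardo_energy p \<Omega> u \<equiv> (\<integral>\<^sup>+y\<in>\<Omega>. gagliardo_density p \<Omega> u y \<partial>lborel)"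

lemma Gagliardo_integral_eq_energy:
  fixes \<Omega> :: "(real ^ 'd) set"
  assumes "s * p = real CARD('d)"
  shows "Gagliardo_integral s p \<Omega> u = gagliardo_energy p \<Omega> u"
  unfolding Gagliardo_integral_def gagliardo_density_def gagliardo_kernel_def nn_integral_completion
  using assms by simp

lemma Lp_integral_eq_lborel: "Lp_integral p \<Omega> u = (\<integral>\<^sup>+x\<in>\<Omega>. ennreal (\<bar>u x\<bar> powr p) \<partial>lborel)"
  unfolding Lp_integral_def nn_integral_completion ..

lemma gagliardo_energy_cong_AE:
  assumes "AE x in lborel. x \<in> \<Omega> \<longrightarrow> u x = v x"
  shows "gagliardo_energy p \<Omega> u = gagliardo_energy p \<Omega> v"
proof (rule nn_integral_cong_AE)
  show "AE y in lborel. gagliardo_density p \<Omega> u y * indicator \<Omega> y = gagliardo_density p \<Omega> v y * indicator \<Omega> y"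
    using assms
  proof eventually_elim
    case (elim y)
    have "gagliardo_density p \<Omega> u y = gagliardo_density p \<Omega> v y" if "y \<in> \<Omega>"
      unfolding gagliardo_density_def
    proof (rule nn_integral_cong_AE)
      show "AE z in lborel. gagliardo_kernel p u y z * indicator \<Omega> z = gagliardo_kernel p v y z * indicator \<Omega> z"
        using assms by eventually_elim (use elim that in \<open>auto simp: gagliardo_kernel_def split: split_indicator\<close>)
    qed
    then show ?case by (auto split: split_indicator)
  qed
qed

text \<open>
  Borel representatives give access to joint measurability on the product of Borel spaces, which
  is what the double integral requires.
\<close>

lemma borel_representative:
  fixes u :: "'a::euclidean_space \<Rightarrow> real"
  assumes "u \<in> borel_measurable (lebesgue_on \<Omega>)" "open \<Omega>"
  obtains v where "v \<in> borel_measurable borel" "AE x in lborel. x \<in> \<Omega> \<longrightarrow> u x = v x"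
proof -
  have "(\<lambda>x. indicator \<Omega> x *\<^sub>R u x) \<in> borel_measurable lebesgue"
    using assms by (subst borel_measurable_restrict_space_iff[symmetric]) auto
  from completion_ex_borel_measurable_real[OF this] obtain v
    where "v \<in> borel_measurable lborel" "AE x in lborel. indicator \<Omega> x *\<^sub>R u x = v x" by auto
  then show thesis by (intro that[of v]) (auto elim!: eventually_mono)
qed

lemma powr_abs_diff_le:
  fixes a b p :: real
  assumes "0 \<le> p"
  shows "\<bar>a - b\<bar> powr p \<le> 2 powr p * (\<bar>a\<bar> powr p + \<bar>b\<bar> powr p)"
proof -
  have *: "\<bar>a - b\<bar> powr p \<le> 2 powr p * (\<bar>a\<bar> powr p + \<bar>b\<bar> powr p)" if "\<bar>a\<bar> \<le> \<bar>b\<bar>" for a b :: real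
  proof -
    have "\<bar>a - b\<bar> powr p \<le> (2 * \<bar>b\<bar>) powr p" using that assms by (intro powr_mono2) auto
    then show ?thesis by (simp add: powr_mult algebra_simps add_increasing)
  qed
  show ?thesis using *[of a b] *[of b a] by (cases "\<bar>a\<bar> \<le> \<bar>b\<bar>") (auto simp: abs_minus_commute add.commute)
qed

lemma ennreal_powr_abs_diff_le:
  fixes a b p :: real
  assumes "0 \<le> p" "0 \<le> c"
  shows "ennreal (\<bar>a - b\<bar> powr p / c) \<le> ennreal (2 powr p) * (ennreal (\<bar>a\<bar> powr p / c) + ennreal (\<bar>b\<bar> powr p / c))"
proof -
  have "\<bar>a - b\<bar> powr p / c \<le> 2 powr p * (\<bar>a\<bar> powr p / c + \<bar>b\<bar> powr p / c)"
    using divide_right_mono[OF powr_abs_diff_le[OF assms(1), of a b] assms(2)]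
    by (simp add: add_divide_distrib[symmetric])
  then have "ennreal (\<bar>a - b\<bar> powr p / c) \<le> ennreal (2 powr p * (\<bar>a\<bar> powr p / c + \<bar>b\<bar> powr p / c))"
    by (rule ennreal_leI)
  also have "\<dots> = ennreal (2 powr p) * (ennreal (\<bar>a\<bar> powr p / c) + ennreal (\<bar>b\<bar> powr p / c))"
    using assms by (subst ennreal_mult) auto
  finally show ?thesis .
qed

lemma gagliardo_energy_diff_le:
  fixes u v :: "'a::euclidean_space \<Rightarrow> real"
  assumes "0 \<le> p" "open \<Omega>" "u \<in> borel_measurable (lebesgue_on \<Omega>)" "v \<in> borel_measurable (lebesgue_on \<Omega>)"
  shows "gagliardo_energy p \<Omega> (\<lambda>x. u x - v x) \<le> ennreal (2 powr p) * (gagliardo_energy p \<Omega> u + gagliardo_energy p \<Omega> v)"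
proof -
  obtain u' where u'[measurable]: "u' \<in> borel_measurable borel" and u_AE: "AE x in lborel. x \<in> \<Omega> \<longrightarrow> u x = u' x"
    using borel_representative[OF assms(3,2)] .
  obtain v' where v'[measurable]: "v' \<in> borel_measurable borel" and v_AE: "AE x in lborel. x \<in> \<Omega> \<longrightarrow> v x = v' x"
    using borel_representative[OF assms(4,2)] .
  have [measurable]: "\<Omega> \<in> sets borel" using assms by simp
  let ?c = "ennreal (2 powr p)"
  have ker: "gagliardo_kernel p (\<lambda>x. u' x - v' x) y z \<le> ?c * (gagliardo_kernel p u' y z + gagliardo_kernel p v' y z)" for y z
  proof -
    have eq: "u' y - v' y - (u' z - v' z) = (u' y - u' z) - (v' y - v' z)" by simp
    show ?thesis unfolding gagliardo_kernel_def eq by (intro ennreal_powr_abs_diff_le assms) simp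
  qed
  have dens: "gagliardo_density p \<Omega> (\<lambda>x. u' x - v' x) y \<le> ?c * (gagliardo_density p \<Omega> u' y + gagliardo_density p \<Omega> v' y)" for y
  proof -
    have "gagliardo_density p \<Omega> (\<lambda>x. u' x - v' x) y
        \<le> (\<integral>\<^sup>+z. ?c * (gagliardo_kernel p u' y z * indicator \<Omega> z + gagliardo_kernel p v' y z * indicator \<Omega> z) \<partial>lborel)"
      unfolding gagliardo_density_def using ker by (intro nn_integral_mono) (auto split: split_indicator)
    also have "\<dots> = ?c * (gagliardo_density p \<Omega> u' y + gagliardo_density p \<Omega> v' y)"
      unfolding gagliardo_density_def by (simp add: nn_integral_cmult nn_integral_add)
    finally show ?thesis .
  qed
  have "gagliardo_energy p \<Omega> (\<lambda>x. u x - v x) = gagliardo_energy p \<Omega> (\<lambda>x. u' x - v' x)"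
    by (rule gagliardo_energy_cong_AE) (use u_AE v_AE in eventually_elim, simp)
  also have "\<dots> \<le> (\<integral>\<^sup>+y. ?c * (gagliardo_density p \<Omega> u' y * indicator \<Omega> y + gagliardo_density p \<Omega> v' y * indicator \<Omega> y) \<partial>lborel)"
    using dens by (intro nn_integral_mono) (auto split: split_indicator)
  also have "\<dots> = ?c * (gagliardo_energy p \<Omega> u' + gagliardo_energy p \<Omega> v')"
    by (simp add: nn_integral_cmult nn_integral_add)
  also have "gagliardo_energy p \<Omega> u' = gagliardo_energy p \<Omega> u"
    by (rule gagliardo_energy_cong_AE) (use u_AE in eventually_elim, simp)
  also have "gagliardo_energy p \<Omega> v' = gagliardo_energy p \<Omega> v"
    by (rule gagliardo_energy_cong_AE) (use v_AE in eventually_elim, simp)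
  finally show ?thesis .
qed

lemma Lp_integral_diff_le:
  fixes u v :: "real ^ 'd \<Rightarrow> real"
  assumes "0 \<le> p" "open \<Omega>" "u \<in> borel_measurable (lebesgue_on \<Omega>)" "v \<in> borel_measurable (lebesgue_on \<Omega>)"
  shows "Lp_integral p \<Omega> (\<lambda>x. u x - v x) \<le> ennreal (2 powr p) * (Lp_integral p \<Omega> u + Lp_integral p \<Omega> v)"
proof -
  have restr: "Lp_integral p \<Omega> w = (\<integral>\<^sup>+x. ennreal (\<bar>w x\<bar> powr p) \<partial>lebesgue_on \<Omega>)" for w
    using assms unfolding Lp_integral_def by (subst nn_integral_restrict_space) auto
  note [measurable] = assms(3,4)
  have "Lp_integral p \<Omega> (\<lambda>x. u x - v x)
      \<le> (\<integral>\<^sup>+x. ennreal (2 powr p) * (ennreal (\<bar>u x\<bar> powr p) + ennreal (\<bar>v x\<bar> powr p)) \<partial>lebesgue_on \<Omega>)"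
    unfolding restr using ennreal_powr_abs_diff_le[OF assms(1), of 1] by (intro nn_integral_mono) simp
  also have "\<dots> = ennreal (2 powr p) * (Lp_integral p \<Omega> u + Lp_integral p \<Omega> v)"
    unfolding restr by (subst nn_integral_cmult, measurable) (subst nn_integral_add; measurable)
  finally show ?thesis .
qed

text \<open>
  For a Lipschitz function the kernel is at most a multiple of \<open>\<rho> powr (p - 2 *
  d)\<close> at distance \<open>\<rho>\<close>. This is integrable near \<open>0\<close> because
  \<open>p > d\<close>; the integral is estimated by dyadic balls. Finiteness matters because
  the real-valued norm reports the value \<open>0\<close> for an infinite integral: it excludes
  that a test function counts as an approximation merely because its energy is infinite.
\<close>

lemma gagliardo_energy_Lipschitz_finite:
  fixes \<Omega> :: "'a::euclidean_space set"
  assumes p: "real DIM('a) < p" and \<Omega>: "open \<Omega>" "bounded \<Omega>" and lip: "B-lipschitz_on UNIV \<phi>"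
  shows "gagliardo_energy p \<Omega> \<phi> < \<infinity>"
proof -
  let ?d = "real DIM('a)"
  have B: "0 \<le> B" using lip by (rule lipschitz_on_nonneg)
  obtain R0 where R0: "0 < R0" "\<Omega> \<subseteq> ball 0 R0" using bounded_subset_ballD[OF \<Omega>(2), of 0] by auto
  define R where "R = 2 * R0"
  have R: "0 < R" using R0 by (simp add: R_def)
  define a where "a n = B powr p * ((R / 2 ^ n) powr (p - ?d) * (2 ^ Suc n / R) ^ DIM('a))" for n :: nat
  define t where "t = (1 / 2 :: real) powr (p - ?d)"
  have t: "0 < t" "t < 1" using p powr_less_mono2[of "p - ?d" "1/2" 1] by (auto simp: t_def)
  define D where "D = B powr p * R powr (p - ?d) * 2 ^ DIM('a) * unit_ball_vol ?d / (1 - t)"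
  have D: "0 \<le> D" using t by (simp add: D_def)
  have dyadic: "\<exists>n. \<rho> < R / 2 ^ n \<and> R / 2 ^ Suc n \<le> \<rho>" if \<rho>: "0 < \<rho>" "\<rho> < R" for \<rho> :: real
  proof -
    have ex: "\<exists>n. R / 2 ^ n \<le> \<rho>"
    proof -
      obtain n where "(1/2::real) ^ n < \<rho> / R" using real_arch_pow_inv[of "\<rho> / R" "1/2"] \<rho> R by auto
      then have "R / 2 ^ n < \<rho>" using R by (simp add: power_divide field_simps)
      then show ?thesis by (intro exI[of _ n]) simp
    qed
    define N where "N = (LEAST n. R / 2 ^ n \<le> \<rho>)"
    have N: "R / 2 ^ N \<le> \<rho>" unfolding N_def using ex by (rule LeastI_ex)
    then have "0 < N" using \<rho> by (cases N) auto
    then have "\<not> R / 2 ^ (N - 1) \<le> \<rho>" unfolding N_def by (intro not_less_Least) auto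
    then show ?thesis using N \<open>0 < N\<close> by (intro exI[of _ "N - 1"]) auto
  qed
  have ker: "gagliardo_kernel p \<phi> y z \<le> (\<Sum>n. ennreal (a n) * indicator (ball y (R / 2 ^ n)) z)" if "y \<in> \<Omega>" "z \<in> \<Omega>" for y z
  proof (cases "y = z")
    case True
    then show ?thesis by (simp add: gagliardo_kernel_def)
  next
    case False
    define \<rho> where "\<rho> = norm (y - z)"
    have "norm y < R0" "norm z < R0" using R0(2) that by (auto simp: subset_eq)
    then have "\<rho> < R" using norm_triangle_ineq4[of y z] by (simp add: R_def \<rho>_def)
    then obtain n where n: "\<rho> < R / 2 ^ n" "R / 2 ^ Suc n \<le> \<rho>" using dyadic[of \<rho>] False by (auto simp: \<rho>_def)
    have \<rho>: "0 < \<rho>" using False by (simp add: \<rho>_def)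
    have "\<bar>\<phi> y - \<phi> z\<bar> powr p \<le> (B * \<rho>) powr p"
      using lipschitz_onD[OF lip, of y z] p by (intro powr_mono2) (auto simp: dist_norm \<rho>_def)
    also have "\<dots> = B powr p * \<rho> powr p" using B \<rho> by (simp add: powr_mult)
    finally have "\<bar>\<phi> y - \<phi> z\<bar> powr p / \<rho> powr (2 * ?d) \<le> B powr p * \<rho> powr p / \<rho> powr (2 * ?d)"
      by (rule divide_right_mono) simp
    also have "\<dots> = B powr p * (\<rho> powr (p - ?d) * (1 / \<rho>) ^ DIM('a))"
    proof -
      have "\<rho> powr (2 * ?d) = \<rho> powr ?d * \<rho> powr ?d" by (simp add: powr_add[symmetric])
      moreover have "\<rho> powr ?d = \<rho> ^ DIM('a)" using \<rho> by (rule powr_realpow)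
      ultimately show ?thesis using \<rho> by (simp add: powr_diff power_divide)
    qed
    also have "\<dots> \<le> a n"
    proof -
      have "1 / \<rho> \<le> 2 ^ Suc n / R"
        using divide_left_mono[OF n(2), of 1] \<rho> R by simp
      then show ?thesis
        unfolding a_def using \<rho> n(1) R p by (intro mult_left_mono mult_mono powr_mono2 power_mono) auto
    qed
    finally have "gagliardo_kernel p \<phi> y z \<le> ennreal (a n)"
      unfolding gagliardo_kernel_def \<rho>_def by (rule ennreal_leI)
    also have "\<dots> = ennreal (a n) * indicator (ball y (R / 2 ^ n)) z"
      using n by (simp add: \<rho>_def dist_norm)
    also have "\<dots> \<le> (\<Sum>n. ennreal (a n) * indicator (ball y (R / 2 ^ n)) z)"
    proof -
      have "f n \<le> suminf f" for f :: "nat \<Rightarrow> ennreal" using sum_le_suminf[of f "{n}"] by auto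
      then show ?thesis .
    qed
    finally show ?thesis .
  qed
  have dens: "gagliardo_density p \<Omega> \<phi> y \<le> ennreal D" if "y \<in> \<Omega>" for y
  proof -
    have "gagliardo_density p \<Omega> \<phi> y \<le> (\<integral>\<^sup>+z. (\<Sum>n. ennreal (a n) * indicator (ball y (R / 2 ^ n)) z) \<partial>lborel)"
      unfolding gagliardo_density_def using ker[OF that] by (intro nn_integral_mono) (auto split: split_indicator)
    also have "\<dots> = (\<Sum>n. ennreal (a n) * emeasure lborel (ball y (R / 2 ^ n)))"
      by (subst nn_integral_suminf) (auto simp: nn_integral_cmult_indicator)
    also have "\<dots> = (\<Sum>n. ennreal (B powr p * R powr (p - ?d) * 2 ^ DIM('a) * unit_ball_vol ?d * t ^ n))"
    proof (rule suminf_cong)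
      fix n
      have "(R / 2 ^ n) powr (p - ?d) = R powr (p - ?d) * t ^ n"
      proof -
        have "t ^ n = (1 / 2 ^ n) powr (p - ?d)"
          unfolding t_def by (simp add: powr_powr powr_realpow[symmetric] powr_divide mult.commute)
        then show ?thesis using R by (simp add: powr_divide)
      qed
      then have eq: "a n * (unit_ball_vol ?d * (R / 2 ^ n) ^ DIM('a)) =
          B powr p * R powr (p - ?d) * 2 ^ DIM('a) * unit_ball_vol ?d * t ^ n"
        unfolding a_def using R by (simp add: power_divide power_mult_distrib)
      have "ennreal (a n) * emeasure lborel (ball y (R / 2 ^ n))
          = ennreal (a n * (unit_ball_vol ?d * (R / 2 ^ n) ^ DIM('a)))"
        using R by (subst ennreal_mult) (auto simp: a_def emeasure_ball)
      then show "ennreal (a n) * emeasure lborel (ball y (R / 2 ^ n)) =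
          ennreal (B powr p * R powr (p - ?d) * 2 ^ DIM('a) * unit_ball_vol ?d * t ^ n)"
        unfolding eq .
    qed
    also have "\<dots> = ennreal D"
      using t sums_mult[OF geometric_sums[of t], of "B powr p * R powr (p - ?d) * 2 ^ DIM('a) * unit_ball_vol ?d"]
      by (intro suminf_ennreal_eq) (auto simp: D_def)
    finally show ?thesis .
  qed
  have "gagliardo_energy p \<Omega> \<phi> \<le> (\<integral>\<^sup>+y. ennreal D * indicator \<Omega> y \<partial>lborel)"
    using dens by (intro nn_integral_mono) (auto split: split_indicator)
  also have "\<dots> = ennreal D * emeasure lborel \<Omega>" using \<Omega> by (simp add: nn_integral_cmult_indicator)
  also have "\<dots> < \<infinity>" using emeasure_bounded_finite[OF \<Omega>(2)] by (simp add: ennreal_mult_less_top)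
  finally show ?thesis .
qed

lemma test_function_Lipschitz:
  fixes \<phi> :: "real ^ 'd \<Rightarrow> real"
  assumes "\<phi> \<in> test_functions U"
  shows "\<exists>B. B-lipschitz_on UNIV \<phi>"
proof -
  let ?C = "closure {x. \<phi> x \<noteq> 0}"
  let ?D = "\<lambda>x. frechet_derivative \<phi> (at x)"
  have "C_times 1 \<phi>" and C: "compact ?C" using assms by (auto simp: test_functions_def)
  then have diff: "\<phi> differentiable (at x)" and cont: "continuous_on UNIV (\<lambda>x. ?D x (axis i 1))" for x i
    by auto
  have zero: "?D x = (\<lambda>_. 0)" if "x \<notin> ?C" for x
  proof -
    have "((\<lambda>_. 0) has_derivative (\<lambda>_. 0)) (at x)" by simp
    then have "(\<phi> has_derivative (\<lambda>_. 0)) (at x)"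
      by (rule has_derivative_transform_within_open[of _ _ _ _ "- ?C"])
        (use that closure_subset[of "{x. \<phi> x \<noteq> 0}"] in auto)
    then show ?thesis by (rule frechet_derivative_at[symmetric])
  qed
  have "\<exists>M\<ge>0. \<forall>x. \<bar>?D x (axis i 1)\<bar> \<le> M" for i
  proof -
    have "bounded ((\<lambda>x. ?D x (axis i 1)) ` ?C)"
      by (intro compact_imp_bounded compact_continuous_image C continuous_on_subset[OF cont]) auto
    then obtain M where "0 < M" "\<And>x. x \<in> ?C \<Longrightarrow> \<bar>?D x (axis i 1)\<bar> \<le> M"
      by (auto simp: bounded_pos)
    then show ?thesis using zero by (intro exI[of _ M]) force
  qed
  then obtain M where M: "\<And>i. 0 \<le> M i" "\<And>i x. \<bar>?D x (axis i 1)\<bar> \<le> M i" by metis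
  have "onorm (?D x) \<le> (\<Sum>i\<in>UNIV. M i)" for x
  proof (rule onorm_le)
    fix h
    have "linear (?D x)" using linear_frechet_derivative[OF diff] .
    then have "?D x h = (\<Sum>i\<in>UNIV. h $ i * ?D x (axis i 1))"
      by (subst (1) basis_expansion[of h, symmetric])
        (simp add: linear_sum scalar_mult_eq_scaleR linear_scale)
    also have "\<bar>\<dots>\<bar> \<le> (\<Sum>i\<in>UNIV. \<bar>h $ i * ?D x (axis i 1)\<bar>)" by (rule sum_abs)
    also have "\<dots> \<le> (\<Sum>i\<in>UNIV. norm h * M i)"
      unfolding abs_mult using M component_le_norm_cart[of h] by (intro sum_mono mult_mono) auto
    finally show "norm (?D x h) \<le> (\<Sum>i\<in>UNIV. M i) * norm h"
      by (simp add: sum_distrib_left sum_distrib_right mult.commute)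
  qed
  then have "norm (\<phi> x - \<phi> y) \<le> (\<Sum>i\<in>UNIV. M i) * norm (x - y)" for x y
    by (intro differentiable_bound[of UNIV \<phi> ?D])
      (use diff in \<open>auto simp: frechet_derivative_works[symmetric]\<close>)
  then have "(\<Sum>i\<in>UNIV. M i)-lipschitz_on UNIV \<phi>"
    using M by (intro lipschitz_onI) (auto simp: dist_norm intro: sum_nonneg)
  then show ?thesis ..
qed

section \<open>Cones in Lipschitz domains\<close>

text \<open>
  Above the graph of a function with Lipschitz constant \<open>L\<close>, a cone with vertical
  axis and aperture \<open>1 / (L + 1)\<close> stays above the graph: over a horizontal
  displacement of at most \<open>norm w\<close> the graph rises by at most \<open>L * norm
  w\<close>, while the height gained is at least \<open>t - norm w\<close>.
\<close>

lemma Lipschitz_domain_cone: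
  fixes \<Omega> :: "(real ^ 'd) set"
  assumes "bounded_Lipschitz_domain \<Omega>" "z \<in> closure \<Omega>"
  obtains \<rho> e \<kappa> h where "0 < \<rho>" "norm e = 1" "0 < \<kappa>" "\<kappa> \<le> 1 / 4" "0 < h"
    "\<And>x t. x \<in> \<Omega> \<inter> ball z \<rho> \<Longrightarrow> 0 < t \<Longrightarrow> t \<le> h \<Longrightarrow> ball (x + t *\<^sub>R e) (\<kappa> * t) \<subseteq> \<Omega>"
proof (cases "z \<in> \<Omega>")
  case True
  obtain e :: "real ^ 'd" where e: "norm e = 1" using vector_choose_size[of 1] by auto
  obtain r where r: "0 < r" "ball z r \<subseteq> \<Omega>"
    using True assms(1) unfolding bounded_Lipschitz_domain_def by (meson open_contains_ball)
  show thesis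
  proof (rule that[of "r / 2" e "1 / 4" "r / 4"])
    fix x t assume x: "x \<in> \<Omega> \<inter> ball z (r / 2)" and t: "0 < t" "t \<le> r / 4"
    have "ball (x + t *\<^sub>R e) (1 / 4 * t) \<subseteq> ball z r"
    proof
      fix y assume y: "y \<in> ball (x + t *\<^sub>R e) (1 / 4 * t)"
      have "dist z y \<le> dist z x + (dist x (x + t *\<^sub>R e) + dist (x + t *\<^sub>R e) y)"
        using dist_triangle[of z y x] dist_triangle[of x y "x + t *\<^sub>R e"] by linarith
      also have "dist x (x + t *\<^sub>R e) = t" using e t by (simp add: dist_norm)
      finally show "y \<in> ball z r" using x y t by simp
    qed
    with r show "ball (x + t *\<^sub>R e) (1 / 4 * t) \<subseteq> \<Omega>" by blast
  qed (use r e in auto)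
next
  case False
  then have "z \<in> frontier \<Omega>"
    using assms unfolding bounded_Lipschitz_domain_def by (simp add: frontier_def interior_open)
  then obtain r e \<gamma> L where r: "0 < r" and e: "norm e = 1"
    and \<gamma>: "L-lipschitz_on {v. v \<bullet> e = 0} \<gamma>"
    and graph: "\<Omega> \<inter> ball z r = {x \<in> ball z r. \<gamma> ((x - z) - ((x - z) \<bullet> e) *\<^sub>R e) < (x - z) \<bullet> e}"
    using assms(1) unfolding bounded_Lipschitz_domain_def by blast
  have L: "0 \<le> L" using \<gamma> by (rule lipschitz_on_nonneg)
  have ee: "e \<bullet> e = 1" using e by (simp add: dot_square_norm)
  define \<kappa> where "\<kappa> = min (1 / 4) (1 / (L + 1))"
  have \<kappa>: "0 < \<kappa>" "\<kappa> \<le> 1 / 4" "(L + 1) * \<kappa> \<le> 1"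
    using L by (auto simp: \<kappa>_def min_def field_simps)
  define P where "P v = v - (v \<bullet> e) *\<^sub>R e" for v :: "real ^ 'd"
  have P: "P v \<bullet> e = 0" "norm (P v) \<le> norm v" for v
  proof -
    show "P v \<bullet> e = 0" by (simp add: P_def inner_diff_left ee)
    have "(norm (P v))\<^sup>2 = (norm v)\<^sup>2 - (v \<bullet> e)\<^sup>2"
      unfolding P_def power2_norm_eq_inner
      by (simp add: inner_diff_left inner_diff_right ee inner_commute power2_eq_square)
    then have "(norm (P v))\<^sup>2 \<le> (norm v)\<^sup>2" by simp
    then show "norm (P v) \<le> norm v" by (rule power2_le_imp_le) simp
  qed
  show thesis
  proof (rule that[of "r / 2" e \<kappa> "r / 4"])
    fix x t assume x: "x \<in> \<Omega> \<inter> ball z (r / 2)" and t: "0 < t" "t \<le> r / 4"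
    have "x \<in> \<Omega> \<inter> ball z r" using x r by (simp add: less_le_trans)
    then have xg: "\<gamma> (P (x - z)) < (x - z) \<bullet> e" unfolding graph P_def by blast
    show "ball (x + t *\<^sub>R e) (\<kappa> * t) \<subseteq> \<Omega>"
    proof
      fix y assume "y \<in> ball (x + t *\<^sub>R e) (\<kappa> * t)"
      define w where "w = y - (x + t *\<^sub>R e)"
      have w: "norm w < \<kappa> * t" "y = x + t *\<^sub>R e + w"
        using \<open>y \<in> _\<close> by (auto simp: w_def dist_norm norm_minus_commute)
      have \<kappa>t: "\<kappa> * t \<le> t / 4" using \<kappa> t by simp
      have "norm (y - z) = norm ((x - z) + (t *\<^sub>R e + w))" unfolding w(2) by (simp add: algebra_simps)
      then have "norm (y - z) \<le> norm (x - z) + (norm (t *\<^sub>R e) + norm w)"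
        using norm_triangle_ineq[of "x - z" "t *\<^sub>R e + w"] norm_triangle_ineq[of "t *\<^sub>R e" w] by linarith
      moreover have "norm (x - z) < r / 2" using x by (simp add: dist_norm norm_minus_commute)
      moreover have "norm (t *\<^sub>R e) = t" using e t by simp
      ultimately have "norm (y - z) < r" using w(1) \<kappa>t t by linarith
      then have "y \<in> ball z r" by (simp add: dist_norm norm_minus_commute)
      have "P (y - z) = P (x - z) + P w"
        unfolding w(2) P_def by (simp add: inner_add_left inner_diff_left ee algebra_simps)
      then have "dist (P (y - z)) (P (x - z)) \<le> norm w" using P(2)[of w] by (simp add: dist_norm)
      then have "dist (\<gamma> (P (y - z))) (\<gamma> (P (x - z))) \<le> L * norm w"
        using order_trans[OF lipschitz_onD[OF \<gamma>, of "P (y - z)" "P (x - z)"] mult_left_mono[OF _ L]] P(1)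
        by (simp only: mem_Collect_eq)
      then have "\<gamma> (P (y - z)) < (x - z) \<bullet> e + L * norm w" using xg by (simp add: dist_real_def)
      moreover have "(y - z) \<bullet> e = (x - z) \<bullet> e + t + w \<bullet> e"
        unfolding w(2) by (simp add: inner_add_left inner_diff_left ee)
      moreover have "\<bar>w \<bullet> e\<bar> \<le> norm w" using Cauchy_Schwarz_ineq2[of w e] e by simp
      moreover have "L * norm w + norm w \<le> t"
      proof -
        have "(L + 1) * norm w \<le> (L + 1) * (\<kappa> * t)" using w(1) L by (intro mult_left_mono) auto
        also have "\<dots> = (L + 1) * \<kappa> * t" by simp
        also have "\<dots> \<le> 1 * t" using \<kappa>(3) t by (intro mult_right_mono) auto
        finally show ?thesis by (simp add: algebra_simps)
      qed
      ultimately have "\<gamma> (P (y - z)) < (y - z) \<bullet> e" by linarith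
      then have "y \<in> \<Omega> \<inter> ball z r" unfolding graph using \<open>y \<in> ball z r\<close> by (simp add: P_def)
      then show "y \<in> \<Omega>" by simp
    qed
  qed (use r e \<kappa> in auto)
qed

section \<open>Uniform exponential bounds\<close>

text \<open>
  The exponent \<open>\<alpha>\<close> is quantified first: any exponent is allowed at the price
  of a smaller energy. Since the bound is uniform over functions that are continuous and vanish
  on \<open>K\<close>, it passes to limits.
\<close>

definition uniformly_exp_bounded ::
    "real \<Rightarrow> nat \<Rightarrow> (real ^ 'd) set \<Rightarrow> (real ^ 'd) set \<Rightarrow> (real ^ 'd) set \<Rightarrow> (real ^ 'd \<Rightarrow> ennreal) \<Rightarrow> bool" where
  "uniformly_exp_bounded p m \<Omega> K X w \<longleftrightarrow> (\<forall>\<alpha>>0. \<exists>\<epsilon>>0. \<exists>M. \<forall>\<phi>.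
     continuous_on UNIV \<phi> \<longrightarrow> (\<forall>x\<in>K. \<phi> x = 0) \<longrightarrow> gagliardo_energy p \<Omega> \<phi> \<le> ennreal \<epsilon> \<longrightarrow> Lp_integral p \<Omega> \<phi> \<le> 1 \<longrightarrow>
     (\<integral>\<^sup>+x\<in>X. w x * ennreal (exp_tail m (\<alpha> * \<bar>\<phi> x\<bar> powr (p / (p - 1)))) \<partial>lborel) \<le> ennreal M)"

lemma measurable_exp_tail [measurable]: "exp_tail m \<in> borel_measurable borel"
  by (rule borel_measurable_continuous_onI[OF continuous_on_exp_tail])

lemma uniformly_exp_bounded_Un:
  assumes [measurable]: "X \<in> sets borel" "Y \<in> sets borel" "w \<in> borel_measurable borel"
    and X: "uniformly_exp_bounded p m \<Omega> K X w" and Y: "uniformly_exp_bounded p m \<Omega> K Y w"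
  shows "uniformly_exp_bounded p m \<Omega> K (X \<union> Y) w"
  unfolding uniformly_exp_bounded_def
proof (intro allI impI)
  fix \<alpha> :: real assume \<alpha>: "0 < \<alpha>"
  let ?I = "\<lambda>X \<phi>. (\<integral>\<^sup>+x\<in>X. w x * ennreal (exp_tail m (\<alpha> * \<bar>\<phi> x\<bar> powr (p / (p - 1)))) \<partial>lborel)"
  let ?adm = "\<lambda>\<epsilon> M X. \<forall>\<phi>. continuous_on UNIV \<phi> \<longrightarrow> (\<forall>x\<in>K. \<phi> x = 0) \<longrightarrow>
      gagliardo_energy p \<Omega> \<phi> \<le> ennreal \<epsilon> \<longrightarrow> Lp_integral p \<Omega> \<phi> \<le> 1 \<longrightarrow> ?I X \<phi> \<le> ennreal M"
  obtain \<epsilon> M where \<epsilon>: "0 < \<epsilon>" and M: "?adm \<epsilon> M X"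
    using X[unfolded uniformly_exp_bounded_def, THEN spec, THEN mp, OF \<alpha>] by (elim exE conjE)
  obtain \<epsilon>' M' where \<epsilon>': "0 < \<epsilon>'" and M': "?adm \<epsilon>' M' Y"
    using Y[unfolded uniformly_exp_bounded_def, THEN spec, THEN mp, OF \<alpha>] by (elim exE conjE)
  have "?I (X \<union> Y) \<phi> \<le> ennreal (max 0 M + max 0 M')"
    if "continuous_on UNIV \<phi>" "\<forall>x\<in>K. \<phi> x = 0" "gagliardo_energy p \<Omega> \<phi> \<le> ennreal (min \<epsilon> \<epsilon>')" "Lp_integral p \<Omega> \<phi> \<le> 1" for \<phi>
  proof -
    have [measurable]: "\<phi> \<in> borel_measurable borel" using that(1) by (rule borel_measurable_continuous_onI)
    have E: "gagliardo_energy p \<Omega> \<phi> \<le> ennreal \<epsilon>" "gagliardo_energy p \<Omega> \<phi> \<le> ennreal \<epsilon>'"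
      using order_trans[OF that(3) ennreal_leI] by auto
    let ?f = "\<lambda>x. w x * ennreal (exp_tail m (\<alpha> * \<bar>\<phi> x\<bar> powr (p / (p - 1))))"
    have "?I (X \<union> Y) \<phi> \<le> (\<integral>\<^sup>+x. ?f x * indicator X x + ?f x * indicator Y x \<partial>lborel)"
      by (intro nn_integral_mono) (auto split: split_indicator)
    also have "\<dots> = ?I X \<phi> + ?I Y \<phi>" by (rule nn_integral_add) measurable
    also have "\<dots> \<le> ennreal (max 0 M) + ennreal (max 0 M')"
      using M that E(1) M' E(2) by (intro add_mono) (auto simp: ennreal_max_0)
    also have "\<dots> = ennreal (max 0 M + max 0 M')" by (simp add: ennreal_plus)
    finally show ?thesis .
  qed
  then show "\<exists>\<epsilon>>0. \<exists>M. \<forall>\<phi>. continuous_on UNIV \<phi> \<longrightarrow> (\<forall>x\<in>K. \<phi> x = 0) \<longrightarrow>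
      gagliardo_energy p \<Omega> \<phi> \<le> ennreal \<epsilon> \<longrightarrow> Lp_integral p \<Omega> \<phi> \<le> 1 \<longrightarrow> ?I (X \<union> Y) \<phi> \<le> ennreal M"
    using \<epsilon> \<epsilon>' by (intro exI[of _ "min \<epsilon> \<epsilon>'"] conjI exI[of _ "max 0 M + max 0 M'"]) auto
qed

lemma uniformly_exp_bounded_UN:
  assumes "finite I" "\<And>i. i \<in> I \<Longrightarrow> X i \<in> sets borel" "w \<in> borel_measurable borel"
    "\<And>i. i \<in> I \<Longrightarrow> uniformly_exp_bounded p m \<Omega> K (X i) w"
  shows "uniformly_exp_bounded p m \<Omega> K (\<Union>i\<in>I. X i) w"
  using assms
proof (induction I rule: finite_induct)
  case empty
  then show ?case by (auto simp: uniformly_exp_bounded_def intro: exI[of _ 1])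
next
  case (insert i I)
  then show ?case
    by (simp only: UN_insert) (intro uniformly_exp_bounded_Un; auto)
qed

lemma uniformly_exp_bounded_weight:
  assumes "uniformly_exp_bounded p m \<Omega> K X (\<lambda>_. 1)" "Y \<subseteq> X" "\<And>x. x \<in> Y \<Longrightarrow> w x \<le> ennreal c" "0 \<le> c"
    and [measurable]: "X \<in> sets borel"
  shows "uniformly_exp_bounded p m \<Omega> K Y w"
  unfolding uniformly_exp_bounded_def
proof (intro allI impI)
  fix \<alpha> :: real assume \<alpha>: "0 < \<alpha>"
  let ?f = "\<lambda>\<phi> x. ennreal (exp_tail m (\<alpha> * \<bar>\<phi> x\<bar> powr (p / (p - 1))))"
  obtain \<epsilon> M where \<epsilon>: "0 < \<epsilon>" and M: "\<forall>\<phi>. continuous_on UNIV \<phi> \<longrightarrow> (\<forall>x\<in>K. \<phi> x = 0) \<longrightarrow>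
      gagliardo_energy p \<Omega> \<phi> \<le> ennreal \<epsilon> \<longrightarrow> Lp_integral p \<Omega> \<phi> \<le> 1 \<longrightarrow> (\<integral>\<^sup>+x\<in>X. 1 * ?f \<phi> x \<partial>lborel) \<le> ennreal M"
    using assms(1)[unfolded uniformly_exp_bounded_def, THEN spec, THEN mp, OF \<alpha>] by (elim exE conjE)
  have "(\<integral>\<^sup>+x\<in>Y. w x * ?f \<phi> x \<partial>lborel) \<le> ennreal (c * M)"
    if "continuous_on UNIV \<phi>" "\<forall>x\<in>K. \<phi> x = 0" "gagliardo_energy p \<Omega> \<phi> \<le> ennreal \<epsilon>" "Lp_integral p \<Omega> \<phi> \<le> 1" for \<phi>
  proof -
    have [measurable]: "\<phi> \<in> borel_measurable borel" using that(1) by (rule borel_measurable_continuous_onI)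
    have "(\<integral>\<^sup>+x\<in>Y. w x * ?f \<phi> x \<partial>lborel) \<le> (\<integral>\<^sup>+x. ennreal c * (?f \<phi> x * indicator X x) \<partial>lborel)"
      using assms(2,3) by (intro nn_integral_mono) (auto split: split_indicator intro!: mult_right_mono)
    also have "\<dots> = ennreal c * (\<integral>\<^sup>+x\<in>X. ?f \<phi> x \<partial>lborel)" by (rule nn_integral_cmult) measurable
    also have "\<dots> \<le> ennreal c * ennreal M" using M that by (intro mult_left_mono) auto
    also have "\<dots> = ennreal (c * M)" using assms(4) by (simp add: ennreal_mult')
    finally show ?thesis .
  qed
  then show "\<exists>\<epsilon>>0. \<exists>M. \<forall>\<phi>. continuous_on UNIV \<phi> \<longrightarrow> (\<forall>x\<in>K. \<phi> x = 0) \<longrightarrow>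
      gagliardo_energy p \<Omega> \<phi> \<le> ennreal \<epsilon> \<longrightarrow> Lp_integral p \<Omega> \<phi> \<le> 1 \<longrightarrow> (\<integral>\<^sup>+x\<in>Y. w x * ?f \<phi> x \<partial>lborel) \<le> ennreal M"
    by (intro exI[of _ \<epsilon>] conjI[OF \<epsilon>] exI[of _ "c * M"] allI impI)
qed

text \<open>
  The two chains share their first ball. The average over it differs from \<open>\<phi>
  x\<close> by the telescoping sum of the first chain, and from the value \<open>0\<close> on
  the surface by that of the second.
\<close>

lemma uniformly_exp_bounded_near_surface:
  fixes \<Omega> :: "(real ^ 'd) set"
  assumes p: "1 < p" and m: "p - 1 \<le> real m" and chart: "surface_chart \<Omega> K x0 r T S L C1"
  obtains s where "0 < s" "uniformly_exp_bounded p m \<Omega> K (ball x0 s \<inter> (\<Omega> - K)) (distance_weight K)"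
proof -
  interpret surface_chart \<Omega> K x0 r T S L C1 by (rule chart)
  obtain s c c' \<rho> a where s: "0 < s"
    and chain: "ball_chain \<Omega> (ball x0 s \<inter> (\<Omega> - K)) (distance_weight K) c \<rho> (\<lambda>x. x)"
    and chain': "ball_chain \<Omega> (ball x0 s \<inter> (\<Omega> - K)) (distance_weight K) c' \<rho> a"
    and start: "\<And>x. x \<in> ball x0 s \<inter> (\<Omega> - K) \<Longrightarrow> c' 0 x = c 0 x"
    and a: "\<And>x. x \<in> ball x0 s \<inter> (\<Omega> - K) \<Longrightarrow> a x \<in> K"
    by (rule chains_near_surface, rule that)
  define X where "X = ball x0 s \<inter> (\<Omega> - K)"
  note X = chain[folded X_def] chain'[folded X_def] start[folded X_def] a[folded X_def]
  have [measurable]: "X \<in> sets borel" using open_domain K by (auto simp: X_def)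
  define q where "q = p / (p - 1)"
  have q: "0 < q" using p by (simp add: q_def)
  have "uniformly_exp_bounded p m \<Omega> K X (distance_weight K)"
    unfolding uniformly_exp_bounded_def q_def[symmetric]
  proof (intro allI impI)
    fix \<alpha> :: real assume \<alpha>: "0 < \<alpha>"
    define \<beta> where "\<beta> = \<alpha> * 2 powr q"
    have \<beta>: "0 < \<beta>" using \<alpha> by (simp add: \<beta>_def)
    let ?f = "\<lambda>a c \<phi> x. ennreal (exp_tail m (\<beta> * \<bar>\<phi> (a x) - ball_average \<phi> (c 0 x) (\<rho> x)\<bar> powr q))"
    obtain \<epsilon> M where \<epsilon>: "0 < \<epsilon>" and M: "\<forall>\<phi>. continuous_on UNIV \<phi> \<longrightarrow> gagliardo_energy p \<Omega> \<phi> \<le> ennreal \<epsilon> \<longrightarrow>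
        (\<exists>H\<in>borel_measurable borel. (\<forall>x\<in>X. ?f (\<lambda>x. x) c \<phi> x \<le> H x) \<and> (\<integral>\<^sup>+x\<in>X. distance_weight K x * H x \<partial>lborel) \<le> ennreal M)"
      using exp_tail_ball_chain[OF p q_def \<beta> m open_domain(1) X(1)] by (elim exE conjE)
    obtain \<epsilon>' M' where \<epsilon>': "0 < \<epsilon>'" and M': "\<forall>\<phi>. continuous_on UNIV \<phi> \<longrightarrow> gagliardo_energy p \<Omega> \<phi> \<le> ennreal \<epsilon>' \<longrightarrow>
        (\<exists>H\<in>borel_measurable borel. (\<forall>x\<in>X. ?f a c' \<phi> x \<le> H x) \<and> (\<integral>\<^sup>+x\<in>X. distance_weight K x * H x \<partial>lborel) \<le> ennreal M')"
      using exp_tail_ball_chain[OF p q_def \<beta> m open_domain(1) X(2)] by (elim exE conjE)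
    have "(\<integral>\<^sup>+x\<in>X. distance_weight K x * ennreal (exp_tail m (\<alpha> * \<bar>\<phi> x\<bar> powr q)) \<partial>lborel) \<le> ennreal (max 0 M + max 0 M')"
      if \<phi>: "continuous_on UNIV \<phi>" "\<forall>x\<in>K. \<phi> x = 0" "gagliardo_energy p \<Omega> \<phi> \<le> ennreal (min \<epsilon> \<epsilon>')" for \<phi>
    proof -
      have E: "gagliardo_energy p \<Omega> \<phi> \<le> ennreal \<epsilon>" "gagliardo_energy p \<Omega> \<phi> \<le> ennreal \<epsilon>'"
        using order_trans[OF that(3) ennreal_leI] by auto
      obtain H where [measurable]: "H \<in> borel_measurable borel" and H: "\<And>x. x \<in> X \<Longrightarrow> ?f (\<lambda>x. x) c \<phi> x \<le> H x"
        "(\<integral>\<^sup>+x\<in>X. distance_weight K x * H x \<partial>lborel) \<le> ennreal M"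
        using M[rule_format, OF \<phi>(1) E(1)] by blast
      obtain H' where [measurable]: "H' \<in> borel_measurable borel" and H': "\<And>x. x \<in> X \<Longrightarrow> ?f a c' \<phi> x \<le> H' x"
        "(\<integral>\<^sup>+x\<in>X. distance_weight K x * H' x \<partial>lborel) \<le> ennreal M'"
        using M'[rule_format, OF \<phi>(1) E(2)] by blast
      have pt: "ennreal (exp_tail m (\<alpha> * \<bar>\<phi> x\<bar> powr q)) \<le> H x + H' x" if x: "x \<in> X" for x
      proof -
        let ?A = "ball_average \<phi> (c 0 x) (\<rho> x)"
        have "exp_tail m (\<alpha> * \<bar>\<phi> x\<bar> powr q) \<le> exp_tail m (\<beta> * \<bar>\<phi> x - ?A\<bar> powr q) + exp_tail m (\<beta> * \<bar>\<phi> (a x) - ?A\<bar> powr q)"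
          unfolding \<beta>_def using q \<alpha> \<phi>(2) X(4)[OF x] by (intro exp_tail_max) auto
        then have "ennreal (exp_tail m (\<alpha> * \<bar>\<phi> x\<bar> powr q)) \<le> ?f (\<lambda>x. x) c \<phi> x + ?f a c' \<phi> x"
          using \<beta> X(3)[OF x] by (simp add: exp_tail_nonneg flip: ennreal_plus)
        also have "\<dots> \<le> H x + H' x" by (intro add_mono H H' x)
        finally show ?thesis .
      qed
      have "(\<integral>\<^sup>+x\<in>X. distance_weight K x * ennreal (exp_tail m (\<alpha> * \<bar>\<phi> x\<bar> powr q)) \<partial>lborel)
        \<le> (\<integral>\<^sup>+x. distance_weight K x * H x * indicator X x + distance_weight K x * H' x * indicator X x \<partial>lborel)"
        using pt by (intro nn_integral_mono) (auto split: split_indicator simp: distrib_left[symmetric] intro!: mult_left_mono)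
      also have "\<dots> = (\<integral>\<^sup>+x\<in>X. distance_weight K x * H x \<partial>lborel) + (\<integral>\<^sup>+x\<in>X. distance_weight K x * H' x \<partial>lborel)"
        by (rule nn_integral_add) measurable
      also have "\<dots> \<le> ennreal (max 0 M) + ennreal (max 0 M')"
        using H(2) H'(2) by (intro add_mono) (auto simp: ennreal_max_0)
      finally show ?thesis by (simp add: ennreal_plus)
    qed
    then show "\<exists>\<epsilon>>0. \<exists>M. \<forall>\<phi>. continuous_on UNIV \<phi> \<longrightarrow> (\<forall>x\<in>K. \<phi> x = 0) \<longrightarrow>
        gagliardo_energy p \<Omega> \<phi> \<le> ennreal \<epsilon> \<longrightarrow> Lp_integral p \<Omega> \<phi> \<le> 1 \<longrightarrow>
        (\<integral>\<^sup>+x\<in>X. distance_weight K x * ennreal (exp_tail m (\<alpha> * \<bar>\<phi> x\<bar> powr q)) \<partial>lborel) \<le> ennreal M"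
      using \<epsilon> \<epsilon>' by (intro exI[of _ "min \<epsilon> \<epsilon>'"] conjI exI[of _ "max 0 M + max 0 M'"]) auto
  qed
  with s show thesis by (intro that) (auto simp: X_def)
qed

text \<open>
  Here the weight is \<open>1\<close> and one chain inside the cone at \<open>x\<close>
  suffices. Its first ball has a fixed radius, so the \<open>L\<^sup>p\<close> norm bounds the
  average over it.
\<close>

lemma uniformly_exp_bounded_away:
  fixes \<Omega> :: "(real ^ 'd) set"
  assumes p: "1 < p" and m: "p - 1 \<le> real m" and \<Omega>: "bounded_Lipschitz_domain \<Omega>" and z: "z \<in> closure \<Omega>"
  obtains s where "0 < s" "uniformly_exp_bounded p m \<Omega> K (\<Omega> \<inter> ball z s) (\<lambda>_. 1)"
proof -
  have "open \<Omega>" "bounded \<Omega>" using \<Omega> by (auto simp: bounded_Lipschitz_domain_def)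
  obtain s e \<kappa> h where s: "0 < s" and e: "norm e = 1" and \<kappa>: "0 < \<kappa>" "\<kappa> \<le> 1 / 4" and h: "0 < h"
    and cone: "\<And>x t. x \<in> \<Omega> \<inter> ball z s \<Longrightarrow> 0 < t \<Longrightarrow> t \<le> h \<Longrightarrow> ball (x + t *\<^sub>R e) (\<kappa> * t) \<subseteq> \<Omega>"
    by (rule Lipschitz_domain_cone[OF \<Omega> z], rule that)
  define X where "X = \<Omega> \<inter> ball z s"
  have X: "X \<in> sets borel" using \<open>open \<Omega>\<close> by (simp add: X_def)
  note [measurable] = X
  have X_fin: "emeasure lborel X < \<infinity>"
    by (rule emeasure_bounded_finite) (auto simp: X_def intro: bounded_subset[OF bounded_ball])
  have chain: "ball_chain \<Omega> X (\<lambda>_. 1) (\<lambda>n x. x + (h / 2 ^ n) *\<^sub>R e) (\<lambda>_. \<kappa> * h) (\<lambda>x. x)"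
    by (rule ball_chain_cone[OF X e \<kappa> h]) (use cone in \<open>simp add: X_def\<close>)
  define q where "q = p / (p - 1)"
  have q: "0 < q" using p by (simp add: q_def)
  define b where "b = 1 + 1 / measure lborel (ball (0 :: real ^ 'd) (\<kappa> * h))"
  have b: "0 \<le> b" by (simp add: b_def)
  have "uniformly_exp_bounded p m \<Omega> K X (\<lambda>_. 1)"
    unfolding uniformly_exp_bounded_def q_def[symmetric]
  proof (intro allI impI)
    fix \<alpha> :: real assume \<alpha>: "0 < \<alpha>"
    define \<beta> where "\<beta> = \<alpha> * 2 powr q"
    have \<beta>: "0 < \<beta>" using \<alpha> by (simp add: \<beta>_def)
    obtain \<epsilon> M where \<epsilon>: "0 < \<epsilon>" and M: "\<forall>\<phi>. continuous_on UNIV \<phi> \<longrightarrow> gagliardo_energy p \<Omega> \<phi> \<le> ennreal \<epsilon> \<longrightarrow>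
        (\<exists>H\<in>borel_measurable borel.
          (\<forall>x\<in>X. ennreal (exp_tail m (\<beta> * \<bar>\<phi> x - ball_average \<phi> (x + (h / 2 ^ 0) *\<^sub>R e) (\<kappa> * h)\<bar> powr q)) \<le> H x) \<and>
          (\<integral>\<^sup>+x\<in>X. 1 * H x \<partial>lborel) \<le> ennreal M)"
      using exp_tail_ball_chain[OF p q_def \<beta> m \<open>open \<Omega>\<close> chain] by (elim exE conjE)
    define E where "E = exp_tail m (\<beta> * b powr q)"
    have E: "0 \<le> E" using \<beta> by (simp add: E_def exp_tail_nonneg)
    have "(\<integral>\<^sup>+x\<in>X. 1 * ennreal (exp_tail m (\<alpha> * \<bar>\<phi> x\<bar> powr q)) \<partial>lborel) \<le> ennreal (max 0 M + E * measure lborel X)"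
      if \<phi>: "continuous_on UNIV \<phi>" "gagliardo_energy p \<Omega> \<phi> \<le> ennreal \<epsilon>" "Lp_integral p \<Omega> \<phi> \<le> 1" for \<phi>
    proof -
      obtain H where [measurable]: "H \<in> borel_measurable borel"
        and H: "\<And>x. x \<in> X \<Longrightarrow> ennreal (exp_tail m (\<beta> * \<bar>\<phi> x - ball_average \<phi> (x + h *\<^sub>R e) (\<kappa> * h)\<bar> powr q)) \<le> H x"
        "(\<integral>\<^sup>+x\<in>X. H x \<partial>lborel) \<le> ennreal M"
        using M[rule_format, OF \<phi>(1,2)] by auto
      have pt: "ennreal (exp_tail m (\<alpha> * \<bar>\<phi> x\<bar> powr q)) \<le> H x + ennreal E" if x: "x \<in> X" for x
      proof -
        let ?A = "ball_average \<phi> (x + h *\<^sub>R e) (\<kappa> * h)"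
        have "(\<integral>\<^sup>+y\<in>ball (x + h *\<^sub>R e) (\<kappa> * h). ennreal (\<bar>\<phi> y\<bar> powr p) \<partial>lborel) \<le> Lp_integral p \<Omega> \<phi>"
          unfolding Lp_integral_eq_lborel using cone[of x h] x h
          by (intro nn_integral_mono) (auto simp: X_def split: split_indicator)
        then have "\<bar>?A\<bar> \<le> 1 + 1 / measure lborel (ball (x + h *\<^sub>R e) (\<kappa> * h))"
          using \<phi>(3) \<kappa> h by (intro ball_average_le_Lp[OF \<phi>(1) _ p]) auto
        also have "\<dots> = b" using \<kappa> h by (simp add: b_def content_ball)
        finally have "\<bar>\<phi> x\<bar> \<le> \<bar>\<phi> x - ?A\<bar> + b" by linarith
        then have "exp_tail m (\<alpha> * \<bar>\<phi> x\<bar> powr q) \<le> exp_tail m (\<beta> * \<bar>\<phi> x - ?A\<bar> powr q) + E"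
          unfolding \<beta>_def E_def using q \<alpha> b by (intro exp_tail_max) auto
        then have "ennreal (exp_tail m (\<alpha> * \<bar>\<phi> x\<bar> powr q)) \<le> ennreal (exp_tail m (\<beta> * \<bar>\<phi> x - ?A\<bar> powr q)) + ennreal E"
          using \<beta> E by (simp add: exp_tail_nonneg flip: ennreal_plus)
        also have "\<dots> \<le> H x + ennreal E" by (intro add_mono H x order_refl)
        finally show ?thesis .
      qed
      have "(\<integral>\<^sup>+x\<in>X. 1 * ennreal (exp_tail m (\<alpha> * \<bar>\<phi> x\<bar> powr q)) \<partial>lborel)
        \<le> (\<integral>\<^sup>+x. H x * indicator X x + ennreal E * indicator X x \<partial>lborel)"
        using pt by (intro nn_integral_mono) (auto split: split_indicator)
      also have "\<dots> = (\<integral>\<^sup>+x\<in>X. H x \<partial>lborel) + ennreal E * emeasure lborel X"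
        by (subst nn_integral_add) (auto simp: nn_integral_cmult_indicator)
      also have "\<dots> \<le> ennreal (max 0 M) + ennreal E * ennreal (measure lborel X)"
        using H(2) X_fin by (intro add_mono) (auto simp: ennreal_max_0 emeasure_eq_ennreal_measure)
      finally show ?thesis using E by (simp add: ennreal_plus ennreal_mult)
    qed
    then show "\<exists>\<epsilon>>0. \<exists>M. \<forall>\<phi>. continuous_on UNIV \<phi> \<longrightarrow> (\<forall>x\<in>K. \<phi> x = 0) \<longrightarrow>
        gagliardo_energy p \<Omega> \<phi> \<le> ennreal \<epsilon> \<longrightarrow> Lp_integral p \<Omega> \<phi> \<le> 1 \<longrightarrow>
        (\<integral>\<^sup>+x\<in>X. 1 * ennreal (exp_tail m (\<alpha> * \<bar>\<phi> x\<bar> powr q)) \<partial>lborel) \<le> ennreal M"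
      by (intro exI[of _ \<epsilon>] conjI[OF \<epsilon>] exI[of _ "max 0 M + E * measure lborel X"] allI impI)
  qed
  with s show thesis by (intro that) (auto simp: X_def)
qed

lemma surface_chart_exists:
  fixes \<Omega> K :: "(real ^ 'd) set"
  assumes surf: "C01_compact_surface TYPE('k::finite) TYPE('m::finite) \<Omega> K"
    and dim: "CARD('d) = CARD('k) + CARD('m)" and "open \<Omega>" and x0: "x0 \<in> K"
  shows "\<exists>r (T :: (real ^ 'k) \<times> (real ^ 'm) \<Rightarrow> real ^ 'd) S L C1. surface_chart \<Omega> K x0 r T S L C1"
proof -
  have K: "compact K" "K \<subseteq> \<Omega>" using surf by (auto simp: C01_compact_surface_def)
  obtain r and T :: "(real ^ 'k) \<times> (real ^ 'm) \<Rightarrow> real ^ 'd" and S C1 C2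
    where r: "0 < r" and T: "bij_betw T reference_cylinder (ball x0 r)" "\<forall>\<xi>\<in>reference_cylinder. S (T \<xi>) = \<xi>"
      and reg: "C01 (closure reference_cylinder) T" "C01 (closure (ball x0 r)) S"
      and S_K: "S ` (ball x0 r \<inter> K) = {\<xi> \<in> reference_cylinder. fst \<xi> = 0}"
      and C1: "0 < C1" "\<forall>\<xi>\<in>reference_cylinder. T \<xi> \<in> \<Omega> - K \<longrightarrow>
        C1 * norm (fst \<xi>) \<le> infdist (T \<xi>) K \<and> infdist (T \<xi>) K \<le> C2 * norm (fst \<xi>)"
    apply (insert surf[unfolded C01_compact_surface_def])
    apply (elim conjE exE)
    apply (drule bspec[OF _ x0])
    apply (elim conjE exE)
    apply (rule that; assumption)
    done
  obtain L1 L2 where L: "L1-lipschitz_on (closure reference_cylinder) T" "L2-lipschitz_on (closure (ball x0 r)) S"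
    using reg by (auto simp: C01_def)
  define L where "L = Max {1, L1, L2}"
  have "L-lipschitz_on reference_cylinder T" "L-lipschitz_on (ball x0 r) S"
    using lipschitz_on_mono[OF L(1) closure_subset, of L] lipschitz_on_mono[OF L(2) closure_subset, of L]
    by (simp_all add: L_def)
  moreover have "x0 \<in> \<Omega>" "1 \<le> L" using K(2) x0 by (auto simp: L_def)
  ultimately have "surface_chart \<Omega> K x0 r T S L C1"
    using dim \<open>open \<Omega>\<close> x0 compact_imp_closed[OF K(1)] r T S_K C1 by unfold_locales simp_all
  then show ?thesis by blast
qed

text \<open>
  Both \<open>K\<close> and the closure of \<open>\<Omega>\<close> are compact, so finitely many
  local bounds suffice.
\<close>

lemma uniformly_exp_bounded_domain:
  fixes \<Omega> K :: "(real ^ 'd) set"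
  assumes p: "1 < p" and m: "p - 1 \<le> real m" and \<Omega>: "bounded_Lipschitz_domain \<Omega>"
    and surf: "C01_compact_surface TYPE('k::finite) TYPE('m::finite) \<Omega> K"
    and dim: "CARD('d) = CARD('k) + CARD('m)"
  shows "uniformly_exp_bounded p m \<Omega> K (\<Omega> - K) (distance_weight K)"
proof -
  have "open \<Omega>" "bounded \<Omega>" using \<Omega> by (auto simp: bounded_Lipschitz_domain_def)
  have K: "compact K" "closed K" using surf by (auto simp: C01_compact_surface_def compact_imp_closed)
  have "\<forall>x\<in>K. \<exists>s>0. uniformly_exp_bounded p m \<Omega> K (ball x s \<inter> (\<Omega> - K)) (distance_weight K)"
  proof
    fix x0 assume "x0 \<in> K"
    then obtain r T S L C1
      where chart: "surface_chart \<Omega> K x0 r (T :: (real ^ 'k) \<times> (real ^ 'm) \<Rightarrow> real ^ 'd) S L C1"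
      using surface_chart_exists[OF surf dim \<open>open \<Omega>\<close>] by blast
    show "\<exists>s>0. uniformly_exp_bounded p m \<Omega> K (ball x0 s \<inter> (\<Omega> - K)) (distance_weight K)"
      by (rule uniformly_exp_bounded_near_surface[OF p m chart]) (intro exI conjI)
  qed
  then obtain s where s: "\<And>x. x \<in> K \<Longrightarrow> 0 < s x"
    "\<And>x. x \<in> K \<Longrightarrow> uniformly_exp_bounded p m \<Omega> K (ball x (s x) \<inter> (\<Omega> - K)) (distance_weight K)"
    by metis
  have "\<forall>z\<in>closure \<Omega>. \<exists>s>0. uniformly_exp_bounded p m \<Omega> K (\<Omega> \<inter> ball z s) (\<lambda>_. 1)"
  proof
    fix z assume z: "z \<in> closure \<Omega>"
    show "\<exists>s>0. uniformly_exp_bounded p m \<Omega> K (\<Omega> \<inter> ball z s) (\<lambda>_. 1)"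
      by (rule uniformly_exp_bounded_away[OF p m \<Omega> z]) (intro exI conjI)
  qed
  then obtain t where t: "\<And>z. z \<in> closure \<Omega> \<Longrightarrow> 0 < t z"
    "\<And>z. z \<in> closure \<Omega> \<Longrightarrow> uniformly_exp_bounded p m \<Omega> K (\<Omega> \<inter> ball z (t z)) (\<lambda>_. 1)"
    by metis
  obtain F where F: "F \<subseteq> K" "finite F" "K \<subseteq> (\<Union>x\<in>F. ball x (s x))"
    by (rule compactE_image[OF K(1), of K "\<lambda>x. ball x (s x)"]) (use s in \<open>auto intro!: centre_in_ball[THEN iffD2]\<close>)
  have "compact (closure \<Omega>)" using \<open>bounded \<Omega>\<close> by simp
  then obtain F' where F': "F' \<subseteq> closure \<Omega>" "finite F'" "closure \<Omega> \<subseteq> (\<Union>z\<in>F'. ball z (t z))"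
    by (rule compactE_image[of _ "closure \<Omega>" "\<lambda>z. ball z (t z)"]) (use t in \<open>auto intro!: centre_in_ball[THEN iffD2]\<close>)
  define U where "U = (\<Union>x\<in>F. ball x (s x))"
  have "open U" by (auto simp: U_def)
  have near: "uniformly_exp_bounded p m \<Omega> K (\<Union>x\<in>F. ball x (s x) \<inter> (\<Omega> - K)) (distance_weight K)"
    by (rule uniformly_exp_bounded_UN) (use F s \<open>open \<Omega>\<close> K in auto)
  have "uniformly_exp_bounded p m \<Omega> K (\<Union>z\<in>F'. \<Omega> \<inter> ball z (t z)) (\<lambda>_. 1)"
    by (rule uniformly_exp_bounded_UN) (use F' t \<open>open \<Omega>\<close> in auto)
  moreover have "(\<Union>z\<in>F'. \<Omega> \<inter> ball z (t z)) = \<Omega>" using F'(3) closure_subset[of \<Omega>] by auto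
  ultimately have whole: "uniformly_exp_bounded p m \<Omega> K \<Omega> (\<lambda>_. 1)" by simp
  have "closed (- U)" "K \<inter> - U = {}"
    using \<open>open U\<close> F(3) unfolding U_def[symmetric] by auto
  then obtain \<delta> where \<delta>: "0 < \<delta>" "\<forall>x\<in>K. \<forall>y\<in>- U. \<delta> \<le> dist x y"
    using separate_compact_closed[OF K(1)] by blast
  have away: "uniformly_exp_bounded p m \<Omega> K (\<Omega> - K - U) (distance_weight K)"
  proof (rule uniformly_exp_bounded_weight[OF whole])
    show "distance_weight K x \<le> ennreal (1 / \<delta> ^ CARD('d))" if "x \<in> \<Omega> - K - U" for x
    proof (cases "K = {}")
      case True
      then show ?thesis by (simp add: distance_weight_def infdist_def power_0_left)
    next
      case False
      then have "\<delta> \<le> infdist x K"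
        using \<delta>(2) that by (auto simp: infdist_def dist_commute intro!: cINF_greatest)
      then show ?thesis
        unfolding distance_weight_def using \<delta>(1) by (auto intro!: ennreal_leI frac_le power_mono)
    qed
  qed (use \<delta> \<open>open \<Omega>\<close> in auto)
  have "uniformly_exp_bounded p m \<Omega> K ((\<Union>x\<in>F. ball x (s x) \<inter> (\<Omega> - K)) \<union> (\<Omega> - K - U)) (distance_weight K)"
  proof (rule uniformly_exp_bounded_Un[OF _ _ _ near])
    show "(\<Union>x\<in>F. ball x (s x) \<inter> (\<Omega> - K)) \<in> sets borel"
      using \<open>open \<Omega>\<close> K by (intro borel_open open_UN ballI open_Int open_Diff) auto
  qed (use away \<open>open \<Omega>\<close> \<open>open U\<close> K in auto)
  moreover have "(\<Union>x\<in>F. ball x (s x) \<inter> (\<Omega> - K)) \<union> (\<Omega> - K - U) = \<Omega> - K" by (auto simp: U_def)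
  ultimately show ?thesis by simp
qed

section \<open>Approximation by test functions\<close>

lemma test_function_approximation:
  fixes \<Omega> K :: "(real ^ 'd) set"
  assumes p: "real CARD('d) < p" and sp: "s * p = real CARD('d)" and \<Omega>: "open \<Omega>" "bounded \<Omega>"
    and u: "u \<in> Wsp0 s p \<Omega> K" and \<eta>: "0 < \<eta>"
  obtains \<phi> where "\<phi> \<in> test_functions (\<Omega> - K)"
    "gagliardo_energy p \<Omega> (\<lambda>x. u x - \<phi> x) \<le> ennreal \<eta>" "Lp_integral p \<Omega> (\<lambda>x. u x - \<phi> x) \<le> ennreal \<eta>"
proof -
  have p0: "0 < p" using p by simp
  have u_W: "u \<in> borel_measurable (lebesgue_on \<Omega>)" "gagliardo_energy p \<Omega> u < \<infinity>" "Lp_integral p \<Omega> u < \<infinity>"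
    using u by (auto simp: Wsp0_def Wsp_def Gagliardo_integral_eq_energy[OF sp])
  have "0 < \<eta> powr (1 / p)" using \<eta> by simp
  then obtain \<phi> where \<phi>: "\<phi> \<in> test_functions (\<Omega> - K)" and norm: "Wsp_norm s p \<Omega> (\<lambda>x. u x - \<phi> x) < \<eta> powr (1 / p)"
    using u unfolding Wsp0_def by blast
  obtain B where B: "B-lipschitz_on UNIV \<phi>" using test_function_Lipschitz[OF \<phi>] ..
  have cont: "continuous_on UNIV \<phi>" using B by (rule lipschitz_on_continuous_on)
  have \<phi>_meas: "\<phi> \<in> borel_measurable (lebesgue_on \<Omega>)"
    by (rule continuous_imp_measurable_on_sets_lebesgue[OF continuous_on_subset[OF cont]]) (use \<Omega> in auto)
  have "compact (closure \<Omega>)" using \<Omega> by simp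
  then have "bounded (\<phi> ` closure \<Omega>)"
    by (intro compact_imp_bounded compact_continuous_image continuous_on_subset[OF cont]) auto
  then obtain b where b: "0 < b" "\<And>x. x \<in> \<Omega> \<Longrightarrow> \<bar>\<phi> x\<bar> \<le> b"
    using closure_subset[of \<Omega>] by (auto simp: bounded_pos)
  have "Lp_integral p \<Omega> \<phi> \<le> (\<integral>\<^sup>+x. ennreal (b powr p) * indicator \<Omega> x \<partial>lborel)"
    unfolding Lp_integral_eq_lborel using b p0
    by (intro nn_integral_mono) (auto split: split_indicator intro!: ennreal_leI powr_mono2)
  also have "\<dots> = ennreal (b powr p) * emeasure lborel \<Omega>" using \<Omega> by (simp add: nn_integral_cmult_indicator)
  also have "\<dots> < \<infinity>" using emeasure_bounded_finite[OF \<Omega>(2)] by (simp add: ennreal_mult_less_top)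
  finally have Lp_fin: "Lp_integral p \<Omega> \<phi> < \<infinity>" .
  have E_fin: "gagliardo_energy p \<Omega> \<phi> < \<infinity>"
    by (rule gagliardo_energy_Lipschitz_finite[OF _ \<Omega> B]) (use p in simp)
  let ?w = "\<lambda>x. u x - \<phi> x"
  have "gagliardo_energy p \<Omega> ?w < \<infinity>"
    by (rule le_less_trans[OF gagliardo_energy_diff_le]) (use p0 \<Omega> u_W \<phi>_meas E_fin in \<open>auto simp: ennreal_mult_less_top\<close>)
  then obtain E where E: "gagliardo_energy p \<Omega> ?w = ennreal E" "0 \<le> E" by (cases "gagliardo_energy p \<Omega> ?w") auto
  have "Lp_integral p \<Omega> ?w < \<infinity>"
    by (rule le_less_trans[OF Lp_integral_diff_le]) (use p0 \<Omega> u_W \<phi>_meas Lp_fin in \<open>auto simp: ennreal_mult_less_top\<close>)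
  then obtain N where N: "Lp_integral p \<Omega> ?w = ennreal N" "0 \<le> N" by (cases "Lp_integral p \<Omega> ?w") auto
  have "Wsp_norm s p \<Omega> ?w = (E + N) powr (1 / p)"
    using E N p0 by (simp add: Wsp_norm_def Wsp_seminorm_def Lp_norm_def Gagliardo_integral_eq_energy[OF sp] powr_powr)
  then have "E + N < \<eta>"
    using norm p0 \<eta> by (metis not_less powr_mono2 less_imp_le divide_nonneg_pos zero_le_one)
  with E N show thesis by (intro that[OF \<phi>]) (auto intro!: ennreal_leI)
qed

text \<open>
  Split \<open>u\<close> into a test function \<open>\<phi> 0\<close> and a remainder
  \<open>v\<close> of small norm. The test function is bounded and supported away from
  \<open>K\<close>, so it contributes a finite amount for any exponent. The remainder is the
  limit of the test functions \<open>\<phi> n - \<phi> 0\<close>, which have small norm as well,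
  so the uniform bound and Fatou's lemma apply to it.
\<close>

theorem corollary5p1:
  fixes d k :: nat
    and \<Omega> K :: "(real ^ 'd) set"
    and s p \<alpha> :: real
    and u :: "real ^ 'd \<Rightarrow> real"
  assumes "d = CARD('d)" and "k = CARD('k::finite)" and "d - k = CARD('m::finite)"
    and "1 < k" and "k < d"
    and "bounded_Lipschitz_domain \<Omega>"
    and "C01_compact_surface TYPE('k) TYPE('m) \<Omega> K"
    and "p > 1" and "0 < s" and "s < 1" and "s * p = real d"
    and "u \<in> Wsp0 s p \<Omega> K"
    and "\<alpha> > 0"
  shows "(\<integral>\<^sup>+x\<in>\<Omega>. ennreal (Phi d s (\<alpha> * \<bar>u x\<bar> powr (real d / (real d - s)))
                        * (1 / infdist x K ^ d)) \<partial>lebesgue) < \<infinity>"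
proof -
  let ?w = "distance_weight K"
  have \<Omega>: "open \<Omega>" "bounded \<Omega>" using assms(6) by (auto simp: bounded_Lipschitz_domain_def)
  have K: "compact K" "K \<subseteq> \<Omega>" using assms(7) by (auto simp: C01_compact_surface_def)
  have dim: "CARD('d) = CARD('k) + CARD('m)" using assms(1-5) by simp
  have sp: "s * p = real CARD('d)" using assms by simp
  have ds: "real d / s = p" using assms(9,11) by (simp add: field_simps)
  define q where "q = p / (p - 1)"
  have q: "0 < q" "real d / (real d - s) = q"
    using assms(8,9) unfolding assms(11)[symmetric] q_def by (auto simp: field_simps)
  have dp: "real CARD('d) < p"
    using assms(8,10) unfolding sp[symmetric] by simp
  obtain m where m: "1 \<le> m" "p - 1 \<le> real m" and Phi: "Phi d s = exp_tail m"
    using Phi_eq_exp_tail[of d s] assms(8) unfolding ds by blast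
  define \<beta> where "\<beta> = \<alpha> * 2 powr q"
  have \<beta>: "0 < \<beta>" using assms(13) by (simp add: \<beta>_def)
  let ?f = "\<lambda>v x. ?w x * ennreal (exp_tail m (\<beta> * \<bar>v x\<bar> powr q))"
  obtain \<epsilon> M where \<epsilon>: "0 < \<epsilon>" and M: "\<forall>\<phi>. continuous_on UNIV \<phi> \<longrightarrow> (\<forall>x\<in>K. \<phi> x = 0) \<longrightarrow>
      gagliardo_energy p \<Omega> \<phi> \<le> ennreal \<epsilon> \<longrightarrow> Lp_integral p \<Omega> \<phi> \<le> 1 \<longrightarrow> (\<integral>\<^sup>+x\<in>\<Omega> - K. ?f \<phi> x \<partial>lborel) \<le> ennreal M"
    using uniformly_exp_bounded_domain[OF assms(8) m(2) assms(6,7) dim, unfolded uniformly_exp_bounded_def q_def[symmetric],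
        THEN spec, THEN mp, OF \<beta>] by (elim exE conjE)
  define \<eta> where "\<eta> = min \<epsilon> 1 / (2 * 2 powr p)"
  have \<eta>: "0 < \<eta>" using \<epsilon> by (simp add: \<eta>_def)
  have "\<forall>n. \<exists>\<phi>. \<phi> \<in> test_functions (\<Omega> - K) \<and> gagliardo_energy p \<Omega> (\<lambda>x. u x - \<phi> x) \<le> ennreal (\<eta> * (1/2) ^ n)
      \<and> Lp_integral p \<Omega> (\<lambda>x. u x - \<phi> x) \<le> ennreal (\<eta> * (1/2) ^ n)"
    by (rule allI, rule_tac \<eta> = "\<eta> * (1/2) ^ n" in test_function_approximation[OF dp sp \<Omega> assms(12)]) (use \<eta> in auto)
  from choice[OF this] obtain \<phi> where \<phi>_props: "\<forall>n. \<phi> n \<in> test_functions (\<Omega> - K) \<and>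
      gagliardo_energy p \<Omega> (\<lambda>x. u x - \<phi> n x) \<le> ennreal (\<eta> * (1/2) ^ n) \<and>
      Lp_integral p \<Omega> (\<lambda>x. u x - \<phi> n x) \<le> ennreal (\<eta> * (1/2) ^ n)" ..
  have \<phi>: "\<phi> n \<in> test_functions (\<Omega> - K)"
    "gagliardo_energy p \<Omega> (\<lambda>x. u x - \<phi> n x) \<le> ennreal (\<eta> * (1/2) ^ n)"
    "Lp_integral p \<Omega> (\<lambda>x. u x - \<phi> n x) \<le> ennreal (\<eta> * (1/2) ^ n)" for n
    using \<phi>_props by simp_all
  have cont: "continuous_on UNIV (\<phi> n)" for n
    using test_function_Lipschitz[OF \<phi>(1)] lipschitz_on_continuous_on by blast
  have zero_K: "\<phi> n x = 0" if "x \<in> K" for n x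
    using \<phi>(1)[of n] that closure_subset[of "{x. \<phi> n x \<noteq> 0}"] by (auto simp: test_functions_def)
  have u_meas [measurable]: "u \<in> borel_measurable (lebesgue_on \<Omega>)"
    using assms(12) by (simp add: Wsp0_def Wsp_def)
  have \<phi>_meas [measurable]: "\<phi> n \<in> borel_measurable (lebesgue_on \<Omega>)" for n
    by (rule continuous_imp_measurable_on_sets_lebesgue[OF continuous_on_subset[OF cont]]) (use \<Omega> in auto)
  have w_meas [measurable]: "?w \<in> borel_measurable (lebesgue_on \<Omega>)"
  proof (rule measurable_restrict_space1)
    show "?w \<in> borel_measurable lebesgue" by (rule measurable_completion) simp
  qed
  have restr: "(\<integral>\<^sup>+x\<in>\<Omega>. g x \<partial>lebesgue) = (\<integral>\<^sup>+x. g x \<partial>lebesgue_on \<Omega>)" for g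
    using \<Omega> by (subst nn_integral_restrict_space) auto
  define \<psi> where "\<psi> n x = \<phi> n x - \<phi> 0 x" for n x
  have \<psi>_cont: "continuous_on UNIV (\<psi> n)" for n
    unfolding \<psi>_def[abs_def] by (intro continuous_intros cont)
  have small: "\<eta> * (1/2) ^ n \<le> \<eta>" for n :: nat
    using \<eta> by (simp add: mult_left_le power_le_one)
  have combine: "ennreal (2 powr p) * (ennreal (\<eta> * (1/2) ^ 0) + ennreal (\<eta> * (1/2) ^ n)) \<le> ennreal (min \<epsilon> 1)" for n :: nat
  proof -
    have "2 powr p * (\<eta> * (1/2) ^ 0 + \<eta> * (1/2) ^ n) \<le> 2 powr p * (\<eta> + \<eta>)"
      using small[of n] by (intro mult_left_mono add_mono) auto
    also have "\<dots> = min \<epsilon> 1" by (simp add: \<eta>_def)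
    finally show ?thesis using \<eta> by (simp add: ennreal_leI flip: ennreal_plus ennreal_mult)
  qed
  have \<psi>_eq: "\<psi> n = (\<lambda>x. (u x - \<phi> 0 x) - (u x - \<phi> n x))" for n
    by (simp add: \<psi>_def fun_eq_iff)
  have meas_diff: "(\<lambda>x. u x - \<phi> n x) \<in> borel_measurable (lebesgue_on \<Omega>)" for n by measurable
  have "gagliardo_energy p \<Omega> (\<psi> n) \<le> ennreal (min \<epsilon> 1)" for n
    unfolding \<psi>_eq
    by (rule order_trans[OF gagliardo_energy_diff_le[OF _ \<Omega>(1) meas_diff meas_diff] order_trans[OF _ combine[of n]]])
      (use assms(8) in \<open>auto intro!: mult_left_mono add_mono \<phi>(2) simp del: power_0\<close>)
  then have \<psi>_E: "gagliardo_energy p \<Omega> (\<psi> n) \<le> ennreal \<epsilon>" for n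
    by (rule order_trans) (auto intro: ennreal_leI)
  have "Lp_integral p \<Omega> (\<psi> n) \<le> ennreal (min \<epsilon> 1)" for n
    unfolding \<psi>_eq
    by (rule order_trans[OF Lp_integral_diff_le[OF _ \<Omega>(1) meas_diff meas_diff] order_trans[OF _ combine[of n]]])
      (use assms(8) in \<open>auto intro!: mult_left_mono add_mono \<phi>(3) simp del: power_0\<close>)
  moreover have "ennreal (min \<epsilon> 1) \<le> 1" by (metis ennreal_1 ennreal_leI min.cobounded2)
  ultimately have \<psi>_L: "Lp_integral p \<Omega> (\<psi> n) \<le> 1" for n
    by (rule order_trans)
  have w_K: "?w x = 0" if "x \<in> K" for x using that by (simp add: distance_weight_def)
  have \<psi>_bound: "(\<integral>\<^sup>+x. ?f (\<psi> n) x \<partial>lebesgue_on \<Omega>) \<le> ennreal M" for n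
  proof -
    have "(\<integral>\<^sup>+x. ?f (\<psi> n) x \<partial>lebesgue_on \<Omega>) = (\<integral>\<^sup>+x\<in>\<Omega> - K. ?f (\<psi> n) x \<partial>lborel)"
      unfolding restr[symmetric] nn_integral_completion
      using w_K by (intro nn_integral_cong) (auto split: split_indicator)
    also have "\<dots> \<le> ennreal M"
      by (rule M[rule_format, OF \<psi>_cont _ \<psi>_E \<psi>_L]) (simp add: \<psi>_def zero_K)
    finally show ?thesis .
  qed
  \<comment> \<open>the errors are summable in \<open>L\<^sup>p\<close>, which forces convergence almost everywhere\<close>
  have conv: "AE x in lebesgue_on \<Omega>. (\<lambda>n. \<phi> n x) \<longlonglongrightarrow> u x"
  proof -
    have "(\<integral>\<^sup>+x. (\<Sum>n. ennreal (\<bar>u x - \<phi> n x\<bar> powr p)) \<partial>lebesgue_on \<Omega>)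
        = (\<Sum>n. Lp_integral p \<Omega> (\<lambda>x. u x - \<phi> n x))"
      unfolding Lp_integral_def restr by (rule nn_integral_suminf) measurable
    also have "\<dots> \<le> (\<Sum>n. ennreal (\<eta> * (1/2) ^ n))" by (intro suminf_le \<phi>) auto
    also have "\<dots> = ennreal (\<eta> * 2)"
      using \<eta> sums_mult[OF geometric_sums[of "1/2::real"], of \<eta>] by (intro suminf_ennreal_eq) auto
    finally have "(\<integral>\<^sup>+x. (\<Sum>n. ennreal (\<bar>u x - \<phi> n x\<bar> powr p)) \<partial>lebesgue_on \<Omega>) \<noteq> \<infinity>"
      by (auto simp: top_unique)
    then have "AE x in lebesgue_on \<Omega>. (\<Sum>n. ennreal (\<bar>u x - \<phi> n x\<bar> powr p)) \<noteq> \<infinity>"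
      by (intro nn_integral_noteq_infinite) measurable
    then show ?thesis
    proof eventually_elim
      case (elim x)
      then have "(\<lambda>n. \<bar>u x - \<phi> n x\<bar> powr p) \<longlonglongrightarrow> 0"
        by (intro summable_LIMSEQ_zero summable_suminf_not_top) auto
      then have "(\<lambda>n. (\<bar>u x - \<phi> n x\<bar> powr p) powr (1 / p)) \<longlonglongrightarrow> 0 powr (1 / p)"
        using assms(8) by (intro tendsto_powr') auto
      then have "(\<lambda>n. \<bar>u x - \<phi> n x\<bar>) \<longlonglongrightarrow> 0" using assms(8) by (simp add: powr_powr)
      then have "(\<lambda>n. u x - \<phi> n x) \<longlonglongrightarrow> 0" by (rule tendsto_rabs_zero_cancel)
      from tendsto_diff[OF tendsto_const[of "u x"] this] show ?case by simp
    qed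
  qed
  define v where "v x = u x - \<phi> 0 x" for x
  have [measurable]: "v \<in> borel_measurable (lebesgue_on \<Omega>)" unfolding v_def[abs_def] by (rule meas_diff)
  have [measurable]: "\<psi> n \<in> borel_measurable (lebesgue_on \<Omega>)" for n unfolding \<psi>_def[abs_def] by measurable
  have v_bound: "(\<integral>\<^sup>+x. ?f v x \<partial>lebesgue_on \<Omega>) \<le> ennreal M"
  proof -
    have "(\<integral>\<^sup>+x. ?f v x \<partial>lebesgue_on \<Omega>) = (\<integral>\<^sup>+x. liminf (\<lambda>n. ?f (\<psi> n) x) \<partial>lebesgue_on \<Omega>)"
    proof (rule nn_integral_cong_AE)
      show "AE x in lebesgue_on \<Omega>. ?f v x = liminf (\<lambda>n. ?f (\<psi> n) x)"
        using conv
      proof eventually_elim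
        case (elim x)
        have "(\<lambda>n. \<psi> n x) \<longlonglongrightarrow> v x" unfolding \<psi>_def v_def by (intro tendsto_intros elim)
        then have "(\<lambda>n. \<beta> * \<bar>\<psi> n x\<bar> powr q) \<longlonglongrightarrow> \<beta> * \<bar>v x\<bar> powr q"
          using q by (intro tendsto_intros tendsto_powr') auto
        then have "(\<lambda>n. exp_tail m (\<beta> * \<bar>\<psi> n x\<bar> powr q)) \<longlonglongrightarrow> exp_tail m (\<beta> * \<bar>v x\<bar> powr q)"
          by (rule continuous_on_tendsto_compose[OF continuous_on_exp_tail[of UNIV]]) auto
        then have "(\<lambda>n. ?f (\<psi> n) x) \<longlonglongrightarrow> ?f v x"
          by (intro ennreal_tendsto_cmult tendsto_ennrealI) (simp add: distance_weight_def)
        then show ?case by (intro lim_imp_Liminf[symmetric]) auto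
      qed
    qed
    also have "\<dots> \<le> liminf (\<lambda>n. (\<integral>\<^sup>+x. ?f (\<psi> n) x \<partial>lebesgue_on \<Omega>))"
      by (rule nn_integral_liminf) measurable
    also have "\<dots> \<le> ennreal M"
      using Liminf_mono[of "\<lambda>n. (\<integral>\<^sup>+x. ?f (\<psi> n) x \<partial>lebesgue_on \<Omega>)" "\<lambda>_. ennreal M" sequentially] \<psi>_bound
      by (simp add: Liminf_const)
    finally show ?thesis .
  qed
  have \<phi>_bound: "(\<integral>\<^sup>+x. ?f (\<phi> 0) x \<partial>lebesgue_on \<Omega>) < \<infinity>"
  proof -
    let ?C = "closure {x. \<phi> 0 x \<noteq> 0}"
    have C: "compact ?C" "?C \<subseteq> \<Omega> - K" using \<phi>(1)[of 0] by (auto simp: test_functions_def)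
    obtain \<delta> where \<delta>: "0 < \<delta>" "\<And>x y. x \<in> ?C \<Longrightarrow> y \<in> K \<Longrightarrow> \<delta> \<le> dist x y"
      using separate_compact_closed[OF C(1) compact_imp_closed[OF K(1)]] C(2) by blast
    have "bounded (\<phi> 0 ` ?C)"
      by (intro compact_imp_bounded compact_continuous_image C continuous_on_subset[OF cont]) auto
    then obtain b where b: "0 < b" "\<And>x. x \<in> ?C \<Longrightarrow> \<bar>\<phi> 0 x\<bar> \<le> b" by (auto simp: bounded_pos)
    define c where "c = 1 / \<delta> ^ CARD('d)"
    have pt: "?f (\<phi> 0) x \<le> ennreal c * ennreal (exp_tail m (\<beta> * b powr q))" for x
    proof (cases "x \<in> ?C")
      case True
      have "?w x \<le> ennreal c"
      proof (cases "K = {}")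
        case False
        then have "\<delta> \<le> infdist x K" using \<delta>(2)[OF True] by (auto simp: infdist_def intro!: cINF_greatest)
        then show ?thesis
          unfolding distance_weight_def c_def using \<delta>(1) by (auto intro!: ennreal_leI frac_le power_mono)
      qed (simp add: distance_weight_def infdist_def power_0_left)
      moreover have "exp_tail m (\<beta> * \<bar>\<phi> 0 x\<bar> powr q) \<le> exp_tail m (\<beta> * b powr q)"
        using b(2)[OF True] \<beta> q by (intro exp_tail_mono mult_left_mono powr_mono2) auto
      ultimately show ?thesis by (intro mult_mono ennreal_leI) auto
    next
      case False
      then have "\<phi> 0 x = 0" using closure_subset[of "{x. \<phi> 0 x \<noteq> 0}"] by auto
      then show ?thesis using q m exp_tail_0[of m] by simp
    qed
    have "(\<integral>\<^sup>+x. ?f (\<phi> 0) x \<partial>lebesgue_on \<Omega>) \<le> (\<integral>\<^sup>+x. ennreal c * ennreal (exp_tail m (\<beta> * b powr q)) \<partial>lebesgue_on \<Omega>)"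
      by (intro nn_integral_mono pt)
    also have "\<dots> = ennreal c * ennreal (exp_tail m (\<beta> * b powr q)) * emeasure lborel \<Omega>"
      using \<Omega> by (simp add: emeasure_restrict_space)
    also have "\<dots> < \<infinity>" using emeasure_bounded_finite[OF \<Omega>(2)] by (simp add: ennreal_mult_less_top)
    finally show ?thesis .
  qed
  have pt: "ennreal (Phi d s (\<alpha> * \<bar>u x\<bar> powr (real d / (real d - s))) * (1 / infdist x K ^ d)) \<le> ?f (\<phi> 0) x + ?f v x" for x
  proof -
    have "exp_tail m (\<alpha> * \<bar>u x\<bar> powr q) \<le> exp_tail m (\<beta> * \<bar>\<phi> 0 x\<bar> powr q) + exp_tail m (\<beta> * \<bar>v x\<bar> powr q)"
      unfolding \<beta>_def using q assms(13) by (intro exp_tail_max) (auto simp: v_def)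
    then have "ennreal (exp_tail m (\<alpha> * \<bar>u x\<bar> powr q)) \<le> ennreal (exp_tail m (\<beta> * \<bar>\<phi> 0 x\<bar> powr q)) + ennreal (exp_tail m (\<beta> * \<bar>v x\<bar> powr q))"
      using \<beta> by (simp add: exp_tail_nonneg flip: ennreal_plus)
    from mult_left_mono[OF this, of "?w x"]
    have "?w x * ennreal (exp_tail m (\<alpha> * \<bar>u x\<bar> powr q)) \<le> ?f (\<phi> 0) x + ?f v x"
      by (simp add: distrib_left)
    moreover have "ennreal (Phi d s (\<alpha> * \<bar>u x\<bar> powr (real d / (real d - s))) * (1 / infdist x K ^ d))
        = ?w x * ennreal (exp_tail m (\<alpha> * \<bar>u x\<bar> powr q))"
      unfolding Phi q(2) distance_weight_def using assms(1,13)
      by (subst ennreal_mult) (auto simp: exp_tail_nonneg mult.commute infdist_nonneg)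
    ultimately show ?thesis by simp
  qed
  have "(\<integral>\<^sup>+x\<in>\<Omega>. ennreal (Phi d s (\<alpha> * \<bar>u x\<bar> powr (real d / (real d - s))) * (1 / infdist x K ^ d)) \<partial>lebesgue)
      \<le> (\<integral>\<^sup>+x. ?f (\<phi> 0) x + ?f v x \<partial>lebesgue_on \<Omega>)"
    unfolding restr by (intro nn_integral_mono pt)
  also have "\<dots> = (\<integral>\<^sup>+x. ?f (\<phi> 0) x \<partial>lebesgue_on \<Omega>) + (\<integral>\<^sup>+x. ?f v x \<partial>lebesgue_on \<Omega>)"
    by (rule nn_integral_add) measurable
  also have "\<dots> < \<infinity>" using \<phi>_bound v_bound by (auto simp: less_top[symmetric] top_unique)
  finally show ?thesis .
qed

end
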